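(* Let $(X,D)$ be a toric pair of dimension $d-1\ge1$ over an algebraically closed field $K$ of characteristic $p>0$. Then $$\big(e_0(X,D)\big)^{\frac{2-d}{d-1}}\lim_{k\to\infty}\frac{e_{HK}(X,kD)-e_0(X,kD)/d!}{k^{d-2}}\;\ge\;\Big[\frac{d-1}{d}\Big]\big[(d-1)!\big]^{\frac{2-d}{d-1}}.$$ Moreover, equality $$\big(e_0(X,D)\big)^{\frac{2-d}{d-1}}\lim_{k\to\infty}\frac{e_{HK}(X,kD)-e_0(X,kD)/d!}{k^{d-2}}=\Big[\frac{d-1}{d}\Big]\big[(d-1)!\big]^{\frac{2-d}{d-1}}$$ holds if and only if the polytope $P_D$ tiles the space $\mathbb{R}^{d-1}$ for some $\lambda>0$.
   Context: Toric pair: Let $T$ be a torus with cocharacter lattice $N\cong\mathbb{Z}^{d-1}$ and character lattice $M=\mathrm{Hom}(N,\mathbb{Z})$, identified with $\mathbb{Z}^{d-1}$, so $M_{\mathbb{R}}=\mathbb{R}^{d-1}$. A toric pair $(X,D)$ consists of a projective toric variety $X$ of dimension $d-1\ge1$ over $K$, given by a complete fan in $N_{\mathbb{R}}$ whose rays have primitive generators $v_1,\dots,v_n$, and a very ample $T$-Cartier divisor $D=\sum_i a_iD_i$ on $X$ ($a_i\in\mathbb{Z}$, $D_i$ the $T$-invariant prime divisor corresponding to $v_i$). Its associated lattice polytope is $P_D=\{u\in M_{\mathbb{R}}\mid \langle u,v_i\rangle\ge -a_i \text{ for all } i\}$. For real $\lambda>0$, $P_{\lambda D}:=\lambda P_D$.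 Homogeneous coordinate ring and multiplicities: if $P_D\cap M=\{u_1,\dots,u_r\}$ and $S\subset M\times\mathbb{Z}$ is the semigroup generated by $(u_1,1),\dots,(u_r,1)$, the homogeneous coordinate ring of $(X,D)$ is $R=K[S]=K[\chi^{(u_1,1)},\dots,\chi^{(u_r,1)}]$, a standard graded ring of dimension $d$ with $\deg\chi^{(u_i,1)}=1$ and graded maximal ideal $\mathbf{m}$. $e_0(X,D)=e_0(R,\mathbf{m})$ is the Hilbert-Samuel multiplicity, and $e_{HK}(X,D)=e_{HK}(R,\mathbf{m})=\lim_{n\to\infty}\ell(R/\mathbf{m}^{[q]})/q^{d}$, $q=p^n$, is the Hilbert-Kunz multiplicity, where $\mathbf{m}^{[q]}$ is the ideal generated by $q$-th powers of elements of $\mathbf{m}$. $e_0(X,kD)$ and $e_{HK}(X,kD)$ are the same invariants for the toric pair $(X,kD)$. Tiling: $P_D$ tiles the space $\mathbb{R}^{d-1}$ for $\lambda>0$ if (1) $\bigcup_{v\in\mathbb{Z}^{d-1}}(v+P_{\lambda D})=\mathbb{R}^{d-1}$, and (2) $\dim\big[(v+P_{\lambda D})\cap(v'+P_{\lambda D})\big]<d-1$ for all $v\ne v'$ in $\mathbb{Z}^{d-1}$. *)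

theory Defs
  imports
    "HOL-Analysis.Analysis"
    "HOL-Library.Poly_Mapping"
    "HOL-Library.Extended_Nat"
    "HOL-Computational_Algebra.Polynomial"
    "HOL-Algebra.Ideal_Product"
begin

section \<open>Lengths and multiplicities\<close>

text \<open>
  For an ideal \<open>I\<close> of a commutative ring \<open>R\<close>, the \<open>R\<close>-submodules of \<open>R/I\<close> are the ideals of \<open>R\<close>
  containing \<open>I\<close>, so the length of \<open>R/I\<close> is the supremum of the lengths of strictly
  increasing chains of such ideals.
\<close>
definition quotient_length :: "('a, 'b) ring_scheme \<Rightarrow> 'a set \<Rightarrow> enat" where
  "quotient_length R I =
     Sup {enat l | l. \<exists>J :: nat \<Rightarrow> 'a set.
            (\<forall>i\<le>l. ideal (J i) R \<and> I \<subseteq> J i) \<and> (\<forall>i<l. J i \<subset> J (Suc i))}"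

text \<open>In both multiplicities \<open>d\<close> stands for the dimension of \<open>R\<close>. The lengths involved are finite
  in the intended case of a maximal ideal of a Noetherian ring.\<close>

definition hilbert_samuel_mult :: "('a, 'b) ring_scheme \<Rightarrow> 'a set \<Rightarrow> nat \<Rightarrow> real" where
  "hilbert_samuel_mult R I d =
     lim (\<lambda>n. fact d * real (the_enat (quotient_length R (I [^]\<^bsub>ideals_set R\<^esub> n))) / real n ^ d)"

definition frobenius_power :: "('a, 'b) ring_scheme \<Rightarrow> 'a set \<Rightarrow> nat \<Rightarrow> 'a set" where
  "frobenius_power R I q = genideal R ((\<lambda>f. f [^]\<^bsub>R\<^esub> q) ` I)"

definition hilbert_kunz_mult :: "nat \<Rightarrow> ('a, 'b) ring_scheme \<Rightarrow> 'a set \<Rightarrow> nat \<Rightarrow> real" where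
  "hilbert_kunz_mult p R I d =
     lim (\<lambda>n. real (the_enat (quotient_length R (frobenius_power R I (p ^ n)))) / real (p ^ n) ^ d)"


section \<open>Semigroup algebras\<close>

inductive_set generated_semigroup :: "'s::comm_monoid_add set \<Rightarrow> 's set" for G where
  zero: "0 \<in> generated_semigroup G"
| add: "g \<in> G \<Longrightarrow> s \<in> generated_semigroup G \<Longrightarrow> g + s \<in> generated_semigroup G"

text \<open>Elements of \<open>K[S]\<close> are finitely supported functions on the ambient group, with support in
  \<open>S\<close>; multiplication is convolution, so \<open>Poly_Mapping.single s 1\<close> is the character of \<open>s\<close>.\<close>

definition semigroup_algebra :: "'s::comm_monoid_add set \<Rightarrow> ('s \<Rightarrow>\<^sub>0 'k::field) set" where
  "semigroup_algebra S = {f. Poly_Mapping.keys f \<subseteq> S}"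

definition semigroup_ring :: "'s::comm_monoid_add set \<Rightarrow> ('s \<Rightarrow>\<^sub>0 'k::field) ring" where
  "semigroup_ring S =
     \<lparr>carrier = semigroup_algebra S, mult = (*), one = 1, zero = 0, add = (+)\<rparr>"


section \<open>Complete fans and torus-invariant divisors\<close>

text \<open>
  Both the character lattice \<open>M\<close> and the cocharacter lattice \<open>N\<close> are \<open>int ^ 'n\<close>, paired by the
  standard bilinear form; \<open>CARD('n)\<close> is the dimension of the torus.
\<close>

definition rvec :: "int ^ 'n \<Rightarrow> real ^ 'n" where
  "rvec m = (\<chi> i. real_of_int (m $ i))"

definition strongly_convex_rational_cone :: "(real ^ 'n) set \<Rightarrow> bool" where
  "strongly_convex_rational_cone \<sigma> \<longleftrightarrow>
     (\<exists>A :: (int ^ 'n) set. finite A \<and> \<sigma> = convex_cone hull (rvec ` A)) \<and>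
     (\<forall>x\<in>\<sigma>. - x \<in> \<sigma> \<longrightarrow> x = 0)"

text \<open>The empty set has to be excluded below since \<^term>\<open>{} face_of \<sigma>\<close> always holds.\<close>

definition complete_fan :: "(real ^ 'n) set set \<Rightarrow> bool" where
  "complete_fan \<Delta> \<longleftrightarrow> finite \<Delta> \<and>
     (\<forall>\<sigma>\<in>\<Delta>. strongly_convex_rational_cone \<sigma>) \<and>
     (\<forall>\<sigma>\<in>\<Delta>. \<forall>\<tau>. \<tau> face_of \<sigma> \<and> \<tau> \<noteq> {} \<longrightarrow> \<tau> \<in> \<Delta>) \<and>
     (\<forall>\<sigma>\<in>\<Delta>. \<forall>\<tau>\<in>\<Delta>. (\<sigma> \<inter> \<tau>) face_of \<sigma> \<and> (\<sigma> \<inter> \<tau>) face_of \<tau>) \<and>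
     \<Union>\<Delta> = UNIV"

definition primitive :: "int ^ 'n \<Rightarrow> bool" where
  "primitive v \<longleftrightarrow> Gcd (range (\<lambda>i. v $ i)) = 1"

text \<open>The primitive generators \<open>v\<^sub>1, \<dots>, v\<^sub>n\<close> of the rays.\<close>

definition ray_gens :: "(real ^ 'n) set set \<Rightarrow> (int ^ 'n) set" where
  "ray_gens \<Delta> = {v. primitive v \<and> convex_cone hull {rvec v} \<in> \<Delta>}"

text \<open>
  A torus-invariant Weil divisor \<open>\<Sum>\<^sub>i a\<^sub>i D\<^sub>i\<close> is given by its coefficients, as a function \<open>a\<close> of the
  ray generators (only the values on \<^const>\<open>ray_gens\<close> matter). On the affine chart of \<open>\<sigma>\<close>
  it is the divisor of the character \<open>- m\<close> iff \<open>\<langle>m, v\<rangle> = - a v\<close> for all ray generators \<open>v\<close> in \<open>\<sigma>\<close>.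
\<close>
definition local_datum ::
  "(real ^ 'n) set set \<Rightarrow> (int ^ 'n \<Rightarrow> int) \<Rightarrow> (real ^ 'n) set \<Rightarrow> int ^ 'n \<Rightarrow> bool" where
  "local_datum \<Delta> a \<sigma> m \<longleftrightarrow>
     (\<forall>v\<in>ray_gens \<Delta>. rvec v \<in> \<sigma> \<longrightarrow> rvec m \<bullet> rvec v = - real_of_int (a v))"

definition T_Cartier :: "(real ^ 'n) set set \<Rightarrow> (int ^ 'n \<Rightarrow> int) \<Rightarrow> bool" where
  "T_Cartier \<Delta> a \<longleftrightarrow> (\<forall>\<sigma>\<in>\<Delta>. \<exists>m. local_datum \<Delta> a \<sigma> m)"

definition divisor_polytope ::
  "(real ^ 'n) set set \<Rightarrow> (int ^ 'n \<Rightarrow> int) \<Rightarrow> (real ^ 'n) set" where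
  "divisor_polytope \<Delta> a = {u. \<forall>v\<in>ray_gens \<Delta>. u \<bullet> rvec v \<ge> - real_of_int (a v)}"

definition lattice_points :: "(real ^ 'n) set \<Rightarrow> (int ^ 'n) set" where
  "lattice_points P = {u. rvec u \<in> P}"


section \<open>The toric variety of a fan\<close>

text \<open>
  Varieties over an algebraically closed field \<open>K\<close> are described classically, by closed points,
  the Zariski topology and regular functions. A closed point of the chart
  \<open>U\<^sub>\<sigma> = Spec K[\<sigma>\<^sup>\<or> \<inter> M]\<close> is a semigroup homomorphism \<open>\<sigma>\<^sup>\<or> \<inter> M \<rightarrow> (K, \<cdot>)\<close>. It is nonzero exactly on
  \<open>\<tau>\<^sup>\<bottom> \<inter> \<sigma>\<^sup>\<or> \<inter> M\<close> for a unique face \<open>\<tau>\<close> of \<open>\<sigma>\<close> and is determined by a group homomorphism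
  \<open>\<tau>\<^sup>\<bottom> \<inter> M \<rightarrow> K\<^sup>*\<close>. Gluing \<open>U\<^sub>\<sigma>\<close> and \<open>U\<^sub>\<sigma>\<^sub>'\<close> along \<open>U\<^sub>\<sigma>\<^sub>\<inter>\<^sub>\<sigma>\<^sub>'\<close> identifies exactly the points with the
  same \<open>\<tau>\<close> and the same homomorphism, so a closed point of the variety is a pair \<open>(\<tau>, x)\<close> of
  this form (the torus orbit decomposition), where \<open>x\<close> is extended by \<open>0\<close> to all of \<open>M\<close>.
\<close>

definition dual_lattice_cone :: "(real ^ 'n) set \<Rightarrow> (int ^ 'n) set" where
  "dual_lattice_cone \<sigma> = {m. \<forall>x\<in>\<sigma>. rvec m \<bullet> x \<ge> 0}"

definition perp_lattice :: "(real ^ 'n) set \<Rightarrow> (int ^ 'n) set" where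
  "perp_lattice \<tau> = {m. \<forall>x\<in>\<tau>. rvec m \<bullet> x = 0}"

type_synonym ('n, 'k) toric_point = "(real ^ 'n) set \<times> (int ^ 'n \<Rightarrow> 'k)"

definition toric_points :: "(real ^ 'n) set set \<Rightarrow> ('n, 'k::field) toric_point set" where
  "toric_points \<Delta> = {(\<tau>, x). \<tau> \<in> \<Delta> \<and> x 0 = 1 \<and> (\<forall>m. x m \<noteq> 0 \<longleftrightarrow> m \<in> perp_lattice \<tau>) \<and>
     (\<forall>m\<in>perp_lattice \<tau>. \<forall>m'\<in>perp_lattice \<tau>. x (m + m') = x m * x m')}"

definition toric_chart ::
  "(real ^ 'n) set set \<Rightarrow> (real ^ 'n) set \<Rightarrow> ('n, 'k::field) toric_point set" where
  "toric_chart \<Delta> \<sigma> = {q \<in> toric_points \<Delta>. fst q face_of \<sigma>}"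

text \<open>The value of \<open>f \<in> K[\<sigma>\<^sup>\<or> \<inter> M]\<close> at a point of \<open>U\<^sub>\<sigma>\<close>.\<close>

definition toric_eval :: "(int ^ 'n \<Rightarrow>\<^sub>0 'k::field) \<Rightarrow> ('n, 'k) toric_point \<Rightarrow> 'k" where
  "toric_eval f q = (\<Sum>m\<in>Poly_Mapping.keys f. Poly_Mapping.lookup f m * snd q m)"

definition toric_variety :: "(real ^ 'n) set set \<Rightarrow> ('n, 'k::field) toric_point topology" where
  "toric_variety \<Delta> = topology_generated_by
     {{q \<in> toric_chart \<Delta> \<sigma>. toric_eval f q \<noteq> 0} | \<sigma> f.
        \<sigma> \<in> \<Delta> \<and> f \<in> semigroup_algebra (dual_lattice_cone \<sigma>)}"

text \<open>Regularity of a function on an open set \<open>U\<close>; values outside \<open>U\<close> are irrelevant.\<close>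

definition toric_regular ::
  "(real ^ 'n) set set \<Rightarrow> ('n, 'k::field) toric_point set \<Rightarrow> (('n, 'k) toric_point \<Rightarrow> 'k) \<Rightarrow> bool"
  where
  "toric_regular \<Delta> U f \<longleftrightarrow>
     (\<forall>q\<in>U. \<exists>\<sigma>\<in>\<Delta>. \<exists>g\<in>semigroup_algebra (dual_lattice_cone \<sigma>).
        \<exists>h\<in>semigroup_algebra (dual_lattice_cone \<sigma>). \<exists>V.
          openin (toric_variety \<Delta>) V \<and> q \<in> V \<and> V \<subseteq> U \<inter> toric_chart \<Delta> \<sigma> \<and>
          (\<forall>w\<in>V. toric_eval h w \<noteq> 0 \<and> f w = toric_eval g w / toric_eval h w))"


section \<open>Projective space\<close>

text \<open>
  Projective space with homogeneous coordinates indexed by a finite set \<open>B\<close>. A point is the set of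
  all nonzero multiples of a nonzero vector supported on \<open>B\<close>. Polynomials are
  finitely supported functions on the monomials \<open>'i \<Rightarrow>\<^sub>0 nat\<close>.
\<close>

definition proj_class :: "('i \<Rightarrow> 'k::field) \<Rightarrow> ('i \<Rightarrow> 'k) set" where
  "proj_class y = {(\<lambda>i. c * y i) | c. c \<noteq> 0}"

definition proj_points :: "'i set \<Rightarrow> ('i \<Rightarrow> 'k::field) set set" where
  "proj_points B = {proj_class y | y. (\<exists>i. y i \<noteq> 0) \<and> (\<forall>i. i \<notin> B \<longrightarrow> y i = 0)}"

definition form :: "'i set \<Rightarrow> nat \<Rightarrow> (('i \<Rightarrow>\<^sub>0 nat) \<Rightarrow>\<^sub>0 'k::field) \<Rightarrow> bool" where
  "form B e F \<longleftrightarrow> (\<forall>t\<in>Poly_Mapping.keys F. Poly_Mapping.keys t \<subseteq> B \<and>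
     (\<Sum>i\<in>Poly_Mapping.keys t. Poly_Mapping.lookup t i) = e)"

definition form_eval :: "(('i \<Rightarrow>\<^sub>0 nat) \<Rightarrow>\<^sub>0 'k::field) \<Rightarrow> ('i \<Rightarrow> 'k) \<Rightarrow> 'k" where
  "form_eval F y = (\<Sum>t\<in>Poly_Mapping.keys F. Poly_Mapping.lookup F t *
     (\<Prod>i\<in>Poly_Mapping.keys t. y i ^ Poly_Mapping.lookup t i))"

definition proj_space :: "'i set \<Rightarrow> ('i \<Rightarrow> 'k::field) set topology" where
  "proj_space B = topology_generated_by
     {{z \<in> proj_points B. \<forall>y\<in>z. form_eval F y \<noteq> 0} | F e. form B e F}"

definition proj_regular ::
  "'i set \<Rightarrow> ('i \<Rightarrow> 'k::field) set set \<Rightarrow> (('i \<Rightarrow> 'k) set \<Rightarrow> 'k) \<Rightarrow> bool" where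
  "proj_regular B U f \<longleftrightarrow>
     (\<forall>z\<in>U. \<exists>e G H V. form B e G \<and> form B e H \<and>
        openin (proj_space B) V \<and> z \<in> V \<and> V \<subseteq> U \<and>
        (\<forall>w\<in>V. \<forall>y\<in>w. form_eval H y \<noteq> 0 \<and> f w = form_eval G y / form_eval H y))"


section \<open>Very ample divisors and toric pairs\<close>

text \<open>
  Closed embeddings of varieties \<open>(X, O\<^sub>X) \<rightarrow> (Y, O\<^sub>Y)\<close>, where \<open>O U f\<close> says that \<open>f\<close> is regular on the
  open set \<open>U\<close>: a morphism that is a homeomorphism onto a closed subset and for which
  \<open>O\<^sub>Y \<rightarrow> \<phi>\<^sub>* O\<^sub>X\<close> is surjective on stalks.
\<close>
definition closed_embedding ::
  "'a topology \<Rightarrow> ('a set \<Rightarrow> ('a \<Rightarrow> 'k) \<Rightarrow> bool) \<Rightarrow>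
   'b topology \<Rightarrow> ('b set \<Rightarrow> ('b \<Rightarrow> 'k) \<Rightarrow> bool) \<Rightarrow> ('a \<Rightarrow> 'b) \<Rightarrow> bool" where
  "closed_embedding X OX Y OY \<phi> \<longleftrightarrow>
     continuous_map X Y \<phi> \<and>
     (\<forall>V g. openin Y V \<and> OY V g \<longrightarrow> OX {x \<in> topspace X. \<phi> x \<in> V} (g \<circ> \<phi>)) \<and>
     inj_on \<phi> (topspace X) \<and> closed_map X Y \<phi> \<and>
     (\<forall>U f. \<forall>x\<in>U. openin X U \<and> OX U f \<longrightarrow>
        (\<exists>V g W. openin Y V \<and> OY V g \<and> openin X W \<and> x \<in> W \<and> W \<subseteq> U \<and>
           (\<forall>w\<in>W. \<phi> w \<in> V \<and> f w = g (\<phi> w))))"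

text \<open>
  The map \<open>\<phi>\<^sub>D = (\<chi>\<^bsup>u\<^sub>1\<^esup> : \<dots> : \<chi>\<^bsup>u\<^sub>r\<^esup>)\<close> given by the complete linear system of \<open>D\<close>, whose global sections
  have the basis \<open>\<chi>\<^sup>u\<close>, \<open>u \<in> P\<^sub>D \<inter> M\<close>. If \<open>D\<close> has local datum \<open>m\<close> on \<open>U\<^sub>\<tau>\<close>, then \<open>\<chi>\<^sup>m\<close> generates
  \<open>O(D)\<close> there, and the section \<open>\<chi>\<^sup>u\<close> is the function \<open>\<chi>\<^bsup>u - m\<^esup>\<close> in this trivialization.
  At a base point the value is the class of the zero vector, which is not a point of projective
  space; hence \<^const>\<open>closed_embedding\<close> also forces \<open>D\<close> to be base point free.
\<close>
definition divisor_map ::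
  "(real ^ 'n) set set \<Rightarrow> (int ^ 'n \<Rightarrow> int) \<Rightarrow> ('n, 'k::field) toric_point \<Rightarrow> (int ^ 'n \<Rightarrow> 'k) set"
  where
  "divisor_map \<Delta> a q = proj_class (\<lambda>u.
     if u \<in> lattice_points (divisor_polytope \<Delta> a)
     then snd q (u - (SOME m. local_datum \<Delta> a (fst q) m)) else 0)"

definition very_ample ::
  "'k::field itself \<Rightarrow> (real ^ 'n) set set \<Rightarrow> (int ^ 'n \<Rightarrow> int) \<Rightarrow> bool" where
  "very_ample K \<Delta> a \<longleftrightarrow>
     (let B = lattice_points (divisor_polytope \<Delta> a) in
      closed_embedding
        (toric_variety \<Delta> :: ('n, 'k) toric_point topology) (toric_regular \<Delta>)
        (proj_space B) (proj_regular B) (divisor_map \<Delta> a))"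

text \<open>Projectivity of the variety need not be required separately: it is witnessed by the divisor.\<close>

definition toric_pair ::
  "'k::field itself \<Rightarrow> (real ^ 'n) set set \<Rightarrow> (int ^ 'n \<Rightarrow> int) \<Rightarrow> bool" where
  "toric_pair K \<Delta> a \<longleftrightarrow> complete_fan \<Delta> \<and> T_Cartier \<Delta> a \<and> very_ample K \<Delta> a"


section \<open>Multiplicities of toric pairs\<close>

definition coord_semigroup ::
  "(real ^ 'n) set set \<Rightarrow> (int ^ 'n \<Rightarrow> int) \<Rightarrow> ((int ^ 'n) \<times> int) set" where
  "coord_semigroup \<Delta> a =
     generated_semigroup ((\<lambda>u. (u, 1)) ` lattice_points (divisor_polytope \<Delta> a))"

definition coord_ring ::
  "(real ^ 'n) set set \<Rightarrow> (int ^ 'n \<Rightarrow> int) \<Rightarrow> ((int ^ 'n) \<times> int \<Rightarrow>\<^sub>0 'k::field) ring" where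
  "coord_ring \<Delta> a = semigroup_ring (coord_semigroup \<Delta> a)"

definition coord_max_ideal ::
  "(real ^ 'n) set set \<Rightarrow> (int ^ 'n \<Rightarrow> int) \<Rightarrow> ((int ^ 'n) \<times> int \<Rightarrow>\<^sub>0 'k::field) set" where
  "coord_max_ideal \<Delta> a =
     {f \<in> carrier (coord_ring \<Delta> a). \<forall>s\<in>Poly_Mapping.keys f. snd s > 0}"

text \<open>The homogeneous coordinate ring has dimension \<open>CARD('n) + 1\<close>.\<close>

definition e0 ::
  "'k::field itself \<Rightarrow> (real ^ 'n) set set \<Rightarrow> (int ^ 'n \<Rightarrow> int) \<Rightarrow> real" where
  "e0 K \<Delta> a = hilbert_samuel_mult
     (coord_ring \<Delta> a :: ((int ^ 'n) \<times> int \<Rightarrow>\<^sub>0 'k) ring) (coord_max_ideal \<Delta> a) (CARD('n) + 1)"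

definition eHK ::
  "'k::field itself \<Rightarrow> (real ^ 'n) set set \<Rightarrow> (int ^ 'n \<Rightarrow> int) \<Rightarrow> real" where
  "eHK K \<Delta> a = hilbert_kunz_mult CHAR('k)
     (coord_ring \<Delta> a :: ((int ^ 'n) \<times> int \<Rightarrow>\<^sub>0 'k) ring) (coord_max_ideal \<Delta> a) (CARD('n) + 1)"

definition divisor_multiple :: "nat \<Rightarrow> (int ^ 'n \<Rightarrow> int) \<Rightarrow> (int ^ 'n \<Rightarrow> int)" where
  "divisor_multiple k a = (\<lambda>v. int k * a v)"


section \<open>Tilings\<close>

definition tiles_space_for :: "(real ^ 'n) set \<Rightarrow> real \<Rightarrow> bool" where
  "tiles_space_for P r \<longleftrightarrow>
     (\<Union>v :: int ^ 'n. (+) (rvec v) ` (*\<^sub>R) r ` P) = UNIV \<and>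
     (\<forall>v v' :: int ^ 'n. v \<noteq> v' \<longrightarrow>
        aff_dim ((+) (rvec v) ` (*\<^sub>R) r ` P \<inter> (+) (rvec v') ` (*\<^sub>R) r ` P) < int CARD('n))"

end

theory Submission
  imports Defs
begin

text \<open>
  Let \<open>P = P\<^sub>D\<close> and \<open>n = d - 1\<close>. Lengths of monomial quotients of \<open>K[S]\<close> count lattice points of the
  cone \<open>C\<close> over \<open>P \<times> {1}\<close>, so both multiplicities are volumes: \<open>e\<^sub>0 = n! vol P\<close>, and \<open>e\<^sub>H\<^sub>K\<close> is the volume
  of \<open>C\<close> minus the translates of \<open>C\<close> by the \<open>(u, 1)\<close> with \<open>u \<in> P \<inter> M\<close>. Below height 1 nothing
  is removed, which accounts for \<open>e\<^sub>0 / d!\<close>. For \<open>k P\<close> the slice at height \<open>1 + l / k\<close> is what the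
  lattice translates of \<open>l P\<close> leave uncovered in \<open>(k + l) P\<close>. Divided by \<open>k\<^sup>n\<close>, its volume tends to
  \<open>vol P \<cdot> \<psi> l\<close>, where \<open>\<psi> l\<close> is the volume of the part of a unit cell not covered by the lattice
  translates of \<open>l P\<close>. Hence the limit is \<open>vol P\<close> times the integral of \<open>\<psi>\<close>. Since
  \<open>\<psi> l \<ge> max 0 (1 - l\<^sup>n vol P)\<close>, with equality for almost all \<open>l\<close> iff some dilate of \<open>P\<close> tiles, the theorem
  follows by integration.

  Of very ampleness only two consequences are used. Base point freeness makes \<open>P\<close> the convex hull of
  its lattice points. Surjectivity on the stalk at the unit of the torus forces the differences of
  the lattice points of \<open>P\<close> to generate \<open>M\<close>; it suffices to evaluate along one-parameter subgroups.
\<close>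

section \<open>Monomial ideals in semigroup algebras\<close>

text \<open>The ring K[S] need not be normal: S can miss lattice points of \<open>C\<close>. A
  conductor element c, with c + z in S for every lattice point z of \<open>C\<close>, repairs this,
  since a fixed shift disappears after division by q and only the frontier of \<open>C\<close>, a
  null set, stays undecided. It is available because S generates the full lattice as a group; a
  sublattice of index j would divide every count by j.

  All limits are taken by dominated convergence. Replacing a lattice point by a cube of side 1 / q
  turns a normalized count into a volume, and the factor l stays in a range that does not depend on
  k.

  The constant arises as follows. With r = V^(-1/n), the factor at which r P has volume 1, the
  integral of max 0 (1 - l^n V) is r n / (n + 1), and the power e_0^(1/n - 1) cancels every V.

  In the equality case the integrands agree only almost everywhere, while a tiling must cover every
  point. Covering at r is therefore obtained as a limit of almost coverings from the right, and the
  absence of overlaps then follows by comparing volumes.\<close>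

lemma nat_pow_semigroup_ring:
  "f [^]\<^bsub>semigroup_ring S\<^esub> (n::nat) = f ^ n"
  by (induction n) (simp_all add: semigroup_ring_def nat_pow_def mult.commute)

lemma semigroup_ring_simps [simp]:
  "carrier (semigroup_ring S) = semigroup_algebra S"
  "f \<otimes>\<^bsub>semigroup_ring S\<^esub> g = f * g"
  "f \<oplus>\<^bsub>semigroup_ring S\<^esub> g = f + g"
  "\<one>\<^bsub>semigroup_ring S\<^esub> = 1"
  "\<zero>\<^bsub>semigroup_ring S\<^esub> = 0"
  by (simp_all add: semigroup_ring_def)

lemma semigroup_algebra_simps [simp]:
  "0 \<in> semigroup_algebra T"
  "Poly_Mapping.single s c \<in> semigroup_algebra T \<longleftrightarrow> s \<in> T \<or> c = 0"
  by (auto simp: semigroup_algebra_def)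

lemma semigroup_algebra_add:
  "f \<in> semigroup_algebra T \<Longrightarrow> g \<in> semigroup_algebra T \<Longrightarrow> f + g \<in> semigroup_algebra T"
  unfolding semigroup_algebra_def using Poly_Mapping.keys_add[of f g] by auto

lemma semigroup_algebra_uminus:
  "f \<in> semigroup_algebra T \<Longrightarrow> - f \<in> semigroup_algebra T"
  by (auto simp: semigroup_algebra_def in_keys_iff)

lemma semigroup_algebra_sum:
  "(\<And>i. i \<in> I \<Longrightarrow> f i \<in> semigroup_algebra T) \<Longrightarrow> sum f I \<in> semigroup_algebra T"
  by (induction I rule: infinite_finite_induct) (auto intro: semigroup_algebra_add)

lemma semigroup_algebra_mult:
  assumes "f \<in> semigroup_algebra A" "g \<in> semigroup_algebra B"
    and "\<And>a b. a \<in> A \<Longrightarrow> b \<in> B \<Longrightarrow> a + b \<in> C"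
  shows "f * g \<in> semigroup_algebra C"
  using assms keys_mult[of f g] unfolding semigroup_algebra_def by fast

lemma poly_mapping_eq_sum_single:
  "f = (\<Sum>k\<in>Poly_Mapping.keys f. Poly_Mapping.single k (Poly_Mapping.lookup f k))"
proof (rule poly_mapping_eqI)
  fix k
  show "Poly_Mapping.lookup f k =
    Poly_Mapping.lookup (\<Sum>k\<in>Poly_Mapping.keys f. Poly_Mapping.single k (Poly_Mapping.lookup f k)) k"
    by (simp add: lookup_sum lookup_single when_def in_keys_iff)
qed

locale submonoid =
  fixes S :: "'s::comm_monoid_add set"
  assumes zero_mem: "0 \<in> S" and add_mem: "a \<in> S \<Longrightarrow> b \<in> S \<Longrightarrow> a + b \<in> S"
begin

lemma cring_semigroup_ring: "cring (semigroup_ring S :: ('s \<Rightarrow>\<^sub>0 'k::field) ring)"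
proof (rule cringI)
  show "abelian_group (semigroup_ring S :: ('s \<Rightarrow>\<^sub>0 'k::field) ring)"
  proof (rule abelian_groupI)
    fix f :: "'s \<Rightarrow>\<^sub>0 'k" assume "f \<in> carrier (semigroup_ring S)"
    then show "\<exists>g\<in>carrier (semigroup_ring S). g \<oplus>\<^bsub>semigroup_ring S\<^esub> f = \<zero>\<^bsub>semigroup_ring S\<^esub>"
      by (intro bexI[of _ "- f"]) (auto intro: semigroup_algebra_uminus)
  qed (auto simp: algebra_simps intro: semigroup_algebra_add)
  show "comm_monoid (semigroup_ring S :: ('s \<Rightarrow>\<^sub>0 'k::field) ring)"
    by (rule comm_monoidI)
      (use semigroup_algebra_simps(2)[of 0 "1::'k" S] zero_mem in
        \<open>auto simp: mult_ac intro: semigroup_algebra_mult[where A=S and B=S] add_mem\<close>)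
qed (auto simp: algebra_simps)

lemma ideal_semigroup_algebra:
  assumes "T \<subseteq> S" "\<And>s t. s \<in> S \<Longrightarrow> t \<in> T \<Longrightarrow> s + t \<in> T"
  shows "ideal (semigroup_algebra T) (semigroup_ring S :: ('s \<Rightarrow>\<^sub>0 'k::field) ring)"
proof -
  interpret R: cring "semigroup_ring S :: ('s \<Rightarrow>\<^sub>0 'k::field) ring" by (rule cring_semigroup_ring)
  have sub: "f \<in> semigroup_algebra T \<Longrightarrow> f \<in> semigroup_algebra S" for f :: "'s \<Rightarrow>\<^sub>0 'k"
    using assms(1) by (auto simp: semigroup_algebra_def)
  show ?thesis
  proof (rule idealI)
    show "subgroup (semigroup_algebra T) (add_monoid (semigroup_ring S :: ('s \<Rightarrow>\<^sub>0 'k::field) ring))"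
    proof (rule R.add.subgroupI)
      fix f :: "'s \<Rightarrow>\<^sub>0 'k" assume f: "f \<in> semigroup_algebra T"
      then have "\<ominus>\<^bsub>semigroup_ring S\<^esub> f = - f"
        using R.minus_equality[of "- f" f] semigroup_algebra_uminus sub by auto
      then show "\<ominus>\<^bsub>semigroup_ring S\<^esub> f \<in> semigroup_algebra T"
        using f semigroup_algebra_uminus by simp
    qed (auto intro: sub semigroup_algebra_add intro!: exI[of _ 0] simp: ex_in_conv[symmetric])
  next
    fix f g :: "'s \<Rightarrow>\<^sub>0 'k"
    assume f: "f \<in> semigroup_algebra T" and g: "g \<in> carrier (semigroup_ring S)"
    have "g * f \<in> semigroup_algebra T"
      using semigroup_algebra_mult[of g S f T T] f g assms(2) by simp
    then show "g \<otimes>\<^bsub>semigroup_ring S\<^esub> f \<in> semigroup_algebra T"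
      "f \<otimes>\<^bsub>semigroup_ring S\<^esub> g \<in> semigroup_algebra T" by (simp_all add: mult.commute)
  qed (rule R.ring_axioms)
qed

lemma semigroup_algebra_subset_ideal:
  assumes J: "ideal J (semigroup_ring S :: ('s \<Rightarrow>\<^sub>0 'k::field) ring)"
    and T: "\<And>t. t \<in> T \<Longrightarrow> Poly_Mapping.single t 1 \<in> J"
  shows "semigroup_algebra T \<subseteq> J"
proof
  fix f :: "'s \<Rightarrow>\<^sub>0 'k" assume f: "f \<in> semigroup_algebra T"
  interpret ideal J "semigroup_ring S :: ('s \<Rightarrow>\<^sub>0 'k::field) ring" by (rule J)
  have sum: "(\<Sum>i\<in>I. h i) \<in> J" if "\<And>i. i \<in> I \<Longrightarrow> h i \<in> J" for h :: "'s \<Rightarrow> 's \<Rightarrow>\<^sub>0 'k" and I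
    using that additive_subgroup.zero_closed[OF ideal.axioms(1)[OF J]]
      additive_subgroup.a_closed[OF ideal.axioms(1)[OF J]]
    by (induction I rule: infinite_finite_induct) auto
  have "Poly_Mapping.single k c \<in> J" if "k \<in> T" for k c
    using I_l_closed[OF T[OF that], of "Poly_Mapping.single 0 c"] by (simp add: mult_single zero_mem)
  then show "f \<in> J"
    using f by (subst poly_mapping_eq_sum_single) (auto intro!: sum simp: semigroup_algebra_def)
qed

text \<open>Gaussian elimination in the finite-dimensional space K[S]/K[T]. To each ideal containing
  K[T] belongs the set \<open>LM\<close> of positions in \<open>S - T\<close> where one of its
  members has a leading coefficient; a strict inclusion of ideals makes this set strictly
  larger.\<close>

lemma ideal_chain_length_le:
  fixes J :: "nat \<Rightarrow> ('s \<Rightarrow>\<^sub>0 'k::field) set"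
  assumes fin: "finite (S - T)"
    and id: "\<And>i. i \<le> l \<Longrightarrow> ideal (J i) (semigroup_ring S)"
    and sub: "\<And>i. i \<le> l \<Longrightarrow> semigroup_algebra T \<subseteq> J i"
    and strict: "\<And>i. i < l \<Longrightarrow> J i \<subset> J (Suc i)"
  shows "l \<le> card (S - T)"
proof -
  \<comment> \<open>An arbitrary order of the positions will do, as leading terms are only cancelled
    by scalar multiples.\<close>
  obtain e :: "'s \<Rightarrow> nat" where e: "inj_on e (S - T)"
    using fin finite_imp_inj_to_nat_seg by blast
  define LM where "LM J = {s \<in> S - T. \<exists>f\<in>J. Poly_Mapping.lookup f s \<noteq> 0 \<and>
      (\<forall>s'\<in>S - T. e s < e s' \<longrightarrow> Poly_Mapping.lookup f s' = 0)}" for J :: "('s \<Rightarrow>\<^sub>0 'k) set"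
  have finLM: "finite (LM X)" for X by (rule finite_subset[OF _ fin]) (auto simp: LM_def)
  have eq: "X = Y" if X: "ideal X (semigroup_ring S)" and Y: "ideal Y (semigroup_ring S)"
    and XY: "X \<subseteq> Y" and TX: "semigroup_algebra T \<subseteq> X" and LM: "LM X = LM Y" for X Y
  proof -
    interpret X: ideal X "semigroup_ring S" by (rule X)
    interpret Y: ideal Y "semigroup_ring S" by (rule Y)
    have sc: "Poly_Mapping.single 0 c * g \<in> X" if "g \<in> X" for c g
      using X.I_l_closed[OF that, of "Poly_Mapping.single 0 c"] zero_mem by simp
    \<comment> \<open>Induction on a strict bound \<open>n\<close> for the positions that occur in
      \<open>f\<close> outside \<open>T\<close>: a leading coefficient is cancelled by a member of
      \<open>X\<close> with the same leading position.\<close>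
    have "f \<in> X" if "f \<in> Y" "\<forall>s\<in>S - T. n \<le> e s \<longrightarrow> Poly_Mapping.lookup f s = 0" for f n
      using that
    proof (induction n arbitrary: f)
      case 0
      have "Poly_Mapping.keys f \<subseteq> S"
        using Y.a_subset 0(1) by (auto simp: semigroup_algebra_def)
      then have "f \<in> semigroup_algebra T"
        using 0(2) by (auto simp: semigroup_algebra_def in_keys_iff)
      then show ?case using TX by auto
    next
      case (Suc n)
      show ?case
      proof (cases "\<exists>s\<in>S - T. e s = n \<and> Poly_Mapping.lookup f s \<noteq> 0")
        case False
        then show ?thesis using Suc.IH[OF Suc.prems(1)] Suc.prems(2) by (metis Suc_leI le_neq_implies_less)
      next
        case True
        then obtain s where s: "s \<in> S - T" "e s = n" "Poly_Mapping.lookup f s \<noteq> 0" by auto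
        then have "s \<in> LM Y" using Suc.prems by (auto simp: LM_def Suc_le_eq)
        then obtain g where g: "g \<in> X" "Poly_Mapping.lookup g s \<noteq> 0"
          "\<And>s'. s' \<in> S - T \<Longrightarrow> n < e s' \<Longrightarrow> Poly_Mapping.lookup g s' = 0"
          using s(2) unfolding LM[symmetric] by (auto simp: LM_def)
        define c where "c = Poly_Mapping.lookup f s / Poly_Mapping.lookup g s"
        define h where "h = Poly_Mapping.single 0 c * g"
        have lh: "Poly_Mapping.lookup h t = c * Poly_Mapping.lookup g t" for t
          unfolding h_def mult_map_scale_conv_mult[symmetric] by (simp add: Poly_Mapping.map.rep_eq when_def)
        have hX: "h \<in> X" "- h \<in> X" using sc g(1) by (auto simp: h_def) (metis sc mult_minus_left single_uminus)
        have "f + - h \<in> X"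
        proof (rule Suc.IH)
          show "f + - h \<in> Y" using additive_subgroup.a_closed[OF ideal.axioms(1)[OF Y], of f "- h"] Suc.prems(1) hX XY by auto
          show "\<forall>t\<in>S - T. n \<le> e t \<longrightarrow> Poly_Mapping.lookup (f + - h) t = 0"
          proof (intro ballI impI)
            fix t assume t: "t \<in> S - T" "n \<le> e t"
            show "Poly_Mapping.lookup (f + - h) t = 0"
            proof (cases "e t = n")
              case True
              then have "t = s" using e s t by (auto dest: inj_onD)
              then show ?thesis using g by (simp add: lookup_minus lh c_def)
            next
              case False
              then show ?thesis using t g(3) Suc.prems(2) by (simp add: lookup_minus lh)
            qed
          qed
        qed
        from additive_subgroup.a_closed[OF ideal.axioms(1)[OF X] this hX(1)]
        have "(f + - h) + h \<in> X" by (simp only: semigroup_ring_simps)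
        moreover have "(f + - h) + h = f" by (simp only: add.assoc add.left_inverse add_0_right)
        ultimately show ?thesis by simp
      qed
    qed note * = this
    have "f \<in> X" if "f \<in> Y" for f
    proof (rule *[OF that, of "Suc (Max (e ` (S - T)))"], intro ballI impI)
      fix s assume "s \<in> S - T" "Suc (Max (e ` (S - T))) \<le> e s"
      then show "Poly_Mapping.lookup f s = 0"
        using Max_ge[OF finite_imageI[OF fin], of "e s" e] by (metis imageI not_less_eq_eq)
    qed
    then show ?thesis using XY by auto
  qed
  have mono: "LM X \<subseteq> LM Y" if "X \<subseteq> Y" for X Y using that by (auto simp: LM_def)
  have "i \<le> card (LM (J i))" if "i \<le> l" for i
    using that
  proof (induction i)
    case (Suc i)
    have "LM (J i) \<subset> LM (J (Suc i))"
      using eq[OF id id, of i "Suc i"] strict[of i] sub[of i] mono[of "J i" "J (Suc i)"] Suc.prems by auto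
    then have "card (LM (J i)) < card (LM (J (Suc i)))" by (rule psubset_card_mono[OF finLM])
    then show ?case using Suc by simp
  qed simp
  from this[of l] have "l \<le> card (LM (J l))" by simp
  also have "\<dots> \<le> card (S - T)" by (rule card_mono[OF fin]) (auto simp: LM_def)
  finally show ?thesis .
qed

text \<open>Adjoining to \<open>T\<close> an element of \<open>S - T\<close> of maximal degree keeps
  \<open>T\<close> closed under translation by \<open>S\<close>: a proper translate of that element
  has larger degree, so it lies in \<open>T\<close> already. One monomial at a time gives the full
  length.\<close>

lemma ideal_chain_exists:
  fixes deg :: "'s \<Rightarrow> 'o::linorder"
  assumes deg: "\<And>s t. s \<in> S \<Longrightarrow> s \<noteq> 0 \<Longrightarrow> t \<in> S \<Longrightarrow> deg t < deg (s + t)"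
    and "finite (S - T)" "T \<subseteq> S" "\<And>s t. s \<in> S \<Longrightarrow> t \<in> T \<Longrightarrow> s + t \<in> T"
  shows "\<exists>J :: nat \<Rightarrow> ('s \<Rightarrow>\<^sub>0 'k::field) set.
    (\<forall>i\<le>card (S - T). ideal (J i) (semigroup_ring S) \<and> semigroup_algebra T \<subseteq> J i) \<and>
    (\<forall>i<card (S - T). J i \<subset> J (Suc i))"
  using assms(2-)
proof (induction "card (S - T)" arbitrary: T)
  case 0
  then show ?case using ideal_semigroup_algebra[of T]
    by (intro exI[of _ "\<lambda>_. semigroup_algebra T"]) auto
next
  case (Suc m)
  have ne: "S - T \<noteq> {}" using Suc.hyps(2) by (metis card.empty nat.distinct(1))
  have "Max (deg ` (S - T)) \<in> deg ` (S - T)" using ne Suc.prems by (intro Max_in) auto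
  then obtain s where s: "s \<in> S - T" "deg s = Max (deg ` (S - T))" by auto
  have mx: "deg t \<le> deg s" if "t \<in> S - T" for t using that s(2) Suc.prems(1) by simp
  have cardT: "m = card (S - insert s T)"
    using Suc.hyps(2) s(1) Suc.prems(1) by (metis Diff_insert card_Diff_singleton diff_Suc_1)
  have closed: "u + t \<in> insert s T" if "u \<in> S" "t \<in> insert s T" for u t
  proof (cases "t \<in> T \<or> u = 0")
    case False
    then have "t = s" "u \<noteq> 0" using that by auto
    then have "u + s \<in> T" using deg[of u s] that(1) s add_mem[of u s] mx[of "u + s"] by force
    then show ?thesis using \<open>t = s\<close> by simp
  qed (use that Suc.prems in auto)
  obtain J :: "nat \<Rightarrow> ('s \<Rightarrow>\<^sub>0 'k::field) set"
    where J: "\<And>i. i\<le>m \<Longrightarrow> ideal (J i) (semigroup_ring S)" "\<And>i. i\<le>m \<Longrightarrow> semigroup_algebra (insert s T) \<subseteq> J i"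
      "\<And>i. i<m \<Longrightarrow> J i \<subset> J (Suc i)"
  proof -
    have "\<exists>J :: nat \<Rightarrow> ('s \<Rightarrow>\<^sub>0 'k) set.
      (\<forall>i\<le>m. ideal (J i) (semigroup_ring S) \<and> semigroup_algebra (insert s T) \<subseteq> J i) \<and>
      (\<forall>i<m. J i \<subset> J (Suc i))"
      using Suc.hyps(1)[OF cardT, folded cardT] Suc.prems(1,2) s(1) closed by simp
    then show thesis using that by blast
  qed
  have sub: "semigroup_algebra T \<subset> (semigroup_algebra (insert s T) :: ('s \<Rightarrow>\<^sub>0 'k) set)"
  proof
    show "semigroup_algebra T \<noteq> (semigroup_algebra (insert s T) :: ('s \<Rightarrow>\<^sub>0 'k) set)"
      using s(1) semigroup_algebra_simps(2)[of s "1::'k" T] semigroup_algebra_simps(2)[of s "1::'k" "insert s T"] 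
      by force
  qed (auto simp: semigroup_algebra_def)
  show ?case
  proof (intro exI[of _ "case_nat (semigroup_algebra T) J"] conjI allI impI)
    fix i assume i: "i \<le> card (S - T)"
    show "ideal (case_nat (semigroup_algebra T) J i) (semigroup_ring S)"
      using i J(1) Suc.hyps(2) ideal_semigroup_algebra[OF Suc.prems(2,3)] by (cases i) auto
    show "semigroup_algebra T \<subseteq> case_nat (semigroup_algebra T) J i"
    proof (cases i)
      case (Suc j)
      then show ?thesis using J(2)[of j] i Suc.hyps(2) sub by (simp add: psubset_imp_subset subset_trans)
    qed simp
  next
    fix i assume i: "i < card (S - T)"
    show "case_nat (semigroup_algebra T) J i \<subset> case_nat (semigroup_algebra T) J (Suc i)"
    proof (cases i)
      case 0
      then show ?thesis using J(2)[of 0] sub by auto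
    next
      case (Suc j)
      then show ?thesis using J(3)[of j] i Suc.hyps(2) by simp
    qed
  qed
qed

lemma quotient_length_monomial_ideal:
  fixes deg :: "'s \<Rightarrow> 'o::linorder"
  assumes "\<And>s t. s \<in> S \<Longrightarrow> s \<noteq> 0 \<Longrightarrow> t \<in> S \<Longrightarrow> deg t < deg (s + t)"
    and "finite (S - T)" "T \<subseteq> S" "\<And>s t. s \<in> S \<Longrightarrow> t \<in> T \<Longrightarrow> s + t \<in> T"
  shows "quotient_length (semigroup_ring S) (semigroup_algebra T :: ('s \<Rightarrow>\<^sub>0 'k::field) set) =
    enat (card (S - T))"
  unfolding quotient_length_def
proof (rule antisym)
  show "Sup {enat l |l. \<exists>J :: nat \<Rightarrow> ('s \<Rightarrow>\<^sub>0 'k) set.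
     (\<forall>i\<le>l. ideal (J i) (semigroup_ring S) \<and> semigroup_algebra T \<subseteq> J i) \<and> (\<forall>i<l. J i \<subset> J (Suc i))}
    \<le> enat (card (S - T))"
    by (rule Sup_least, clarsimp) (metis ideal_chain_length_le[OF assms(2)])
  show "enat (card (S - T)) \<le> Sup {enat l |l. \<exists>J :: nat \<Rightarrow> ('s \<Rightarrow>\<^sub>0 'k) set.
     (\<forall>i\<le>l. ideal (J i) (semigroup_ring S) \<and> semigroup_algebra T \<subseteq> J i) \<and> (\<forall>i<l. J i \<subset> J (Suc i))}"
    by (rule Sup_upper) (use ideal_chain_exists[OF assms] in blast)
qed

lemma ideal_prod_semigroup_algebra:
  assumes A: "A \<subseteq> S" "\<And>s t. s \<in> S \<Longrightarrow> t \<in> A \<Longrightarrow> s + t \<in> A"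
    and B: "B \<subseteq> S" "\<And>s t. s \<in> S \<Longrightarrow> t \<in> B \<Longrightarrow> s + t \<in> B"
  shows "ideal_prod (semigroup_ring S) (semigroup_algebra A) (semigroup_algebra B) =
    (semigroup_algebra {a + b | a b. a \<in> A \<and> b \<in> B} :: ('s \<Rightarrow>\<^sub>0 'k::field) set)" (is "?L = ?R")
proof
  interpret R: cring "semigroup_ring S :: ('s \<Rightarrow>\<^sub>0 'k::field) ring" by (rule cring_semigroup_ring)
  show "?L \<subseteq> ?R"
  proof
    fix f assume "f \<in> ?L"
    then show "f \<in> ?R"
      by (induction rule: ideal_prod.induct)
        (auto intro: semigroup_algebra_add intro!: semigroup_algebra_mult)
  qed
  have "Poly_Mapping.single (a + b) 1 \<in> ?L" if "a \<in> A" "b \<in> B" for a b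
    using ideal_prod.prod[of "Poly_Mapping.single a 1" "semigroup_algebra A"
        "Poly_Mapping.single b 1" "semigroup_algebra B" "semigroup_ring S"] that
    by (simp add: mult_single)
  then show "?R \<subseteq> ?L"
    by (intro semigroup_algebra_subset_ideal R.ideal_prod_is_ideal ideal_semigroup_algebra)
      (use A B in auto)
qed

text \<open>In characteristic p the q-th power of a sum is the sum of the q-th powers of its terms,
  so q-th powers of monomials generate the whole Frobenius power. The constant sum over
  \<open>i < p ^ e\<close> is the q-fold multiple of t in the monoid.\<close>

lemma frobenius_power_semigroup_algebra:
  assumes p: "p = CHAR('k::field)" "p > 0" and T: "T \<subseteq> S"
  shows "frobenius_power (semigroup_ring S) (semigroup_algebra T :: ('s \<Rightarrow>\<^sub>0 'k) set) (p ^ e) =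
    semigroup_algebra {s + (\<Sum>i<p ^ e. t) | s t. s \<in> S \<and> t \<in> T}" (is "?L = ?R")
proof
  interpret R: cring "semigroup_ring S :: ('s \<Rightarrow>\<^sub>0 'k::field) ring" by (rule cring_semigroup_ring)
  have prime: "prime CHAR('k)" using p prime_CHAR_semidom by blast
  have "of_nat m = (0 :: 's \<Rightarrow>\<^sub>0 'k) \<longleftrightarrow> of_nat m = (0::'k)" for m
  proof -
    have "of_nat m = (0 :: 's \<Rightarrow>\<^sub>0 'k) \<longleftrightarrow> Poly_Mapping.single (0::'s) (of_nat m :: 'k) = 0"
      by (simp only: single_of_nat)
    also have "\<dots> \<longleftrightarrow> of_nat m = (0::'k)"
      by (metis lookup_single_eq lookup_zero single_zero)
    finally show ?thesis .
  qed
  then have char: "CHAR('s \<Rightarrow>\<^sub>0 'k) = CHAR('k)"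
    by (intro CHAR_eqI) (simp_all only: of_nat_eq_0_iff_char_dvd dvd_refl)
  have pow1: "Poly_Mapping.single t c ^ m = Poly_Mapping.single (\<Sum>i<m. t) (c ^ m)" for t :: 's and c :: 'k and m
    by (induction m) (simp_all add: mult_single add.commute mult.commute)
  have sumS: "(\<Sum>i<m. t) \<in> S" if "t \<in> T" for m :: nat and t
    using that T by (induction m) (auto intro: zero_mem add_mem)
  have img: "(\<lambda>f. f [^]\<^bsub>semigroup_ring S\<^esub> (p ^ e)) ` (semigroup_algebra T :: ('s \<Rightarrow>\<^sub>0 'k) set) \<subseteq> ?R"
  proof (rule image_subsetI, unfold nat_pow_semigroup_ring)
    fix f :: "'s \<Rightarrow>\<^sub>0 'k" assume f: "f \<in> semigroup_algebra T"
    have "f ^ p ^ e = (\<Sum>k\<in>Poly_Mapping.keys f. Poly_Mapping.single k (Poly_Mapping.lookup f k) ^ p ^ e)"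
    proof -
      have "f ^ p ^ e = (\<Sum>k\<in>Poly_Mapping.keys f. Poly_Mapping.single k (Poly_Mapping.lookup f k)) ^ p ^ e"
        by (rule arg_cong[of f _ "\<lambda>g. g ^ p ^ e", OF poly_mapping_eq_sum_single])
      also have "\<dots> = (\<Sum>k\<in>Poly_Mapping.keys f. Poly_Mapping.single k (Poly_Mapping.lookup f k) ^ p ^ e)"
        by (rule freshmans_dream_sum'[where n = e]) (simp_all add: char p(1) prime)
      finally show ?thesis .
    qed
    also have "\<dots> \<in> ?R"
    proof (rule semigroup_algebra_sum)
      fix k assume "k \<in> Poly_Mapping.keys f"
      then have "k \<in> T" using f by (auto simp: semigroup_algebra_def)
      then have "0 + (\<Sum>i<p ^ e. k) \<in> {s + (\<Sum>i<p ^ e. t) | s t. s \<in> S \<and> t \<in> T}"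
        using zero_mem by blast
      then show "Poly_Mapping.single k (Poly_Mapping.lookup f k) ^ p ^ e \<in> ?R" by (simp add: pow1)
    qed
    finally show "f ^ p ^ e \<in> ?R" .
  qed
  have idR: "ideal ?R (semigroup_ring S)"
  proof (rule ideal_semigroup_algebra)
    fix u v assume u: "u \<in> S" and "v \<in> {s + (\<Sum>i<p ^ e. t) | s t. s \<in> S \<and> t \<in> T}"
    then obtain s t where "s \<in> S" "t \<in> T" "v = s + (\<Sum>i<p ^ e. t)" by auto
    then show "u + v \<in> {s + (\<Sum>i<p ^ e. t) | s t. s \<in> S \<and> t \<in> T}"
      using u add_mem[of u s] by (simp only: add.assoc[symmetric]) blast
  qed (use sumS add_mem T in auto)
  show "?L \<subseteq> ?R"
    unfolding frobenius_power_def by (rule R.genideal_minimal[OF idR img])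
  have sub: "(\<lambda>f. f [^]\<^bsub>semigroup_ring S\<^esub> (p ^ e)) ` (semigroup_algebra T :: ('s \<Rightarrow>\<^sub>0 'k) set) \<subseteq> carrier (semigroup_ring S)"
    using img additive_subgroup.a_subset[OF ideal.axioms(1)[OF idR]] by (rule subset_trans)
  then have idL: "ideal ?L (semigroup_ring S)" unfolding frobenius_power_def by (rule R.genideal_ideal)
  show "?R \<subseteq> ?L"
  proof (rule semigroup_algebra_subset_ideal[OF idL], clarify)
    fix s t assume s: "s \<in> S" and t: "t \<in> T"
    have "Poly_Mapping.single t (1::'k) [^]\<^bsub>semigroup_ring S\<^esub> (p ^ e) \<in> ?L"
      unfolding frobenius_power_def using R.genideal_self[OF sub] t by auto
    then have "Poly_Mapping.single s 1 * Poly_Mapping.single (\<Sum>i<p ^ e. t) (1::'k) \<in> ?L"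
      using ideal.I_l_closed[OF idL, of _ "Poly_Mapping.single s 1"] s by (simp add: nat_pow_semigroup_ring pow1)
    then show "Poly_Mapping.single (s + (\<Sum>i<p ^ e. t)) 1 \<in> ?L" by (simp add: mult_single)
  qed
qed

end

section \<open>Lattice points and volume\<close>

text \<open>Set up for any Euclidean space because it serves both M and the lattice M x Z that
  contains the semigroup.\<close>

definition int_lattice :: "'a::euclidean_space set" where
  "int_lattice = {x. \<forall>b\<in>Basis. x \<bullet> b \<in> \<int>}"

text \<open>Its fibres are half-open unit cubes, which partition the space without shared
  faces.\<close>

definition int_floor :: "'a::euclidean_space \<Rightarrow> 'a" where
  "int_floor x = (\<Sum>b\<in>Basis. of_int \<lfloor>x \<bullet> b\<rfloor> *\<^sub>R b)"

definition unit_cell :: "'a::euclidean_space set" where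
  "unit_cell = {x. int_floor x = 0}"

lemma int_floor_inner: "b \<in> Basis \<Longrightarrow> int_floor x \<bullet> b = of_int \<lfloor>x \<bullet> b\<rfloor>"
  by (simp add: int_floor_def inner_sum_left_Basis)

lemma int_floor_in_lattice: "int_floor x \<in> int_lattice"
  by (simp add: int_lattice_def int_floor_inner)

lemma int_lattice_diff: "x \<in> int_lattice \<Longrightarrow> y \<in> int_lattice \<Longrightarrow> x - y \<in> int_lattice"
  by (simp add: int_lattice_def inner_diff_left)

lemma int_floor_add: "z \<in> int_lattice \<Longrightarrow> int_floor (x + z) = int_floor x + z"
  by (rule euclidean_eqI)
    (auto simp: int_lattice_def int_floor_inner inner_add_left elim!: Ints_cases)

lemma int_floor_diff: "z \<in> int_lattice \<Longrightarrow> int_floor (x - z) = int_floor x - z"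
  using int_floor_add[of z "x - z"] by simp

lemma unit_cell_iff: "x \<in> unit_cell \<longleftrightarrow> (\<forall>b\<in>Basis. 0 \<le> x \<bullet> b \<and> x \<bullet> b < 1)"
proof -
  have "x \<in> unit_cell \<longleftrightarrow> (\<forall>b\<in>Basis. \<lfloor>x \<bullet> b\<rfloor> = 0)"
    by (auto simp: unit_cell_def int_floor_inner euclidean_eq_iff[of "int_floor x"])
  then show ?thesis by (simp add: floor_eq_iff)
qed

lemma diff_in_unit_cell_iff: "z \<in> int_lattice \<Longrightarrow> x - z \<in> unit_cell \<longleftrightarrow> int_floor x = z"
  by (auto simp: unit_cell_def int_floor_diff)

lemma norm_diff_int_floor: "norm (x - int_floor x :: 'a::euclidean_space) \<le> DIM('a)"
proof -
  have "norm (x - int_floor x) \<le> (\<Sum>b\<in>Basis. \<bar>(x - int_floor x) \<bullet> b\<bar>)" by (rule norm_le_l1)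
  also have "\<dots> \<le> (\<Sum>b\<in>(Basis::'a set). 1)"
    by (rule sum_mono) (simp add: inner_diff_left int_floor_inner, linarith)
  finally show ?thesis by simp
qed

lemma norm_unit_cell: "x \<in> unit_cell \<Longrightarrow> norm (x :: 'a::euclidean_space) \<le> DIM('a)"
  using norm_diff_int_floor[of x] by (simp add: unit_cell_def)

lemma tendsto_int_floor_scaleR:
  "(\<lambda>q. int_floor (real q *\<^sub>R x) /\<^sub>R real q) \<longlonglongrightarrow> (x :: 'a::euclidean_space)"
proof (rule LIM_zero_cancel, rule Lim_null_comparison)
  show "\<forall>\<^sub>F q in sequentially. norm (int_floor (real q *\<^sub>R x) /\<^sub>R real q - x) \<le> DIM('a) / real q"
    using eventually_gt_at_top[of 0]
  proof eventually_elim
    case (elim q)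
    have "norm (int_floor (real q *\<^sub>R x) /\<^sub>R real q - x) =
      norm (- ((real q *\<^sub>R x - int_floor (real q *\<^sub>R x)) /\<^sub>R real q))"
      using elim by (simp add: scaleR_diff_right)
    also have "\<dots> = norm (real q *\<^sub>R x - int_floor (real q *\<^sub>R x)) / real q"
      by (simp only: norm_minus_cancel norm_scaleR) (simp add: divide_inverse mult.commute)
    also have "\<dots> \<le> DIM('a) / real q" by (intro divide_right_mono norm_diff_int_floor) simp
    finally show ?case .
  qed
  show "(\<lambda>q. DIM('a) / real q) \<longlonglongrightarrow> 0" by (rule lim_const_over_n)
qed

lemma borel_measurable_int_floor [measurable]: "int_floor \<in> borel_measurable borel"
  unfolding int_floor_def by measurable

lemma sets_unit_cell [measurable]: "(unit_cell :: 'a::euclidean_space set) \<in> sets borel"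
proof -
  have "(unit_cell :: 'a set) = int_floor -` {0} \<inter> space borel" by (auto simp: unit_cell_def)
  then show ?thesis using measurable_sets[OF borel_measurable_int_floor, of "{0 :: 'a}"] by simp
qed

lemma emeasure_unit_cell: "emeasure lborel (unit_cell :: 'a::euclidean_space set) = 1"
proof (rule antisym)
  have "(unit_cell :: 'a set) \<subseteq> cbox 0 One" by (auto simp: unit_cell_iff mem_box less_imp_le)
  then have "emeasure lborel (unit_cell :: 'a set) \<le> emeasure lborel (cbox 0 One :: 'a set)"
    by (intro emeasure_mono) auto
  then show "emeasure lborel (unit_cell :: 'a set) \<le> 1" by (simp add: emeasure_lborel_cbox)
  have "box 0 One \<subseteq> (unit_cell :: 'a set)" by (auto simp: unit_cell_iff mem_box less_imp_le)
  then have "emeasure lborel (box 0 One :: 'a set) \<le> emeasure lborel (unit_cell :: 'a set)"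
    by (intro emeasure_mono) auto
  then show "1 \<le> emeasure lborel (unit_cell :: 'a set)" by (simp add: emeasure_lborel_box)
qed

lemma int_lattice_subset_PiE:
  assumes "\<And>x b. x \<in> L \<Longrightarrow> b \<in> Basis \<Longrightarrow> x \<bullet> b \<in> of_int ` F"
  shows "L \<subseteq> (\<lambda>f. \<Sum>b\<in>Basis. of_int (f b) *\<^sub>R b) ` (Pi\<^sub>E (Basis::'a::euclidean_space set) (\<lambda>_. F))"
proof
  fix x assume "x \<in> L"
  then have "\<forall>b\<in>Basis. \<exists>k\<in>F. x \<bullet> b = of_int k" using assms by blast
  then obtain f where f: "\<And>b. b \<in> Basis \<Longrightarrow> f b \<in> F \<and> x \<bullet> b = of_int (f b)" by metis
  have "x = (\<Sum>b\<in>Basis. of_int (restrict f Basis b) *\<^sub>R b)"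
    by (subst euclidean_representation[symmetric]) (simp add: f)
  then show "x \<in> (\<lambda>f. \<Sum>b\<in>Basis. of_int (f b) *\<^sub>R b) ` (Pi\<^sub>E Basis (\<lambda>_. F))"
    using f by (intro image_eqI[of _ _ "restrict f Basis"]) auto
qed

lemma countable_int_lattice: "countable (int_lattice :: 'a::euclidean_space set)"
proof (rule countable_subset[OF int_lattice_subset_PiE[where F = UNIV]])
  show "x \<in> int_lattice \<Longrightarrow> b \<in> Basis \<Longrightarrow> x \<bullet> b \<in> range real_of_int" for x b :: 'a
    by (auto simp: int_lattice_def Ints_def)
qed (intro countable_image countable_PiE, auto)

lemma finite_int_lattice_bounded:
  assumes "L \<subseteq> int_lattice" "bounded (L :: 'a::euclidean_space set)"
  shows "finite L"
proof -
  obtain R where R: "\<And>x. x \<in> L \<Longrightarrow> norm x \<le> R" using assms(2) by (auto simp: bounded_iff)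
  show ?thesis
  proof (rule finite_subset[OF int_lattice_subset_PiE[where F = "{-\<lceil>R\<rceil>..\<lceil>R\<rceil>}"]])
    fix x b :: 'a assume x: "x \<in> L" and b: "b \<in> Basis"
    then obtain k where k: "x \<bullet> b = of_int k" using assms(1) by (auto simp: int_lattice_def elim!: Ints_cases)
    have "\<bar>x \<bullet> b\<bar> \<le> R" using R[OF x] Basis_le_norm[OF b, of x] by linarith
    then have "k \<in> {-\<lceil>R\<rceil>..\<lceil>R\<rceil>}" unfolding k by (simp, linarith)
    then show "x \<bullet> b \<in> real_of_int ` {-\<lceil>R\<rceil>..\<lceil>R\<rceil>}" using k by blast
  qed (intro finite_imageI finite_PiE, auto)
qed

lemma nn_integral_lborel_affine:
  fixes f :: "'a::euclidean_space \<Rightarrow> ennreal"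
  assumes [measurable]: "f \<in> borel_measurable borel" and c: "c \<noteq> 0"
  shows "(\<integral>\<^sup>+x. f x \<partial>lborel) = ennreal (\<bar>c\<bar> ^ DIM('a)) * (\<integral>\<^sup>+x. f (t + c *\<^sub>R x) \<partial>lborel)"
  by (subst lborel_affine[OF c, of t])
    (simp add: nn_integral_density nn_integral_distr nn_integral_cmult ennreal_power)

lemma emeasure_lborel_affine:
  fixes A :: "'a::euclidean_space set"
  assumes [measurable]: "A \<in> sets borel" and c: "c \<noteq> 0"
  shows "emeasure lborel A = ennreal (\<bar>c\<bar> ^ DIM('a)) * emeasure lborel {x. t + c *\<^sub>R x \<in> A}"
proof -
  have "emeasure lborel A = (\<integral>\<^sup>+x. indicator A x \<partial>lborel)" by simp
  also have "\<dots> = ennreal (\<bar>c\<bar> ^ DIM('a)) * (\<integral>\<^sup>+x. indicator A (t + c *\<^sub>R x) \<partial>lborel)"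
    by (rule nn_integral_lborel_affine[OF _ c]) simp
  also have "(\<integral>\<^sup>+x. indicator A (t + c *\<^sub>R x) \<partial>lborel) =
      (\<integral>\<^sup>+x. indicator {x. t + c *\<^sub>R x \<in> A} x \<partial>lborel)"
    by (rule nn_integral_cong) (simp add: indicator_def)
  also have "\<dots> = emeasure lborel {x. t + c *\<^sub>R x \<in> A}" by (rule nn_integral_indicator) measurable
  finally show ?thesis .
qed

text \<open>Each point of \<open>A\<close> owns one half-open cube of side 1 / q, and these cubes
  are disjoint. A normalized count is thus a volume and becomes accessible to convergence
  theorems.\<close>

lemma emeasure_int_floor_scaleR_vimage:
  fixes A :: "'a::euclidean_space set"
  assumes A: "A \<subseteq> int_lattice" "finite A" and q: "q > 0"
  shows "emeasure lborel {x. int_floor (q *\<^sub>R x) \<in> A} = ennreal (card A / q ^ DIM('a))"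
proof -
  have cell: "emeasure lborel {x. int_floor (q *\<^sub>R x) = a} = ennreal (1 / q ^ DIM('a))" if "a \<in> A" for a
  proof -
    have "1 = ennreal (\<bar>q\<bar> ^ DIM('a)) * emeasure lborel {x. - a + q *\<^sub>R x \<in> unit_cell}"
      using emeasure_lborel_affine[OF sets_unit_cell, of q "- a"] q emeasure_unit_cell[where 'a='a] by simp
    also have "{x. - a + q *\<^sub>R x \<in> unit_cell} = {x. int_floor (q *\<^sub>R x) = a}"
      using diff_in_unit_cell_iff[of a] that A by auto
    finally have "ennreal (1 / q ^ DIM('a)) * 1 =
      ennreal (1 / q ^ DIM('a)) * (ennreal (\<bar>q\<bar> ^ DIM('a)) * emeasure lborel {x. int_floor (q *\<^sub>R x) = a})"
      by simp
    then show ?thesis using q by (simp add: mult.assoc[symmetric] ennreal_mult[symmetric])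
  qed
  have "{x. int_floor (q *\<^sub>R x) \<in> A} = (\<Union>a\<in>A. {x. int_floor (q *\<^sub>R x) = a})" by auto
  then have "emeasure lborel {x. int_floor (q *\<^sub>R x) \<in> A} = (\<Sum>a\<in>A. emeasure lborel {x. int_floor (q *\<^sub>R x) = a})"
    using A(2) by (simp, intro sum_emeasure[symmetric]) (auto simp: disjoint_family_on_def)
  also have "\<dots> = (\<Sum>a\<in>A. ennreal (1 / q ^ DIM('a)))" using cell by simp
  finally show ?thesis using q by (simp add: ennreal_of_nat_eq_real_of_nat ennreal_mult[symmetric])
qed

lemma int_floor_scaleR_vimage_subset_cball:
  fixes A :: "'a::euclidean_space set" and R q :: real
  assumes "\<And>x. x \<in> A \<Longrightarrow> norm x \<le> R * q" "q \<ge> 1"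
  shows "{x. int_floor (q *\<^sub>R x) \<in> A} \<subseteq> cball 0 (R + DIM('a))"
proof
  fix x :: 'a assume "x \<in> {x. int_floor (q *\<^sub>R x) \<in> A}"
  then have "norm (int_floor (q *\<^sub>R x)) \<le> R * q" using assms(1) by auto
  then have "norm (q *\<^sub>R x) \<le> R * q + DIM('a)"
    using norm_diff_int_floor[of "q *\<^sub>R x"] norm_triangle_sub[of "q *\<^sub>R x" "int_floor (q *\<^sub>R x)"] by linarith
  then have "norm x * q \<le> R * q + DIM('a)" using assms(2) by (simp add: mult.commute)
  also have "\<dots> \<le> (R + DIM('a)) * q" using assms(2) mult_left_mono[of 1 q "real DIM('a)"] by (simp add: algebra_simps)
  finally show "x \<in> cball 0 (R + DIM('a))" using assms(2) by simp
qed

text \<open>Supplies a bound independent of q, later the dominating constant for counts in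
  slices.\<close>

lemma card_int_lattice_le:
  fixes A :: "'a::euclidean_space set" and R q :: real
  assumes A: "A \<subseteq> int_lattice" "\<And>x. x \<in> A \<Longrightarrow> norm x \<le> R * q" "q \<ge> 1"
  shows "card A / q ^ DIM('a) \<le> measure lborel (cball 0 (R + DIM('a)) :: 'a set)"
proof -
  have "bounded A" using A(2) by (auto simp: bounded_iff)
  then have fin: "finite A" using A(1) finite_int_lattice_bounded by blast
  have "ennreal (card A / q ^ DIM('a)) = emeasure lborel {x. int_floor (q *\<^sub>R x) \<in> A}"
    using emeasure_int_floor_scaleR_vimage[OF A(1) fin, of q] A(3) by simp
  also have "\<dots> \<le> emeasure lborel (cball 0 (R + DIM('a)) :: 'a set)"
    by (rule emeasure_mono[OF int_floor_scaleR_vimage_subset_cball[OF A(2,3)]]) auto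
  also have "\<dots> = ennreal (measure lborel (cball 0 (R + DIM('a)) :: 'a set))"
    by (rule emeasure_eq_ennreal_measure) (metis emeasure_lborel_cball_finite infinity_ennreal_def less_irrefl)
  finally show ?thesis by (simp add: ennreal_le_iff)
qed

text \<open>The counts are volumes of the sets \<open>X q\<close>, whose indicators stay below that
  of a fixed ball and converge almost everywhere to that of \<open>D\<close>. The last hypothesis
  concerns one point x at a time, so no uniform estimate near the boundary of \<open>D\<close>
  enters.\<close>

lemma lattice_card_tendsto:
  fixes A :: "nat \<Rightarrow> 'a::euclidean_space set"
  assumes lat: "\<And>q. A q \<subseteq> int_lattice"
    and bd: "\<And>q x. q > 0 \<Longrightarrow> x \<in> A q \<Longrightarrow> norm x \<le> R * real q"
    and D [measurable]: "D \<in> sets borel"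
    and ae: "AE x in lborel. \<forall>\<^sub>F q in sequentially. int_floor (real q *\<^sub>R x) \<in> A q \<longleftrightarrow> x \<in> D"
  shows "(\<lambda>q. card (A q) / real q ^ DIM('a)) \<longlonglongrightarrow> measure lborel D"
proof -
  \<comment> \<open>The shift by one avoids q = 0, where \<open>bd\<close> gives no control.\<close>
  define X where "X q = {x. int_floor (real (Suc q) *\<^sub>R x) \<in> A (Suc q)}" for q
  have finA: "finite (A (Suc q))" for q
    using lat[of "Suc q"] bd[of "Suc q"] by (intro finite_int_lattice_bounded) (auto simp: bounded_iff)
  have Xm [measurable]: "X q \<in> sets borel" for q
  proof -
    have [measurable]: "A (Suc q) \<in> sets borel" using finA by (simp add: sets.countable countable_finite)
    show ?thesis unfolding X_def by measurable
  qed
  have meas: "measure lborel (X q) = card (A (Suc q)) / real (Suc q) ^ DIM('a)" for q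
    unfolding measure_def X_def emeasure_int_floor_scaleR_vimage[OF lat finA of_nat_0_less_iff[THEN iffD2, OF zero_less_Suc]]
    by (simp del: of_nat_Suc)
  have "(\<lambda>q. \<integral>x. indicator (X q) x \<partial>lborel :: real) \<longlonglongrightarrow> (\<integral>x. indicator D x \<partial>lborel)"
  proof (rule integral_dominated_convergence[where w = "indicator (cball 0 (R + DIM('a)))"])
    show "integrable lborel (indicator (cball 0 (R + DIM('a)) :: 'a set) :: 'a \<Rightarrow> real)"
      by (rule integrable_real_indicator) (auto simp flip: infinity_ennreal_def intro: emeasure_lborel_cball_finite)
    show "AE x in lborel. (\<lambda>q. indicator (X q) x :: real) \<longlonglongrightarrow> indicator D x"
      using ae
    proof eventually_elim
      case (elim x)
      then have "\<forall>\<^sub>F q in sequentially. int_floor (real (Suc q) *\<^sub>R x) \<in> A (Suc q) \<longleftrightarrow> x \<in> D"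
        by (rule eventually_compose_filterlim) (rule filterlim_Suc)
      then have "\<forall>\<^sub>F q in sequentially. indicator (X q) x = (indicator D x :: real)"
        by eventually_elim (auto simp: X_def indicator_def)
      then show ?case by (rule tendsto_eventually)
    qed
    show "AE x in lborel. norm (indicator (X q) x :: real) \<le> indicator (cball 0 (R + DIM('a))) x" for q
    proof -
      have "X q \<subseteq> cball 0 (R + DIM('a))"
        unfolding X_def by (rule int_floor_scaleR_vimage_subset_cball[OF bd]) auto
      then show ?thesis by (intro AE_I2) (auto simp: indicator_def)
    qed
  qed auto
  then have "(\<lambda>q. measure lborel (X q)) \<longlonglongrightarrow> measure lborel D" by simp
  then show ?thesis unfolding meas by (subst (asm) filterlim_sequentially_Suc)
qed

text \<open>Unfolding: every point lies in exactly one lattice translate of the unit cell. Inserting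
  this partition of unity and exchanging sum and integral folds \<open>E\<close> into the
  cell.\<close>

lemma nn_integral_unfold_lattice:
  fixes E :: "'a::euclidean_space set"
  assumes [measurable]: "E \<in> sets borel"
  shows "emeasure lborel E =
    (\<integral>\<^sup>+x. (\<integral>\<^sup>+z. indicator E (x + z) \<partial>count_space int_lattice) * indicator unit_cell x \<partial>lborel)"
proof -
  have "emeasure lborel E = (\<integral>\<^sup>+x. indicator E x \<partial>lborel)" by simp
  also have "\<dots> = (\<integral>\<^sup>+x. (\<integral>\<^sup>+z. indicator E x * indicator unit_cell (x - z) \<partial>count_space int_lattice) \<partial>lborel)"
  proof (rule nn_integral_cong)
    fix x :: 'a
    have "(\<integral>\<^sup>+z. indicator E x * indicator unit_cell (x - z) \<partial>count_space int_lattice) =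
      (\<integral>\<^sup>+z. indicator E x * indicator {int_floor x} z \<partial>count_space int_lattice)"
      by (rule nn_integral_cong) (auto simp: diff_in_unit_cell_iff indicator_def)
    also have "\<dots> = indicator E x"
      by (subst nn_integral_cmult_indicator) (auto simp: int_floor_in_lattice)
    finally show "indicator E x = (\<integral>\<^sup>+z. indicator E x * indicator unit_cell (x - z) \<partial>count_space int_lattice)"
      by simp
  qed
  also have "\<dots> = (\<integral>\<^sup>+z. (\<integral>\<^sup>+x. indicator E x * indicator unit_cell (x - z) \<partial>lborel) \<partial>count_space int_lattice)"
    by (rule nn_integral_count_space_nn_integral[OF countable_int_lattice]) measurable
  also have "\<dots> = (\<integral>\<^sup>+z. (\<integral>\<^sup>+x. indicator E (x + z) * indicator unit_cell x \<partial>lborel) \<partial>count_space int_lattice)"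
  proof (rule nn_integral_cong)
    fix z :: 'a
    show "(\<integral>\<^sup>+x. indicator E x * indicator unit_cell (x - z) \<partial>lborel) =
      (\<integral>\<^sup>+x. indicator E (x + z) * indicator unit_cell x \<partial>lborel)"
      by (subst nn_integral_lborel_affine[where c = 1 and t = z]) (auto simp: add.commute)
  qed
  also have "\<dots> = (\<integral>\<^sup>+x. (\<integral>\<^sup>+z. indicator E (x + z) * indicator unit_cell x \<partial>count_space int_lattice) \<partial>lborel)"
    by (rule nn_integral_count_space_nn_integral[OF countable_int_lattice, symmetric]) measurable
  finally show ?thesis by (simp add: nn_integral_multc)
qed

lemma null_sets_unfold_lattice:
  fixes E :: "'a::euclidean_space set"
  assumes E: "E \<in> sets borel"
    and ae: "AE x in lborel. x \<in> unit_cell \<longrightarrow> (\<forall>z\<in>int_lattice. x + z \<notin> E)"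
  shows "E \<in> null_sets lborel"
proof -
  have "AE x in lborel. (\<integral>\<^sup>+z. indicator E (x + z) \<partial>count_space int_lattice) * indicator unit_cell x = 0"
    using ae
  proof eventually_elim
    case (elim x)
    have "(\<integral>\<^sup>+z. indicator E (x + z) \<partial>count_space int_lattice) = (\<integral>\<^sup>+(z::'a). 0 \<partial>count_space int_lattice)"
      if "x \<in> unit_cell"
      by (rule nn_integral_cong) (use elim that in simp)
    then show ?case by (cases "x \<in> unit_cell") auto
  qed
  then have "emeasure lborel E = (\<integral>\<^sup>+(x::'a). 0 \<partial>lborel)"
    unfolding nn_integral_unfold_lattice[OF E] by (rule nn_integral_cong_AE)
  then show ?thesis using E by (simp add: null_sets_def)
qed

text \<open>Boundedness keeps the sets of lattice points finite; \<open>card\<close> would read an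
  infinite one as 0.\<close>

lemma emeasure_unfold_lattice:
  fixes E :: "'a::euclidean_space set"
  assumes E [measurable]: "E \<in> sets borel" and bd: "bounded E"
  shows "emeasure lborel E =
    (\<integral>\<^sup>+x. ennreal (card {z\<in>int_lattice. x + z \<in> E}) * indicator unit_cell x \<partial>lborel)"
  unfolding nn_integral_unfold_lattice[OF E]
proof (rule nn_integral_cong)
  fix x :: 'a
  obtain R where R: "\<And>y. y \<in> E \<Longrightarrow> norm y \<le> R" using bd by (auto simp: bounded_iff)
  have "finite {z\<in>int_lattice. x + z \<in> E}"
  proof (rule finite_int_lattice_bounded)
    show "bounded {z \<in> int_lattice. x + z \<in> E}"
      unfolding bounded_iff
    proof (intro exI[of _ "R + norm x"] ballI)
      fix z assume "z \<in> {z \<in> int_lattice. x + z \<in> E}"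
      then show "norm z \<le> R + norm x" using R[of "x + z"] norm_triangle_ineq4[of "x + z" x] by simp
    qed
  qed auto
  moreover have "(\<integral>\<^sup>+z. indicator E (x + z) \<partial>count_space int_lattice) =
    (\<integral>\<^sup>+z. indicator {z\<in>int_lattice. x + z \<in> E} z \<partial>count_space int_lattice)"
    by (rule nn_integral_cong) (auto simp: indicator_def)
  ultimately have "(\<integral>\<^sup>+z. indicator E (x + z) \<partial>count_space int_lattice) = ennreal (card {z\<in>int_lattice. x + z \<in> E})"
    by (simp add: emeasure_count_space ennreal_of_nat_eq_real_of_nat)
  then show "(\<integral>\<^sup>+z. indicator E (x + z) \<partial>count_space int_lattice) * indicator unit_cell x =
    ennreal (card {z\<in>int_lattice. x + z \<in> E}) * indicator unit_cell x" by simp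
qed

section \<open>The semigroup over a set of lattice points\<close>

text \<open>The slice at height t is the dilate t Q. Treating all dilates as slices of one closed
  cone makes membership closed, hence measurable, jointly in the point and the factor.\<close>

definition cone_over :: "'a::real_normed_vector set \<Rightarrow> ('a \<times> real) set" where
  "cone_over Q = {(t *\<^sub>R y, t) | t y. 0 \<le> t \<and> y \<in> Q}"

lemma cone_over_iff: "(x, t) \<in> cone_over Q \<longleftrightarrow> 0 \<le> t \<and> x \<in> (*\<^sub>R) t ` Q"
  by (auto simp: cone_over_def)

lemma closed_cone_over:
  assumes "compact (Q :: 'a::euclidean_space set)"
  shows "closed (cone_over Q)"
proof (unfold closed_sequential_limits, intro allI impI, elim conjE)
  fix w :: "nat \<Rightarrow> 'a \<times> real" and l
  assume "\<forall>n. w n \<in> cone_over Q" and lim: "w \<longlonglongrightarrow> l"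
  then have "\<forall>n. \<exists>t y. 0 \<le> t \<and> y \<in> Q \<and> w n = (t *\<^sub>R y, t)"
    unfolding cone_over_def by blast
  then obtain t y where ty: "\<And>n. 0 \<le> t n" "\<And>n. y n \<in> Q" "\<And>n. w n = (t n *\<^sub>R y n, t n)" by metis
  \<comment> \<open>When the heights tend to 0 the points \<open>y n\<close> need not converge, so
    compactness has to provide a subsequence.\<close>
  obtain z r where z: "z \<in> Q" "strict_mono r" "(y \<circ> r) \<longlonglongrightarrow> z"
    using assms ty(2) unfolding compact_def by metis
  have t: "t \<longlonglongrightarrow> snd l" using tendsto_snd[OF lim] by (simp add: ty(3))
  then have tr: "(t \<circ> r) \<longlonglongrightarrow> snd l" using z(2) by (rule LIMSEQ_subseq_LIMSEQ)
  have "(\<lambda>n. t n *\<^sub>R y n) \<longlonglongrightarrow> fst l" using tendsto_fst[OF lim] by (simp add: ty(3))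
  from LIMSEQ_subseq_LIMSEQ[OF this z(2)] have "(\<lambda>n. (t \<circ> r) n *\<^sub>R (y \<circ> r) n) \<longlonglongrightarrow> fst l"
    by (simp add: o_def)
  then have "fst l = snd l *\<^sub>R z" using tendsto_scaleR[OF tr z(3)] LIMSEQ_unique by blast
  moreover have "0 \<le> snd l" using t ty(1) by (simp add: LIMSEQ_le_const)
  ultimately show "l \<in> cone_over Q" using z(1) by (cases l) (auto simp: cone_over_iff)
qed

lemma cone_over_scaleR: "p \<in> cone_over Q \<Longrightarrow> 0 \<le> c \<Longrightarrow> c *\<^sub>R p \<in> cone_over Q"
  by (force simp: cone_over_def)

lemma cone_over_add:
  assumes "convex Q" "p \<in> cone_over Q" "q \<in> cone_over Q"
  shows "p + q \<in> cone_over Q"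
proof -
  obtain s y t z where p: "p = (s *\<^sub>R y, s)" "0 \<le> s" "y \<in> Q" and q: "q = (t *\<^sub>R z, t)" "0 \<le> t" "z \<in> Q"
    using assms by (auto simp: cone_over_def)
  show ?thesis
  proof (cases "s + t = 0")
    case True
    then show ?thesis using p q by (auto simp: cone_over_iff add_nonneg_eq_0_iff)
  next
    case False
    then have pos: "s + t > 0" using p q by simp
    have "(s / (s + t)) *\<^sub>R y + (t / (s + t)) *\<^sub>R z \<in> Q"
      using pos p q by (intro convexD[OF assms(1)]) (auto simp: add_divide_distrib[symmetric])
    moreover have "(s + t) *\<^sub>R ((s / (s + t)) *\<^sub>R y + (t / (s + t)) *\<^sub>R z) = s *\<^sub>R y + t *\<^sub>R z"
      using pos by (simp add: scaleR_add_right)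
    ultimately show ?thesis using p q pos unfolding p(1) q(1) by (auto simp: cone_over_iff intro!: image_eqI)
  qed
qed

lemma convex_cone_over: "convex Q \<Longrightarrow> convex (cone_over Q)"
  by (rule convexI) (intro cone_over_add cone_over_scaleR)

lemma rvec_simps [simp]:
  "rvec 0 = 0" "rvec (m + m') = rvec m + rvec m'" "rvec (m - m') = rvec m - rvec m'" "rvec (- m) = - rvec m"
  by (simp_all add: rvec_def vec_eq_iff)

lemma rvec_sum: "rvec (sum f I) = (\<Sum>i\<in>I. rvec (f i))"
  by (induction I rule: infinite_finite_induct) auto

lemma inj_rvec: "inj rvec"
  by (auto simp: inj_def rvec_def vec_eq_iff)

lemma rvec_eq_iff [simp]: "rvec u = rvec v \<longleftrightarrow> u = v"
  by (rule inj_eq[OF inj_rvec])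

lemma range_rvec: "range (rvec :: int ^ 'n \<Rightarrow> real ^ 'n) = int_lattice"
proof (intro equalityI subsetI)
  fix x :: "real ^ 'n" assume x: "x \<in> int_lattice"
  have "\<exists>k. x $ i = of_int k" for i
    using x unfolding int_lattice_def
    by (auto simp: inner_axis Basis_vec_def elim!: Ints_cases dest: spec[of _ "axis i 1"])
  then obtain k where "\<And>i. x $ i = of_int (k i)" by metis
  then have "x = rvec (\<chi> i. k i)" by (simp add: rvec_def vec_eq_iff)
  then show "x \<in> range rvec" by auto
qed (auto simp: int_lattice_def rvec_def Basis_vec_def inner_axis)

definition rpair :: "(int ^ 'n) \<times> int \<Rightarrow> (real ^ 'n) \<times> real" where
  "rpair s = (rvec (fst s), of_int (snd s))"

lemma rpair_simps [simp]:
  "rpair 0 = 0" "rpair (s + t) = rpair s + rpair t" "rpair (s - t) = rpair s - rpair t"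
  by (simp_all add: rpair_def zero_prod_def)

lemma rpair_sum: "rpair (sum f I) = (\<Sum>i\<in>I. rpair (f i))"
  by (induction I rule: infinite_finite_induct) auto

lemma inj_rpair: "inj rpair"
  by (auto simp: inj_def rpair_def)

lemma range_rpair: "range (rpair :: (int ^ 'n) \<times> int \<Rightarrow> _) = int_lattice"
proof -
  have "int_lattice = (int_lattice :: (real ^ 'n) set) \<times> (\<int> :: real set)"
    by (auto simp: int_lattice_def Basis_prod_def)
  also have "\<dots> = range rvec \<times> range real_of_int" by (simp add: range_rvec Ints_def)
  also have "\<dots> = range (rpair :: (int ^ 'n) \<times> int \<Rightarrow> _)" by (auto simp: rpair_def image_iff)
  finally show ?thesis by simp
qed

lemma generated_semigroup_submonoid: "submonoid (generated_semigroup G)"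
proof
  fix a b assume "a \<in> generated_semigroup G" "b \<in> generated_semigroup G"
  then show "a + b \<in> generated_semigroup G"
    by (induction rule: generated_semigroup.induct) (auto simp: add.assoc intro: generated_semigroup.add)
qed (rule generated_semigroup.zero)

lemma AE_notin_frontier_convex:
  assumes "convex (S :: 'a::euclidean_space set)"
  shows "AE x in lborel. x \<notin> frontier S"
proof -
  have "frontier S \<in> null_sets lborel"
    using negligible_convex_frontier[OF assms] by (simp add: negligible_iff_null_sets null_sets_completion_iff)
  then show ?thesis by (rule AE_not_in)
qed

text \<open>The set of differences is symmetric, so the monoid it generates is a group.\<close>

locale generating_points =
  fixes B :: "(int ^ 'n) set"
  assumes finite_B: "finite B" and nonempty_B: "B \<noteq> {}"
    and differences_generate: "generated_semigroup {u - v | u v. u \<in> B \<and> v \<in> B} = UNIV"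
begin

abbreviation "Q \<equiv> convex hull (rvec ` B)"
abbreviation "C \<equiv> cone_over Q"
abbreviation "G \<equiv> (\<lambda>u. (u, 1 :: int)) ` B"
abbreviation "S \<equiv> generated_semigroup G"

sublocale submonoid S by (rule generated_semigroup_submonoid)

lemma compact_Q: "compact Q"
  using finite_B by (simp add: finite_imp_compact_convex_hull)

lemma convex_C: "convex C" by (simp add: convex_cone_over)

lemma closed_C: "closed C" by (rule closed_cone_over[OF compact_Q])

lemma gen_in_S: "u \<in> B \<Longrightarrow> (u, 1) \<in> S"
  using generated_semigroup.add[of "(u, 1)" G 0] generated_semigroup.zero by auto

lemma sum_in_S: "(\<And>i. i \<in> I \<Longrightarrow> f i \<in> S) \<Longrightarrow> sum f I \<in> S"
  by (induction I rule: infinite_finite_induct) (auto intro: zero_mem add_mem)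

lemma rpair_gen_in_C: "u \<in> B \<Longrightarrow> rpair (u, 1) \<in> C"
  by (auto simp: rpair_def cone_over_iff intro: hull_inc)

lemma zero_in_C: "0 \<in> C"
  using rpair_gen_in_C cone_over_scaleR[of _ Q 0] nonempty_B by fastforce

lemma rpair_S_in_C: "s \<in> S \<Longrightarrow> rpair s \<in> C"
  by (induction rule: generated_semigroup.induct)
    (auto simp: zero_in_C intro!: cone_over_add rpair_gen_in_C)

lemma snd_S_nonneg: "s \<in> S \<Longrightarrow> 0 \<le> snd s"
  by (induction rule: generated_semigroup.induct) auto

lemma snd_S_pos:
  assumes "s \<in> S" "s \<noteq> 0"
  shows "0 < snd s"
  using assms(1)
proof (cases rule: generated_semigroup.cases)
  case (add g s')
  then show ?thesis using snd_S_nonneg[of s'] by auto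
qed (use assms in auto)

lemma S_pos_cases:
  assumes "s \<in> S" "snd s > 0"
  obtains u s' where "u \<in> B" "s' \<in> S" "s = (u, 1) + s'"
  using assms by (cases rule: generated_semigroup.cases) auto

lemma C_decomp:
  assumes "p \<in> C"
  obtains c where "\<And>u. u \<in> B \<Longrightarrow> 0 \<le> c u" "p = (\<Sum>u\<in>B. c u *\<^sub>R rpair (u, 1))" "snd p = sum c B"
proof -
  obtain t y where p: "p = (t *\<^sub>R y, t)" "0 \<le> t" "y \<in> Q" using assms by (auto simp: cone_over_def)
  obtain c where c: "\<forall>x\<in>rvec ` B. 0 \<le> c x" "sum c (rvec ` B) = 1" "(\<Sum>x\<in>rvec ` B. c x *\<^sub>R x) = y"
    using p(3) finite_B by (subst (asm) convex_hull_finite) auto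
  have inj: "inj_on rvec B" using inj_rvec by (rule inj_on_subset) auto
  have s1: "(\<Sum>u\<in>B. c (rvec u)) = 1" using c(2) by (simp add: sum.reindex[OF inj] o_def)
  have s2: "(\<Sum>u\<in>B. c (rvec u) *\<^sub>R rvec u) = y" using c(3) by (simp add: sum.reindex[OF inj] o_def)
  show ?thesis
  proof
    show "0 \<le> t * c (rvec u)" if "u \<in> B" for u using that p c by simp
    have "(\<Sum>u\<in>B. (t * c (rvec u)) *\<^sub>R rpair (u, 1)) =
      ((\<Sum>u\<in>B. (t * c (rvec u)) *\<^sub>R rvec u), (\<Sum>u\<in>B. t * c (rvec u)))"
      by (simp add: rpair_def sum_prod)
    also have "\<dots> = (t *\<^sub>R y, t)"
      using s1 s2 by (simp flip: scaleR_scaleR scaleR_right.sum sum_distrib_left)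
    finally show "p = (\<Sum>u\<in>B. (t * c (rvec u)) *\<^sub>R rpair (u, 1))" using p(1) by simp
    show "snd p = (\<Sum>u\<in>B. t * c (rvec u))" using s1 p(1) by (simp flip: sum_distrib_left)
  qed
qed

lemma norm_C_le:
  obtains M where "M > 0" "\<And>p. p \<in> C \<Longrightarrow> norm p \<le> M * snd p"
proof -
  obtain M where M: "\<And>y. y \<in> Q \<Longrightarrow> norm y \<le> M"
    using compact_imp_bounded[OF compact_Q] by (auto simp: bounded_iff)
  show ?thesis
  proof
    show "max M 0 + 1 > 0" by simp
    fix p assume "p \<in> C"
    then obtain t y where p: "p = (t *\<^sub>R y, t)" "0 \<le> t" "y \<in> Q" by (auto simp: cone_over_def)
    have "norm p \<le> norm (t *\<^sub>R y) + norm t" unfolding p(1) by (rule norm_Pair_le)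
    also have "\<dots> = t * norm y + t" using p(2) by simp
    also have "\<dots> \<le> t * max M 0 + t" using M[OF p(3)] p(2) by (intro add_right_mono mult_left_mono) auto
    finally show "norm p \<le> (max M 0 + 1) * snd p" using p(1) by (simp add: algebra_simps)
  qed
qed

definition S_group :: "((int ^ 'n) \<times> int) set" where
  "S_group = {s - t | s t. s \<in> S \<and> t \<in> S}"

lemma S_group_add: "x \<in> S_group \<Longrightarrow> y \<in> S_group \<Longrightarrow> x + y \<in> S_group"
  unfolding S_group_def
proof clarify
  fix s t s' t' assume "s \<in> S" "t \<in> S" "s' \<in> S" "t' \<in> S"
  then show "\<exists>u v. (s - t) + (s' - t') = u - v \<and> u \<in> S \<and> v \<in> S"
    by (intro exI[of _ "s + s'"] exI[of _ "t + t'"]) (auto intro: add_mem)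
qed

lemma S_group_uminus: "x \<in> S_group \<Longrightarrow> - x \<in> S_group"
  unfolding S_group_def by (force intro: exI)

lemma S_group_S: "s \<in> S \<Longrightarrow> s \<in> S_group"
  unfolding S_group_def using zero_mem by (metis (mono_tags, lifting) diff_zero mem_Collect_eq)

text \<open>Differences of generators fill height 0 by the assumption on \<open>B\<close>; a
  generator corrected by such an element gives (0, 1).\<close>

lemma S_group_eq: "S_group = UNIV"
proof -
  have flat: "(m, 0) \<in> S_group" for m
  proof -
    have "m \<in> generated_semigroup {u - v | u v. u \<in> B \<and> v \<in> B}"
      using differences_generate by simp
    then show ?thesis
    proof induction
      case zero
      then show ?case using S_group_S[OF zero_mem] by (simp add: zero_prod_def)
    next
      case (add g s)
      then obtain u v where uv: "u \<in> B" "v \<in> B" "g = u - v" by auto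
      have "(u, 1) - (v, 1) \<in> S_group" using gen_in_S uv unfolding S_group_def by blast
      then have "((u, 1) - (v, 1)) + (s, 0) \<in> S_group" using add by (intro S_group_add) auto
      then show ?case by (simp add: uv)
    qed
  qed
  obtain u0 where u0: "u0 \<in> B" using nonempty_B by auto
  have "(0, 1) \<in> S_group" using S_group_add[OF S_group_S[OF gen_in_S[OF u0]] flat[of "- u0"]] by simp
  then have nat: "(0, int n) \<in> S_group" for n
  proof (induction n)
    case 0 then show ?case using flat[of 0] by simp
  next
    case (Suc n) then show ?case using S_group_add[of "(0, 1)" "(0, int n)"] by simp
  qed
  have "(0, h) \<in> S_group" for h
    by (cases h rule: int_cases2) (use nat S_group_uminus[OF nat] in auto)
  then have "(m, h) \<in> S_group" for m h using S_group_add[OF flat[of m], of "(0, h)"] by simp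
  then show ?thesis by auto
qed

text \<open>Removing the integral parts of its coefficients writes a lattice point of
  \<open>C\<close> as an element of \<open>S\<close> plus one of finitely many remainders. Each
  remainder is a difference s - t of elements of \<open>S\<close>, and the sum of all these t clears
  every denominator at once.\<close>

lemma conductor: obtains c where "c \<in> S" "\<And>z. rpair z \<in> C \<Longrightarrow> c + z \<in> S"
proof -
  obtain M where M: "M > 0" "\<And>p. p \<in> C \<Longrightarrow> norm p \<le> M * snd p" by (rule norm_C_le) blast
  \<comment> \<open>Fractional parts lie below 1, so a remainder has height at most
    \<open>card B\<close>, hence norm at most \<open>M * card B\<close>.\<close>
  define F :: "((int ^ 'n) \<times> int) set" where "F = {z. norm (rpair z) \<le> M * real (card B)}"
  have "finite (rpair ` F)"
    by (rule finite_int_lattice_bounded) (auto simp: F_def bounded_iff simp flip: range_rpair)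
  then have finF: "finite F" by (rule finite_imageD) (use inj_rpair in \<open>auto intro: inj_on_subset\<close>)
  have "\<forall>z. \<exists>s t. s \<in> S \<and> t \<in> S \<and> z = s - t" using S_group_eq unfolding S_group_def by blast
  then obtain s t where st: "\<And>z. s z \<in> S" "\<And>z. t z \<in> S" "\<And>z. z = s z - t z" by metis
  show ?thesis
  proof
    show "sum t F \<in> S" by (rule sum_in_S) (rule st)
    fix z :: "(int ^ 'n) \<times> int" assume "rpair z \<in> C"
    then obtain c where c: "\<And>u. u \<in> B \<Longrightarrow> 0 \<le> c u" "rpair z = (\<Sum>u\<in>B. c u *\<^sub>R rpair (u, 1))"
      by (rule C_decomp) blast
    define y where "y = (\<Sum>u\<in>B. \<Sum>i<nat \<lfloor>c u\<rfloor>. (u, 1 :: int))"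
    have yS: "y \<in> S" unfolding y_def by (intro sum_in_S gen_in_S)
    have ry: "rpair y = (\<Sum>u\<in>B. real_of_int \<lfloor>c u\<rfloor> *\<^sub>R rpair (u, 1))"
      unfolding y_def rpair_sum using c(1) by (intro sum.cong) (auto simp: sum_constant_scaleR of_nat_nat)
    have diff: "rpair (z - y) = (\<Sum>u\<in>B. frac (c u) *\<^sub>R rpair (u, 1))"
      by (simp add: c(2) ry frac_def scaleR_diff_left sum_subtractf)
    have inC: "rpair (z - y) \<in> C"
      unfolding diff
    proof -
      have "(\<Sum>u\<in>I. frac (c u) *\<^sub>R rpair (u, 1)) \<in> C" if "I \<subseteq> B" for I
        using that by (induction I rule: infinite_finite_induct)
          (auto simp: zero_in_C intro!: cone_over_add cone_over_scaleR rpair_gen_in_C)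
      then show "(\<Sum>u\<in>B. frac (c u) *\<^sub>R rpair (u, 1)) \<in> C" by simp
    qed
    have "snd (rpair (z - y)) = (\<Sum>u\<in>B. frac (c u))"
      unfolding diff by (simp add: snd_sum rpair_def)
    also have "\<dots> \<le> (\<Sum>u\<in>B. 1)" by (intro sum_mono) (simp add: less_imp_le frac_lt_1)
    finally have "M * snd (rpair (z - y)) \<le> M * real (card B)" using M(1) by (intro mult_left_mono) auto
    then have "z - y \<in> F" using M(2)[OF inC] unfolding F_def by simp
    then have "sum t F = t (z - y) + sum t (F - {z - y})" using finF by (simp add: sum.remove)
    then have "sum t F + z = s (z - y) + (sum t (F - {z - y}) + y)"
      using st(3)[of "z - y"] by (simp add: algebra_simps)
    then show "sum t F + z \<in> S" using st yS by (simp add: add_mem sum_in_S)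
  qed
qed

text \<open>Away from the frontier \<open>S\<close> and the lattice points of \<open>C\<close> are
  indistinguishable at large scale: the conductor shift vanishes after division by q, so an interior
  limit keeps \<open>w q - c\<close> in \<open>C\<close>, while the complement of \<open>C\<close>
  is open.\<close>

lemma eventually_in_S_iff:
  assumes lim: "(\<lambda>q. rpair (w q) /\<^sub>R real q) \<longlonglongrightarrow> y" and y: "y \<notin> frontier C"
  shows "\<forall>\<^sub>F q in sequentially. w q \<in> S \<longleftrightarrow> y \<in> C"
proof (cases "y \<in> C")
  case True
  then have int: "y \<in> interior C" using y closed_C by (simp add: frontier_def closure_closed)
  obtain c where c: "c \<in> S" "\<And>z. rpair z \<in> C \<Longrightarrow> c + z \<in> S" by (rule conductor) blast
  have "(\<lambda>q. rpair c /\<^sub>R real q) \<longlonglongrightarrow> 0 *\<^sub>R rpair c"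
    by (intro tendsto_scaleR tendsto_const lim_inverse_n[unfolded inverse_eq_divide[symmetric]] ) 
  then have "(\<lambda>q. rpair (w q) /\<^sub>R real q - rpair c /\<^sub>R real q) \<longlonglongrightarrow> y - 0 *\<^sub>R rpair c" by (rule tendsto_diff[OF lim])
  then have "(\<lambda>q. rpair (w q - c) /\<^sub>R real q) \<longlonglongrightarrow> y" by (simp add: scaleR_diff_right)
  then have "\<forall>\<^sub>F q in sequentially. rpair (w q - c) /\<^sub>R real q \<in> interior C"
    using int by (rule topological_tendstoD[OF _ open_interior])
  then show ?thesis using eventually_gt_at_top[of 0]
  proof eventually_elim
    case (elim q)
    then have "rpair (w q - c) /\<^sub>R real q \<in> C" using interior_subset by blast
    from cone_over_scaleR[OF this, of "real q"] have "rpair (w q - c) \<in> C" using elim by simp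
    then show ?case using c(2)[of "w q - c"] True by simp
  qed
next
  case False
  then have "\<forall>\<^sub>F q in sequentially. rpair (w q) /\<^sub>R real q \<in> - C"
    using closed_C by (intro topological_tendstoD[OF lim]) auto
  then show ?thesis
  proof eventually_elim
    case (elim q)
    then have "rpair (w q) \<notin> C" using cone_over_scaleR[of "rpair (w q)" Q "inverse (real q)"] by auto
    then show ?case using rpair_S_in_C False by blast
  qed
qed

end

section \<open>Multiplicities as volumes of regions in the cone\<close>

context generating_points
begin

lemma card_rpair_image:
  "card (rpair ` X) = card X"
  by (rule card_image) (use inj_rpair in \<open>auto intro: inj_on_subset\<close>)

lemma rpair_inv: "rpair (inv_into UNIV rpair (int_floor x)) = int_floor x"
  using int_floor_in_lattice[of x] by (simp flip: range_rpair add: f_inv_into_f)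

lemma int_floor_in_rpair_image: "int_floor x \<in> rpair ` X \<longleftrightarrow> inv_into UNIV rpair (int_floor x) \<in> X"
  by (metis (no_types, lifting) image_iff inj_rpair inv_f_f rpair_inv)

lemma finite_S_below: "finite {s \<in> S. snd s < h}"
proof -
  obtain M where M: "M > 0" "\<And>p. p \<in> C \<Longrightarrow> norm p \<le> M * snd p" by (rule norm_C_le) blast
  have "finite (rpair ` {s \<in> S. snd s < h})"
  proof (rule finite_int_lattice_bounded)
    show "bounded (rpair ` {s \<in> S. snd s < h})"
      unfolding bounded_iff
    proof (intro exI[of _ "M * h"] ballI)
      fix p assume "p \<in> rpair ` {s \<in> S. snd s < h}"
      then obtain s where s: "s \<in> S" "snd s < h" "p = rpair s" by auto
      have "norm p \<le> M * snd p" using s rpair_S_in_C M(2) by simp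
      also have "\<dots> \<le> M * h" using s(2) M(1) by (simp add: s(3) rpair_def)
      finally show "norm p \<le> M * h" .
    qed
  qed (simp flip: range_rpair add: image_mono)
  then show ?thesis by (rule finite_imageD) (use inj_rpair in \<open>auto intro: inj_on_subset\<close>)
qed

text \<open>Since \<open>S\<close> is generated in height 1, an element of height at least n + 1 is
  a generator plus an element of height at least n. Powers of the maximal ideal are therefore cut
  out by height.\<close>

lemma ideal_power:
  "semigroup_algebra {s \<in> S. snd s > 0} [^]\<^bsub>ideals_set (semigroup_ring S :: ((int ^ 'n) \<times> int \<Rightarrow>\<^sub>0 'k::field) ring)\<^esub> n =
    semigroup_algebra {s \<in> S. snd s \<ge> int n}"
proof (induction n)
  case 0
  have "{s \<in> S. snd s \<ge> 0} = S" using snd_S_nonneg by auto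
  then show ?case by (simp add: nat_pow_def ideals_set_def)
next
  case (Suc n)
  have "{a + b | a b. a \<in> {s \<in> S. snd s \<ge> int n} \<and> b \<in> {s \<in> S. snd s > 0}} = {s \<in> S. snd s \<ge> int (Suc n)}"
  proof (intro equalityI subsetI)
    fix s assume s: "s \<in> {s \<in> S. snd s \<ge> int (Suc n)}"
    then obtain u s' where "u \<in> B" "s' \<in> S" "s = (u, 1) + s'" using S_pos_cases[of s] by auto
    then show "s \<in> {a + b | a b. a \<in> {s \<in> S. snd s \<ge> int n} \<and> b \<in> {s \<in> S. snd s > 0}}"
      using s gen_in_S by (intro CollectI exI[of _ s'] exI[of _ "(u, 1)"]) (auto simp: add.commute)
  next
    fix s assume "s \<in> {a + b | a b. a \<in> {s \<in> S. snd s \<ge> int n} \<and> b \<in> {s \<in> S. snd s > 0}}"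
    then obtain a b where "a \<in> S" "snd a \<ge> int n" "b \<in> S" "snd b > 0" "s = a + b" by blast
    then show "s \<in> {s \<in> S. snd s \<ge> int (Suc n)}" using add_mem[of a b] by simp
  qed
  moreover have "semigroup_algebra {s \<in> S. snd s > 0} [^]\<^bsub>ideals_set (semigroup_ring S :: ((int ^ 'n) \<times> int \<Rightarrow>\<^sub>0 'k) ring)\<^esub> Suc n =
    ideal_prod (semigroup_ring S :: ((int ^ 'n) \<times> int \<Rightarrow>\<^sub>0 'k) ring) (semigroup_algebra {s \<in> S. snd s \<ge> int n}) (semigroup_algebra {s \<in> S. snd s > 0})"
    using Suc by (simp add: nat_pow_def ideals_set_def)
  ultimately show ?case
  proof (subst (asm) ideal_prod_semigroup_algebra)
    fix s t assume s: "s \<in> S"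
    show "s + t \<in> {s \<in> S. int n \<le> snd s}" if "t \<in> {s \<in> S. int n \<le> snd s}"
      using that s add_mem[of s t] snd_S_nonneg[of s] by simp
    show "s + t \<in> {s \<in> S. 0 < snd s}" if "t \<in> {s \<in> S. 0 < snd s}"
      using that s add_mem[of s t] snd_S_nonneg[of s] by simp
  qed auto
qed

lemma snd_less_add: "s \<in> S \<Longrightarrow> s \<noteq> 0 \<Longrightarrow> t \<in> S \<Longrightarrow> snd t < snd (s + t)"
  using snd_S_pos by simp

lemma quotient_length_power:
  "quotient_length (semigroup_ring S :: ((int ^ 'n) \<times> int \<Rightarrow>\<^sub>0 'k::field) ring)
    (semigroup_algebra {s \<in> S. snd s > 0} [^]\<^bsub>ideals_set (semigroup_ring S :: ((int ^ 'n) \<times> int \<Rightarrow>\<^sub>0 'k::field) ring)\<^esub> n) =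
    enat (card {s \<in> S. snd s < int n})"
proof -
  have eq: "S - {s \<in> S. snd s \<ge> int n} = {s \<in> S. snd s < int n}" by auto
  show ?thesis
    unfolding ideal_power
  proof (rule quotient_length_monomial_ideal[of snd "{s \<in> S. snd s \<ge> int n}", unfolded eq])
    fix s t assume "s \<in> S" "t \<in> {s \<in> S. snd s \<ge> int n}"
    then show "s + t \<in> {s \<in> S. snd s \<ge> int n}" using add_mem[of s t] snd_S_nonneg[of s] by auto
  qed (use snd_less_add finite_S_below in auto)
qed

lemma card_S_below_tendsto:
  "(\<lambda>n. card {s \<in> S. snd s < int n} / real n ^ (CARD('n) + 1)) \<longlonglongrightarrow> measure lborel {p \<in> C. snd p < 1}"
proof -
  obtain M where M: "M > 0" "\<And>p. p \<in> C \<Longrightarrow> norm p \<le> M * snd p" by (rule norm_C_le) blast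
  have "(\<lambda>n. card (rpair ` {s \<in> S. snd s < int n}) / real n ^ DIM((real ^ 'n) \<times> real)) \<longlonglongrightarrow> measure lborel {p \<in> C. snd p < 1}"
  proof (rule lattice_card_tendsto[where R = M])
    show "rpair ` {s \<in> S. snd s < int q} \<subseteq> int_lattice" for q by (simp flip: range_rpair add: image_mono)
    show "norm x \<le> M * real q" if "x \<in> rpair ` {s \<in> S. snd s < int q}" for q x
    proof -
      from that obtain s where s: "s \<in> S" "snd s < int q" "x = rpair s" by auto
      have "norm x \<le> M * snd x" using s rpair_S_in_C M(2) by simp
      also have "\<dots> \<le> M * real q" using s(2) M(1) by (simp add: s(3) rpair_def)
      finally show ?thesis .
    qed
    show "{p \<in> C. snd p < 1} \<in> sets borel"
    proof -
      have "{p :: (real ^ 'n) \<times> real. snd p < 1} \<in> sets borel"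
        by (intro borel_open open_Collect_less continuous_intros)
      moreover have "C \<in> sets borel" using closed_C by (rule borel_closed)
      ultimately have "C \<inter> {p. snd p < 1} \<in> sets borel" by (rule sets.Int[rotated])
      then show ?thesis by (simp add: Int_def)
    qed
    \<comment> \<open>A limit point at height exactly 1 would leave the strict inequality undecided;
      such points form a null hyperplane.\<close>
    have "negligible {p :: (real ^ 'n) \<times> real. (0, 1) \<bullet> p = 1}" by (rule negligible_hyperplane) simp
    moreover have "{p :: (real ^ 'n) \<times> real. (0, 1) \<bullet> p = 1} \<in> sets borel" by (intro borel_closed closed_hyperplane)
    ultimately have "AE p in lborel. p \<notin> {p :: (real ^ 'n) \<times> real. (0, 1) \<bullet> p = 1}"
      by (intro AE_not_in) (simp add: negligible_iff_null_sets null_sets_completion_iff)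
    with AE_notin_frontier_convex[OF convex_C]
    show "AE x in lborel. \<forall>\<^sub>F q in sequentially.
      int_floor (real q *\<^sub>R x) \<in> rpair ` {s \<in> S. snd s < int q} \<longleftrightarrow> x \<in> {p \<in> C. snd p < 1}"
    proof eventually_elim
      case (elim x)
      define w where "w q = inv_into UNIV rpair (int_floor (real q *\<^sub>R x))" for q
      have w: "rpair (w q) = int_floor (real q *\<^sub>R x)" for q by (simp add: w_def rpair_inv)
      have lim: "(\<lambda>q. rpair (w q) /\<^sub>R real q) \<longlonglongrightarrow> x" unfolding w by (rule tendsto_int_floor_scaleR)
      have ev1: "\<forall>\<^sub>F q in sequentially. w q \<in> S \<longleftrightarrow> x \<in> C" by (rule eventually_in_S_iff[OF lim elim(1)])
      have ne: "snd x \<noteq> 1" using elim(2) by (simp add: inner_prod_def)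
      have lim2: "(\<lambda>q. snd (rpair (w q) /\<^sub>R real q)) \<longlonglongrightarrow> snd x" by (rule tendsto_snd[OF lim])
      have "\<forall>\<^sub>F q in sequentially. snd (rpair (w q) /\<^sub>R real q) < 1 \<longleftrightarrow> snd x < 1"
      proof (cases "snd x < 1")
        case True
        then show ?thesis using order_tendstoD(2)[OF lim2, of 1] by simp
      next
        case False
        then have "\<forall>\<^sub>F q in sequentially. 1 < snd (rpair (w q) /\<^sub>R real q)"
          using ne order_tendstoD(1)[OF lim2, of 1] by simp
        then show ?thesis by eventually_elim (use False in simp)
      qed
      then have "\<forall>\<^sub>F q in sequentially. snd (w q) < int q \<longleftrightarrow> snd x < 1"
        using eventually_gt_at_top[of 0]
      proof eventually_elim
        case (elim q)
        have "snd (rpair (w q) /\<^sub>R real q) < 1 \<longleftrightarrow> real_of_int (snd (w q)) < real q"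
          using elim(2) by (simp add: rpair_def divide_less_eq divide_inverse[symmetric] mult.commute[of "inverse _"])
        then show ?case using elim(1) by linarith
      qed
      with ev1 show ?case
        by eventually_elim (simp add: int_floor_in_rpair_image flip: w_def)
    qed
  qed
  then show ?thesis by (simp add: card_rpair_image)
qed

lemma sum_lessThan_add_const: "(\<Sum>i<m + n. t) = (\<Sum>i<m. t) + (\<Sum>i<(n::nat). t)" for t :: "'a::comm_monoid_add"
  by (induction n) (simp_all add: add.assoc)

lemma S_coeffs: 
  assumes "s \<in> S"
  obtains c :: "int ^ 'n \<Rightarrow> nat" where "s = (\<Sum>u\<in>B. \<Sum>i<c u. (u, 1))"
proof -
  have "\<exists>c :: int ^ 'n \<Rightarrow> nat. s = (\<Sum>u\<in>B. \<Sum>i<c u. (u, 1))"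
    using assms
  proof induction
    case zero
    then show ?case by (intro exI[of _ "\<lambda>_. 0"]) (simp del: sum_constant)
  next
    case (add g s)
    then obtain u and c :: "int ^ 'n \<Rightarrow> nat" where u: "u \<in> B" "g = (u, 1)" and c: "s = (\<Sum>u\<in>B. \<Sum>i<c u. (u, 1))" by auto
    have "(\<Sum>v\<in>B. \<Sum>i<(c(u := Suc (c u))) v. (v, 1::int)) = (u, 1) + (\<Sum>v\<in>B. \<Sum>i<c v. (v, 1))"
    proof -
      have "(\<Sum>v\<in>B. \<Sum>i<(c(u := Suc (c u))) v. (v, 1::int)) =
        (\<Sum>i<Suc (c u). (u, 1)) + (\<Sum>v\<in>B - {u}. \<Sum>i<(c(u := Suc (c u))) v. (v, 1))"
        unfolding sum.remove[OF finite_B u(1)] by (simp only: fun_upd_same)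
      also have "(\<Sum>v\<in>B - {u}. \<Sum>i<(c(u := Suc (c u))) v. (v, 1)) = (\<Sum>v\<in>B - {u}. \<Sum>i<c v. (v, 1::int))"
        by (rule sum.cong) auto
      also have "(\<Sum>i<Suc (c u). (u, 1::int)) = (u, 1) + (\<Sum>i<c u. (u, 1))"
        by (simp only: sum.lessThan_Suc add.commute)
      finally show ?thesis unfolding sum.remove[OF finite_B u(1), of "\<lambda>v. \<Sum>i<c v. (v, 1)"]
        by (simp only: add.assoc)
    qed
    then show ?case by (intro exI[of _ "c(u := Suc (c u))"]) (simp only: u(2) c)
  qed
  then show ?thesis using that by blast
qed

definition hk_set :: "nat \<Rightarrow> ((int ^ 'n) \<times> int) set" where
  "hk_set q = {s \<in> S. \<forall>u\<in>B. s - (\<Sum>i<q. (u, 1)) \<notin> S}"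

text \<open>An element t of positive height is a generator plus some t' in \<open>S\<close>, and the
  q-fold multiple of t' is absorbed by s. So the q-fold generators alone produce the Frobenius
  power.\<close>

lemma hk_set_eq: "S - {s + (\<Sum>i<q. t) | s t. s \<in> S \<and> t \<in> {s \<in> S. snd s > 0}} = hk_set q"
proof (intro equalityI subsetI)
  fix s assume s: "s \<in> S - {s + (\<Sum>i<q. t) | s t. s \<in> S \<and> t \<in> {s \<in> S. snd s > 0}}"
  then show "s \<in> hk_set q"
    unfolding hk_set_def
  proof (intro CollectI conjI ballI notI)
    fix u assume u: "u \<in> B" "s - (\<Sum>i<q. (u, 1)) \<in> S"
    have "s = (s - (\<Sum>i<q. (u, 1))) + (\<Sum>i<q. (u, 1))" by simp
    moreover have "(u, 1) \<in> {s \<in> S. snd s > 0}" using gen_in_S[OF u(1)] by simp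
    ultimately show False using s u(2) by blast
  qed simp
next
  fix s assume s: "s \<in> hk_set q"
  show "s \<in> S - {s + (\<Sum>i<q. t) | s t. s \<in> S \<and> t \<in> {s \<in> S. snd s > 0}}"
  proof (intro DiffI notI)
    assume "s \<in> {s + (\<Sum>i<q. t) | s t. s \<in> S \<and> t \<in> {s \<in> S. snd s > 0}}"
    then obtain s0 t where st: "s = s0 + (\<Sum>i<q. t)" "s0 \<in> S" "t \<in> S" "snd t > 0" by auto
    obtain u t' where t: "u \<in> B" "t' \<in> S" "t = (u, 1) + t'" using S_pos_cases[OF st(3,4)] .
    have "s - (\<Sum>i<q. (u, 1)) = s0 + (\<Sum>i<q. t')" by (simp only: st(1) t(3) sum.distrib) (simp add: algebra_simps del: sum_constant)
    also have "\<dots> \<in> S" using st(2) t(2) by (intro add_mem sum_in_S)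
    finally show False using s t(1) by (auto simp: hk_set_def)
  qed (use s in \<open>simp add: hk_set_def\<close>)
qed

text \<open>Write s as a sum of generators. If one of them occurred q times, its q-fold multiple
  could be split off within \<open>S\<close>; so each occurs fewer than q times.\<close>

lemma snd_hk_set_less:
  assumes "s \<in> hk_set q" "q > 0"
  shows "snd s < int (card B * q)"
proof -
  obtain c :: "int ^ 'n \<Rightarrow> nat" where c: "s = (\<Sum>u\<in>B. \<Sum>i<c u. (u, 1))" using S_coeffs[of s] assms by (auto simp: hk_set_def)
  have less: "c u < q" if u: "u \<in> B" for u
  proof (rule ccontr)
    assume "\<not> c u < q"
    then obtain m where m: "c u = m + q" using le_Suc_ex[of q "c u"] by (auto simp: add.commute)
    have "s = (\<Sum>i<m. (u, 1)) + (\<Sum>i<q. (u, 1)) + (\<Sum>v\<in>B - {u}. \<Sum>i<c v. (v, 1))"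
      unfolding c using u finite_B by (simp only: sum.remove[of B u] m sum_lessThan_add_const)
    then have "s - (\<Sum>i<q. (u, 1)) = (\<Sum>i<m. (u, 1)) + (\<Sum>v\<in>B - {u}. \<Sum>i<c v. (v, 1))"
      by (simp add: algebra_simps del: sum_constant)
    also have "\<dots> \<in> S" using u by (intro add_mem sum_in_S gen_in_S) auto
    finally show False using assms(1) u by (auto simp: hk_set_def)
  qed
  have "snd s = (\<Sum>u\<in>B. int (c u))" unfolding c by (simp add: snd_sum)
  also have "\<dots> < (\<Sum>u\<in>B. int q)" using finite_B nonempty_B less by (intro sum_strict_mono) auto
  finally show ?thesis by simp
qed

lemma quotient_length_frobenius:
  assumes "p = CHAR('k::field)" "p > 0"
  shows "quotient_length (semigroup_ring S :: ((int ^ 'n) \<times> int \<Rightarrow>\<^sub>0 'k) ring)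
    (frobenius_power (semigroup_ring S) (semigroup_algebra {s \<in> S. snd s > 0}) (p ^ e)) = enat (card (hk_set (p ^ e)))"
proof -
  let ?T = "{s + (\<Sum>i<p ^ e. t) | s t. s \<in> S \<and> t \<in> {s \<in> S. snd s > 0}}"
  have fr: "frobenius_power (semigroup_ring S :: ((int ^ 'n) \<times> int \<Rightarrow>\<^sub>0 'k) ring) (semigroup_algebra {s \<in> S. snd s > 0}) (p ^ e) =
    semigroup_algebra ?T"
    by (rule frobenius_power_semigroup_algebra[OF assms]) auto
  have "quotient_length (semigroup_ring S :: ((int ^ 'n) \<times> int \<Rightarrow>\<^sub>0 'k) ring) (semigroup_algebra ?T) = enat (card (S - ?T))"
  proof (rule quotient_length_monomial_ideal[of snd])
    have "hk_set (p ^ e) \<subseteq> {s \<in> S. snd s < int (card B * p ^ e)}"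
      using snd_hk_set_less[of _ "p ^ e"] assms(2) by (auto simp: hk_set_def)
    then show "finite (S - ?T)" unfolding hk_set_eq by (rule finite_subset) (rule finite_S_below)
    show "?T \<subseteq> S" by (auto intro!: add_mem sum_in_S)
    fix u v assume u: "u \<in> S" and "v \<in> ?T"
    then obtain s t where st: "s \<in> S" "t \<in> {s \<in> S. snd s > 0}" "v = s + (\<Sum>i<p ^ e. t)" by blast
    then have "u + v = (u + s) + (\<Sum>i<p ^ e. t)" by (simp only: add.assoc)
    then show "u + v \<in> ?T" using u st add_mem by blast
  qed (rule snd_less_add)
  then show ?thesis unfolding fr hk_set_eq .
qed

text \<open>The limit shape of \<open>hk_set q\<close> scaled by 1 / q.\<close>

definition hk_region :: "((real ^ 'n) \<times> real) set" where
  "hk_region = {p \<in> C. \<forall>u\<in>B. p - rpair (u, 1) \<notin> C}"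

lemma sets_hk_region [measurable]: "hk_region \<in> sets borel"
proof -
  have [measurable]: "C \<in> sets borel" using closed_C by (rule borel_closed)
  have "hk_region = C \<inter> (\<Inter>u\<in>B. {p. p - rpair (u, 1) \<notin> C})" by (auto simp: hk_region_def)
  also have "\<dots> \<in> sets borel" using finite_B nonempty_B by measurable
  finally show ?thesis .
qed

lemma card_hk_set_tendsto:
  "(\<lambda>q. card (hk_set q) / real q ^ (CARD('n) + 1)) \<longlonglongrightarrow> measure lborel hk_region"
proof -
  obtain M where M: "M > 0" "\<And>p. p \<in> C \<Longrightarrow> norm p \<le> M * snd p" by (rule norm_C_le) blast
  have "(\<lambda>q. card (rpair ` hk_set q) / real q ^ DIM((real ^ 'n) \<times> real)) \<longlonglongrightarrow> measure lborel hk_region"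
  proof (rule lattice_card_tendsto[where R = "M * card B"])
    show "rpair ` hk_set q \<subseteq> int_lattice" for q by (simp flip: range_rpair add: image_mono)
    show "norm x \<le> M * card B * real q" if "q > 0" "x \<in> rpair ` hk_set q" for q x
    proof -
      from that obtain s where s: "s \<in> hk_set q" "x = rpair s" by auto
      have "norm x \<le> M * snd x" using s rpair_S_in_C M(2) by (simp add: hk_set_def)
      also have "snd s \<le> int (card B * q)" using snd_hk_set_less[OF s(1)] that(1) by simp
      then have "snd x \<le> real (card B * q)" unfolding s(2) rpair_def by (simp flip: of_int_le_iff[where 'a = real])
      then have "M * snd x \<le> M * real (card B * q)" using M(1) by (intro mult_left_mono) auto
      finally show ?thesis by simp
    qed
    have "AE x in lborel. \<forall>u\<in>B. x \<notin> frontier ((+) (rpair (u, 1)) ` C)"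
      using finite_B by (intro AE_finite_allI AE_notin_frontier_convex convex_translation convex_C)
    with AE_notin_frontier_convex[OF convex_C]
    show "AE x in lborel. \<forall>\<^sub>F q in sequentially. int_floor (real q *\<^sub>R x) \<in> rpair ` hk_set q \<longleftrightarrow> x \<in> hk_region"
    proof eventually_elim
      case (elim x)
      define w where "w q = inv_into UNIV rpair (int_floor (real q *\<^sub>R x))" for q
      have w: "rpair (w q) = int_floor (real q *\<^sub>R x)" for q by (simp add: w_def rpair_inv)
      have lim: "(\<lambda>q. rpair (w q) /\<^sub>R real q) \<longlonglongrightarrow> x" unfolding w by (rule tendsto_int_floor_scaleR)
      have ev1: "\<forall>\<^sub>F q in sequentially. w q \<in> S \<longleftrightarrow> x \<in> C" by (rule eventually_in_S_iff[OF lim elim(1)])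
      have ev2: "\<forall>\<^sub>F q in sequentially. \<forall>u\<in>B. w q - (\<Sum>i<q. (u, 1)) \<in> S \<longleftrightarrow> x - rpair (u, 1) \<in> C"
      proof (rule eventually_ball_finite[OF finite_B], rule ballI)
        fix u assume u: "u \<in> B"
        have "x - rpair (u, 1) \<notin> frontier C" using elim(2) u by (force simp: frontier_translation)
        moreover have "(\<lambda>q. rpair (w q - (\<Sum>i<q. (u, 1))) /\<^sub>R real q) \<longlonglongrightarrow> x - rpair (u, 1)"
        proof (rule Lim_transform_eventually)
          show "(\<lambda>q. rpair (w q) /\<^sub>R real q - rpair (u, 1)) \<longlonglongrightarrow> x - rpair (u, 1)"
            by (intro tendsto_diff lim tendsto_const)
          show "\<forall>\<^sub>F q in sequentially. rpair (w q) /\<^sub>R real q - rpair (u, 1) = rpair (w q - (\<Sum>i<q. (u, 1))) /\<^sub>R real q"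
            using eventually_gt_at_top[of 0]
            by eventually_elim (simp add: rpair_sum sum_constant_scaleR scaleR_diff_right del: sum_constant)
        qed
        ultimately show "\<forall>\<^sub>F q in sequentially. w q - (\<Sum>i<q. (u, 1)) \<in> S \<longleftrightarrow> x - rpair (u, 1) \<in> C"
          by (intro eventually_in_S_iff)
      qed
      from ev1 ev2 show ?case
        by eventually_elim (simp add: int_floor_in_rpair_image hk_set_def hk_region_def del: sum_constant flip: w_def)
    qed
  qed measurable
  then show ?thesis by (simp add: card_rpair_image)
qed

lemma hilbert_samuel_mult_eq:
  "hilbert_samuel_mult (semigroup_ring S :: ((int ^ 'n) \<times> int \<Rightarrow>\<^sub>0 'k::field) ring)
    (semigroup_algebra {s \<in> S. snd s > 0}) (CARD('n) + 1) = fact (CARD('n) + 1) * measure lborel {p \<in> C. snd p < 1}"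
  unfolding hilbert_samuel_mult_def quotient_length_power the_enat.simps
  using tendsto_mult[OF tendsto_const card_S_below_tendsto, of "fact (CARD('n) + 1)"] by (intro limI) simp

lemma hilbert_kunz_mult_eq:
  assumes p: "p = CHAR('k::field)" "p > 0"
  shows "hilbert_kunz_mult p (semigroup_ring S :: ((int ^ 'n) \<times> int \<Rightarrow>\<^sub>0 'k) ring)
    (semigroup_algebra {s \<in> S. snd s > 0}) (CARD('n) + 1) = measure lborel hk_region"
  unfolding hilbert_kunz_mult_def quotient_length_frobenius[OF p] the_enat.simps
proof (rule limI)
  have "prime p" using p prime_CHAR_semidom by blast
  \<comment> \<open>The counts converge along all q; the lengths are the subsequence of prime
    powers.\<close>
  then have "filterlim (\<lambda>e. p ^ e) sequentially sequentially"
    by (intro filterlim_subseq strict_monoI power_strict_increasing prime_gt_1_nat)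
  from filterlim_compose[OF card_hk_set_tendsto this]
  show "(\<lambda>n. card (hk_set (p ^ n)) / real (p ^ n) ^ (CARD('n) + 1)) \<longlonglongrightarrow> measure lborel hk_region" .
qed

end

section \<open>The polytope of a toric pair\<close>

lemma convex_cone_hull_singleton:
  "convex_cone hull {x} = {c *\<^sub>R x | c. 0 \<le> c}" (is "?L = ?R")
proof
  have "convex_cone ?R"
    unfolding convex_cone_iff
  proof (intro conjI ballI allI impI)
    fix u v assume "u \<in> ?R" "v \<in> ?R"
    then obtain b c where "u = b *\<^sub>R x" "v = c *\<^sub>R x" "0 \<le> b" "0 \<le> c" by auto
    then show "u + v \<in> ?R" by (intro CollectI exI[of _ "b + c"]) (simp add: scaleR_add_left)
  next
    fix u and c :: real assume "u \<in> ?R" "0 \<le> c"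
    then obtain b where "u = b *\<^sub>R x" "0 \<le> b" by auto
    then show "c *\<^sub>R u \<in> ?R" using \<open>0 \<le> c\<close> by (intro CollectI exI[of _ "c * b"]) simp
  qed (auto intro: exI[of _ 0])
  moreover have "{x} \<subseteq> ?R" by (auto intro: exI[of _ 1])
  ultimately show "?L \<subseteq> ?R" by (rule hull_minimal[rotated])
  show "?R \<subseteq> ?L"
    by (auto intro: convex_cone_hull_mul hull_inc)
qed

lemma primitive_multiple:
  assumes "a \<noteq> 0"
  obtains g v where "g > 0" "primitive v" "rvec a = of_int g *\<^sub>R rvec v"
proof
  define g where "g = Gcd (range (\<lambda>i. a $ i))"
  define v where "v = (\<chi> i. a $ i div g)"
  obtain i where "a $ i \<noteq> 0" using assms by (auto simp: vec_eq_iff)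
  then have "g \<noteq> 0" by (auto simp: g_def)
  moreover have "g \<ge> 0" by (simp add: g_def)
  ultimately show "g > 0" by simp
  have dvd: "g dvd a $ i" for i unfolding g_def by (rule Gcd_dvd) simp
  then have av: "a $ i = g * v $ i" for i by (simp add: v_def)
  have "g = Gcd ((*) g ` range (\<lambda>i. v $ i))"
    by (subst (1) g_def) (simp add: av image_image)
  also have "\<dots> = g * Gcd (range (\<lambda>i. v $ i))"
    using \<open>g > 0\<close> by (simp add: Gcd_mult abs_mult)
  finally show "primitive v" using \<open>g > 0\<close> by (simp add: primitive_def)
  show "rvec a = of_int g *\<^sub>R rvec v" by (simp add: rvec_def vec_eq_iff av)
qed

text \<open>Let x = c a lie strictly between p and q, and write both as a multiple of a plus an
  element of the hull of \<open>A\<close>. Comparison gives (c - e) a = h. If c > e, then a would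
  lie in the hull of \<open>A\<close>. Otherwise both h and -h lie in \<open>\<sigma>\<close>, so
  strong convexity kills h and then its two summands.\<close>

lemma minimal_generator_face:
  assumes conv: "\<And>x. x \<in> \<sigma> \<Longrightarrow> - x \<in> \<sigma> \<Longrightarrow> x = 0"
    and \<sigma>: "\<sigma> = convex_cone hull (insert a A)" and a: "a \<notin> convex_cone hull A"
  shows "(convex_cone hull {a}) face_of \<sigma>"
  unfolding face_of_def
proof (intro conjI ballI impI)
  let ?H = "convex_cone hull A" and ?F = "convex_cone hull {a}"
  show "?F \<subseteq> \<sigma>" unfolding \<sigma> by (rule hull_mono) auto
  show "convex ?F" by (rule convex_convex_cone_hull)
  have H\<sigma>: "?H \<subseteq> \<sigma>" unfolding \<sigma> by (rule hull_mono) auto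
  have a\<sigma>: "a \<in> \<sigma>" unfolding \<sigma> by (rule hull_inc) simp
  have scale\<sigma>: "c *\<^sub>R x \<in> \<sigma>" if "x \<in> \<sigma>" "0 \<le> c" for c x
    using that unfolding \<sigma> by (intro convex_cone_hull_mul)
  have decomp: "\<exists>c h. 0 \<le> c \<and> h \<in> ?H \<and> x = c *\<^sub>R a + h" if "x \<in> \<sigma>" for x
  proof -
    have "\<sigma> = convex_cone hull ({a} \<union> A)" unfolding \<sigma> by simp
    also have "\<dots> = (\<Union>x\<in>?F. \<Union>y\<in>?H. {x + y})" by (rule convex_cone_hull_Un)
    finally show ?thesis using that unfolding convex_cone_hull_singleton by blast
  qed
  fix p q x assume pq: "p \<in> \<sigma>" "q \<in> \<sigma>" and x: "x \<in> ?F" "x \<in> open_segment p q"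
  obtain c1 h1 where p: "0 \<le> c1" "h1 \<in> ?H" "p = c1 *\<^sub>R a + h1" using decomp[OF pq(1)] by auto
  obtain c2 h2 where q: "0 \<le> c2" "h2 \<in> ?H" "q = c2 *\<^sub>R a + h2" using decomp[OF pq(2)] by auto
  obtain c where c: "0 \<le> c" "x = c *\<^sub>R a" using x(1) unfolding convex_cone_hull_singleton by auto
  obtain u where u: "0 < u" "u < 1" "x = (1 - u) *\<^sub>R p + u *\<^sub>R q"
    using x(2) by (auto simp: in_segment)
  define e where "e = (1 - u) * c1 + u * c2"
  define h where "h = (1 - u) *\<^sub>R h1 + u *\<^sub>R h2"
  have hH: "h \<in> ?H" unfolding h_def using p q u by (intro convex_cone_hull_add convex_cone_hull_mul) auto
  have eq: "(c - e) *\<^sub>R a = h"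
    using c(2) u(3) unfolding p(3) q(3) e_def h_def by (simp add: algebra_simps)
  have "c \<le> e"
  proof (rule ccontr)
    assume "\<not> c \<le> e"
    then have "a = inverse (c - e) *\<^sub>R h" by (simp flip: eq)
    then show False using a hH \<open>\<not> c \<le> e\<close> convex_cone_hull_mul[OF hH, of "inverse (c - e)"] by simp
  qed
  then have "- h \<in> \<sigma>" using scale\<sigma>[OF a\<sigma>, of "e - c"] by (simp flip: eq add: algebra_simps)
  then have h0: "h = 0" using conv[of h] hH H\<sigma> by auto
  have u1: "(1 - u) *\<^sub>R h1 \<in> \<sigma>" "u *\<^sub>R h2 \<in> \<sigma>" using p q u H\<sigma> by (auto intro!: scale\<sigma>)
  have "- ((1 - u) *\<^sub>R h1) = u *\<^sub>R h2" using h0 unfolding h_def by (simp add: neg_eq_iff_add_eq_0)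
  then have "(1 - u) *\<^sub>R h1 = 0" using conv[of "(1 - u) *\<^sub>R h1"] u1 by simp
  then have "h1 = 0" "h2 = 0" using h0 u unfolding h_def by auto
  then show "p \<in> ?F" "q \<in> ?F" using p q unfolding convex_cone_hull_singleton by auto
qed

text \<open>A generating set of least cardinality has no redundant member, so each member spans a
  face and hence a ray of the fan. The polytope is defined by inequalities for ray generators; this
  carries them over to all of \<open>\<sigma>\<close>.\<close>

lemma fan_cone_generated_by_rays:
  fixes \<sigma> :: "(real ^ 'n) set"
  assumes fan: "complete_fan \<Delta>" and \<sigma>: "\<sigma> \<in> \<Delta>"
  shows "\<sigma> \<subseteq> convex_cone hull (rvec ` {v \<in> ray_gens \<Delta>. rvec v \<in> \<sigma>})"
proof -
  have sc: "strongly_convex_rational_cone \<sigma>" using fan \<sigma> by (simp add: complete_fan_def)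
  obtain A0 :: "(int ^ 'n) set" where A0: "finite A0" "\<sigma> = convex_cone hull (rvec ` A0)"
    using sc by (auto simp: strongly_convex_rational_cone_def)
  have conv: "x = 0" if "x \<in> \<sigma>" "- x \<in> \<sigma>" for x using that sc by (auto simp: strongly_convex_rational_cone_def)
  obtain A where A: "finite A" "\<sigma> = convex_cone hull (rvec ` A)"
    and min: "\<And>A'. finite A' \<Longrightarrow> \<sigma> = convex_cone hull (rvec ` A') \<Longrightarrow> card A \<le> card A'"
    using ex_has_least_nat[of "\<lambda>A. finite A \<and> \<sigma> = convex_cone hull (rvec ` A)" A0 card] A0 by blast
  have "rvec a \<in> convex_cone hull (rvec ` {v \<in> ray_gens \<Delta>. rvec v \<in> \<sigma>})" if a: "a \<in> A" for a
  proof -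
    have ins: "insert (rvec a) (rvec ` (A - {a})) = rvec ` A" using a by auto
    have notin: "rvec a \<notin> convex_cone hull (rvec ` (A - {a}))"
    proof
      assume "rvec a \<in> convex_cone hull (rvec ` (A - {a}))"
      then have "convex_cone hull (insert (rvec a) (rvec ` (A - {a}))) = convex_cone hull (rvec ` (A - {a}))"
        by (rule hull_redundant)
      then have "\<sigma> = convex_cone hull (rvec ` (A - {a}))" using A(2) ins by simp
      then have "card A \<le> card (A - {a})" using A(1) by (intro min) auto
      then show False using a A(1) by (metis card_Diff1_less not_le)
    qed
    have a0: "a \<noteq> 0" using notin convex_cone_hull_contains_0 by (metis rvec_simps(1))
    have face: "(convex_cone hull {rvec a}) face_of \<sigma>"
      by (rule minimal_generator_face[OF conv _ notin]) (simp_all add: ins A(2))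
    then have mem: "convex_cone hull {rvec a} \<in> \<Delta>"
    proof -
      have "\<forall>\<sigma>\<in>\<Delta>. \<forall>\<tau>. \<tau> face_of \<sigma> \<and> \<tau> \<noteq> {} \<longrightarrow> \<tau> \<in> \<Delta>"
        using fan unfolding complete_fan_def by (elim conjE)
      with \<sigma> face convex_cone_hull_nonempty show ?thesis by metis
    qed
    obtain g v where gv: "g > 0" "primitive v" "rvec a = of_int g *\<^sub>R rvec v" using primitive_multiple[OF a0] .
    have v: "rvec v = inverse (of_int g) *\<^sub>R rvec a" using gv by simp
    have "convex_cone hull {rvec v} = convex_cone hull {rvec a}"
    proof
      show "convex_cone hull {rvec v} \<subseteq> convex_cone hull {rvec a}"
        using gv(1) unfolding v
        by (intro hull_minimal convex_cone_convex_cone_hull) (auto intro!: convex_cone_hull_mul simp: hull_inc)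
      show "convex_cone hull {rvec a} \<subseteq> convex_cone hull {rvec v}"
        using gv(1) unfolding gv(3)
        by (intro hull_minimal convex_cone_convex_cone_hull) (auto intro!: convex_cone_hull_mul simp: hull_inc)
    qed
    then have ray: "v \<in> ray_gens \<Delta>" using mem gv(2) by (simp add: ray_gens_def)
    have "rvec a \<in> \<sigma>" using a A(2) by (auto intro: hull_inc)
    then have "rvec v \<in> \<sigma>" using gv(1) unfolding v A(2) by (intro convex_cone_hull_mul) auto
    then show ?thesis unfolding gv(3) using gv(1) ray by (intro convex_cone_hull_mul hull_inc) auto
  qed
  then show ?thesis
    by (subst A(2)) (intro hull_minimal convex_cone_convex_cone_hull, auto)
qed

section \<open>Base point freeness and the vertices of the polytope\<close>

definition orbit_point :: "(real ^ 'n) set \<Rightarrow> ('n, 'k::field) toric_point" where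
  "orbit_point \<tau> = (\<tau>, \<lambda>m. if m \<in> perp_lattice \<tau> then 1 else 0)"

lemma orbit_point_in_toric_points: "\<tau> \<in> \<Delta> \<Longrightarrow> orbit_point \<tau> \<in> toric_points \<Delta>"
  by (auto simp: orbit_point_def toric_points_def perp_lattice_def inner_add_left)

lemma toric_eval_one: "toric_eval 1 q = snd q 0"
  by (simp add: toric_eval_def lookup_one)

lemma topspace_toric_variety:
  assumes "complete_fan \<Delta>"
  shows "topspace (toric_variety \<Delta> :: ('n::finite, 'k::field) toric_point topology) = toric_points \<Delta>"
proof
  show "topspace (toric_variety \<Delta> :: ('n, 'k) toric_point topology) \<subseteq> toric_points \<Delta>"
    by (auto simp: toric_variety_def toric_chart_def)
  show "(toric_points \<Delta> :: ('n, 'k) toric_point set) \<subseteq> topspace (toric_variety \<Delta>)"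
  proof
    fix q :: "('n, 'k) toric_point" assume q: "q \<in> toric_points \<Delta>"
    then have \<tau>: "fst q \<in> \<Delta>" and 1: "snd q 0 = 1" by (auto simp: toric_points_def)
    have "convex (fst q)"
      using assms \<tau> unfolding complete_fan_def strongly_convex_rational_cone_def
      by (metis convex_convex_cone_hull)
    then have "q \<in> {q \<in> toric_chart \<Delta> (fst q). toric_eval 1 q \<noteq> 0}"
      using q 1 by (simp add: toric_chart_def face_of_refl toric_eval_one)
    moreover have "(1 :: int ^ 'n \<Rightarrow>\<^sub>0 'k) \<in> semigroup_algebra (dual_lattice_cone (fst q))"
      by (simp add: semigroup_algebra_def dual_lattice_cone_def)
    ultimately show "q \<in> topspace (toric_variety \<Delta>)"
      unfolding toric_variety_def topology_generated_by_topspace using \<tau> by blast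
  qed
qed

lemma topspace_proj_space_subset: "topspace (proj_space B) \<subseteq> proj_points B"
  by (auto simp: proj_space_def)

text \<open>At the distinguished point of the orbit of \<open>\<tau>\<close> the section of u
  survives only if u - m is orthogonal to \<open>\<tau>\<close>. The image has to be a point of
  projective space, so some u survives, and it is then itself a local datum.\<close>

lemma divisor_map_base_point_free:
  fixes a :: "int ^ 'n \<Rightarrow> int"
  assumes tp: "toric_pair TYPE('k::field) \<Delta> a" and \<tau>: "\<tau> \<in> \<Delta>"
  obtains u where "u \<in> lattice_points (divisor_polytope \<Delta> a)" "local_datum \<Delta> a \<tau> u"
proof -
  let ?B = "lattice_points (divisor_polytope \<Delta> a)"
  have fan: "complete_fan \<Delta>" using tp by (simp add: toric_pair_def)
  let ?q = "orbit_point \<tau> :: ('n, 'k) toric_point"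
  define m where "m = (SOME m. local_datum \<Delta> a \<tau> m)"
  have m: "local_datum \<Delta> a \<tau> m"
    unfolding m_def
  proof (rule someI_ex)
    show "\<exists>m. local_datum \<Delta> a \<tau> m" using tp \<tau> unfolding toric_pair_def T_Cartier_def by blast
  qed
  have "continuous_map (toric_variety \<Delta>) (proj_space ?B) (divisor_map \<Delta> a :: ('n, 'k) toric_point \<Rightarrow> _)"
    using tp by (simp add: toric_pair_def very_ample_def closed_embedding_def Let_def)
  from continuous_map_image_subset_topspace[OF this]
  have "(divisor_map \<Delta> a :: ('n, 'k) toric_point \<Rightarrow> _) ` toric_points \<Delta> \<subseteq> topspace (proj_space ?B)"
    unfolding topspace_toric_variety[OF fan] .
  then have "divisor_map \<Delta> a ?q \<in> topspace (proj_space ?B)"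
    by (rule subsetD[OF _ imageI[OF orbit_point_in_toric_points[OF \<tau>]]])
  then have "divisor_map \<Delta> a ?q \<in> proj_points ?B" using topspace_proj_space_subset by blast
  then obtain y' i where y': "divisor_map \<Delta> a ?q = proj_class y'" "y' i \<noteq> 0" by (auto simp: proj_points_def)
  have "y' \<in> proj_class y'" unfolding proj_class_def by (auto intro: exI[of _ 1])
  then have "y' \<in> divisor_map \<Delta> a ?q" using y' by simp
  also have "divisor_map \<Delta> a ?q = proj_class (\<lambda>u. if u \<in> ?B then snd ?q (u - m) else 0)"
    unfolding divisor_map_def m_def by (simp add: orbit_point_def cong: if_cong)
  finally obtain c where "y' i = c * (if i \<in> ?B then snd ?q (i - m) else 0)"
    unfolding proj_class_def by blast
  then have i: "i \<in> ?B" "i - m \<in> perp_lattice \<tau>" using y'(2) by (auto simp: orbit_point_def split: if_splits)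
  have "local_datum \<Delta> a \<tau> i"
    using m i(2) unfolding local_datum_def perp_lattice_def by (auto simp: inner_diff_left)
  then show ?thesis using that i(1) by blast
qed

text \<open>By completeness x lies in some cone \<open>\<tau>\<close>. A local datum u for
  \<open>\<tau>\<close> in the polytope meets the inequalities of all rays of \<open>\<tau>\<close>
  with equality, so it minimizes every functional from \<open>\<tau>\<close>.\<close>

lemma divisor_polytope_minimizer:
  fixes a :: "int ^ 'n \<Rightarrow> int"
  assumes tp: "toric_pair TYPE('k::field) \<Delta> a"
  obtains u where "u \<in> lattice_points (divisor_polytope \<Delta> a)"
    "\<And>u'. u' \<in> divisor_polytope \<Delta> a \<Longrightarrow> rvec u \<bullet> x \<le> u' \<bullet> x"
proof -
  have fan: "complete_fan \<Delta>" using tp by (simp add: toric_pair_def)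
  then obtain \<tau> where \<tau>: "\<tau> \<in> \<Delta>" "x \<in> \<tau>" unfolding complete_fan_def by blast
  obtain u where u: "u \<in> lattice_points (divisor_polytope \<Delta> a)" "local_datum \<Delta> a \<tau> u"
    using divisor_map_base_point_free[OF tp \<tau>(1)] .
  show ?thesis
  proof
    fix u' assume u': "u' \<in> divisor_polytope \<Delta> a"
    have "\<tau> \<subseteq> convex_cone hull (rvec ` {v \<in> ray_gens \<Delta>. rvec v \<in> \<tau>})"
      by (rule fan_cone_generated_by_rays[OF fan \<tau>(1)])
    also have "\<dots> \<subseteq> {y. 0 \<le> (u' - rvec u) \<bullet> y}"
    proof (rule hull_minimal, clarify)
      fix v assume v: "v \<in> ray_gens \<Delta>" "rvec v \<in> \<tau>"
      then have "rvec u \<bullet> rvec v = - real_of_int (a v)" using u(2) by (simp add: local_datum_def)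
      moreover have "u' \<bullet> rvec v \<ge> - real_of_int (a v)" using u' v(1) by (simp add: divisor_polytope_def)
      ultimately show "0 \<le> (u' - rvec u) \<bullet> rvec v" by (simp add: inner_diff_left)
    qed (rule convex_cone_halfspace_ge)
    finally show "rvec u \<bullet> x \<le> u' \<bullet> x" using \<tau>(2) by (auto simp: inner_diff_left)
  qed (rule u(1))
qed

lemma convex_divisor_polytope: "convex (divisor_polytope \<Delta> a)"
proof -
  have "divisor_polytope \<Delta> a = (\<Inter>v\<in>ray_gens \<Delta>. {u. rvec v \<bullet> u \<ge> - real_of_int (a v)})"
    by (auto simp: divisor_polytope_def inner_commute)
  then show ?thesis by (simp add: convex_INT convex_halfspace_ge)
qed

lemma bounded_divisor_polytope:
  fixes a :: "int ^ 'n \<Rightarrow> int"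
  assumes tp: "toric_pair TYPE('k::field) \<Delta> a"
  shows "bounded (divisor_polytope \<Delta> a)"
proof -
  have "\<exists>l. \<forall>u\<in>divisor_polytope \<Delta> a. l \<le> u \<bullet> x" for x
    using divisor_polytope_minimizer[OF tp, of x] by metis
  then obtain l where l: "\<And>x u. u \<in> divisor_polytope \<Delta> a \<Longrightarrow> l x \<le> u \<bullet> x" by metis
  have "divisor_polytope \<Delta> a \<subseteq> cbox (\<Sum>b\<in>Basis. l b *\<^sub>R b) (\<Sum>b\<in>Basis. - l (- b) *\<^sub>R b)"
  proof
    fix u assume u: "u \<in> divisor_polytope \<Delta> a"
    show "u \<in> cbox (\<Sum>b\<in>Basis. l b *\<^sub>R b) (\<Sum>b\<in>Basis. - l (- b) *\<^sub>R b)"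
      unfolding mem_box using l[OF u] by (auto simp: sum_negf inner_sum_left_Basis minus_le_iff)
        (metis inner_minus_right le_minus_iff minus_le_iff)
  qed
  then show ?thesis using bounded_cbox bounded_subset by blast
qed

lemma finite_lattice_points: "bounded P \<Longrightarrow> finite (lattice_points P)"
proof -
  assume "bounded P"
  then have "finite (rvec ` lattice_points P)"
    by (intro finite_int_lattice_bounded)
      (auto simp: lattice_points_def simp flip: range_rvec elim: bounded_subset)
  then show ?thesis by (rule finite_imageD) (use inj_rvec in \<open>auto intro: inj_on_subset\<close>)
qed

text \<open>A functional separating a point of the polytope from the hull would attain its minimum
  over the polytope at a lattice point, which lies in the hull.\<close>

lemma divisor_polytope_eq_convex_hull:
  fixes a :: "int ^ 'n \<Rightarrow> int"
  assumes tp: "toric_pair TYPE('k::field) \<Delta> a"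
  shows "divisor_polytope \<Delta> a = convex hull (rvec ` lattice_points (divisor_polytope \<Delta> a))"
proof
  let ?B = "lattice_points (divisor_polytope \<Delta> a)"
  show "convex hull (rvec ` ?B) \<subseteq> divisor_polytope \<Delta> a"
    using convex_divisor_polytope by (intro hull_minimal) (auto simp: lattice_points_def)
  have cpt: "compact (convex hull (rvec ` ?B))"
    using finite_lattice_points[OF bounded_divisor_polytope[OF tp]] by (simp add: finite_imp_compact_convex_hull)
  show "divisor_polytope \<Delta> a \<subseteq> convex hull (rvec ` ?B)"
  proof (rule subsetI, rule ccontr)
    fix z assume z: "z \<in> divisor_polytope \<Delta> a" "z \<notin> convex hull (rvec ` ?B)"
    obtain x b where xb: "x \<bullet> z < b" "\<forall>y\<in>convex hull (rvec ` ?B). x \<bullet> y > b"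
      using separating_hyperplane_closed_point[OF convex_convex_hull compact_imp_closed[OF cpt] z(2)] by blast
    obtain u where u: "u \<in> ?B" "\<And>u'. u' \<in> divisor_polytope \<Delta> a \<Longrightarrow> rvec u \<bullet> x \<le> u' \<bullet> x"
      using divisor_polytope_minimizer[OF tp, of x] by blast
    have "x \<bullet> rvec u > b" using xb(2) u(1) by (auto intro: hull_inc)
    then show False using u(2)[OF z(1)] xb(1) by (simp add: inner_commute)
  qed
qed

section \<open>Laurent polynomials, one-parameter subgroups and surjectivity on the stalk\<close>

lemma infinite_alg_closed_field: "infinite (UNIV :: 'k::alg_closed_field set)"
proof
  assume fin: "finite (UNIV :: 'k set)"
  define p where "p = (\<Prod>c\<in>(UNIV :: 'k set). [:- c, 1:]) + 1"
  have "degree (\<Prod>c\<in>(UNIV :: 'k set). [:- c, 1:]) = card (UNIV :: 'k set)"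
    by (subst degree_prod_eq_sum_degree) auto
  then have "degree p > 0"
    unfolding p_def using fin by (subst degree_add_eq_left) (auto simp: card_gt_0_iff)
  then obtain x where "poly p x = 0" using alg_closed_imp_poly_has_root by blast
  moreover have "poly (\<Prod>c\<in>(UNIV :: 'k set). [:- c, 1:]) x = 0"
    unfolding poly_prod using fin by (intro prod_zero) (auto intro: bexI[of _ x])
  ultimately show False by (simp add: p_def)
qed

lemma poly_of_Laurent:
  fixes c :: "'j \<Rightarrow> 'k::field" and e :: "'j \<Rightarrow> int"
  assumes "\<And>j. j \<in> J \<Longrightarrow> 0 \<le> e j + N" "t \<noteq> 0" "0 \<le> N"
  shows "poly (\<Sum>j\<in>J. monom (c j) (nat (e j + N))) t = t ^ nat N * (\<Sum>j\<in>J. c j * t powi e j)"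
proof -
  have "t ^ nat (e j + N) = t ^ nat N * t powi e j" if "j \<in> J" for j
    using assms(1)[OF that] assms(2,3) by (simp add: power_int_def[symmetric] power_int_add flip: power_int_of_nat)
  then show ?thesis
    by (simp add: poly_sum poly_monom sum_distrib_left mult_ac cong: sum.cong)
qed

lemma Laurent_zeros:
  fixes c :: "'j \<Rightarrow> 'k::field" and e :: "'j \<Rightarrow> int"
  assumes J: "finite J" and ne: "t0 \<noteq> 0" "(\<Sum>j\<in>J. c j * t0 powi e j) \<noteq> 0"
  shows "finite {t. t \<noteq> 0 \<and> (\<Sum>j\<in>J. c j * t powi e j) = 0}"
proof -
  define N where "N = (\<Sum>j\<in>J. \<bar>e j\<bar>)"
  have N: "0 \<le> e j + N" if "j \<in> J" for j
    using member_le_sum[OF that, of "\<lambda>j. \<bar>e j\<bar>"] J unfolding N_def by auto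
  have N0: "0 \<le> N" by (simp add: N_def sum_nonneg)
  define p where "p = (\<Sum>j\<in>J. monom (c j) (nat (e j + N)))"
  have p: "poly p t = t ^ nat N * (\<Sum>j\<in>J. c j * t powi e j)" if "t \<noteq> 0" for t
    unfolding p_def using N that N0 by (rule poly_of_Laurent)
  have "p \<noteq> 0" using p[OF ne(1)] ne by auto
  then have "finite {t. poly p t = 0}" by (rule poly_roots_finite)
  then show ?thesis by (rule rev_finite_subset) (auto simp: p)
qed

text \<open>After multiplication by t^N, agreement at infinitely many t is an identity of
  polynomials, and without common exponents both sides vanish. Exponents within \<open>I\<close> may
  coincide, so single coefficients can survive; their sum is the value at t = 1.\<close>

lemma Laurent_disjoint_exponents:
  fixes c :: "'i \<Rightarrow> 'k::field" and d :: "'j \<Rightarrow> 'k" and e :: "'i \<Rightarrow> int" and f :: "'j \<Rightarrow> int"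
  assumes fin: "finite I" "finite J" and disj: "\<And>i j. i \<in> I \<Longrightarrow> j \<in> J \<Longrightarrow> e i \<noteq> f j"
    and T: "infinite T" "\<And>t. t \<in> T \<Longrightarrow> t \<noteq> 0"
    and eq: "\<And>t. t \<in> T \<Longrightarrow> (\<Sum>i\<in>I. c i * t powi e i) = (\<Sum>j\<in>J. d j * t powi f j)"
  shows "sum c I = 0"
proof -
  define N where "N = (\<Sum>i\<in>I. \<bar>e i\<bar>) + (\<Sum>j\<in>J. \<bar>f j\<bar>)"
  have N1: "0 \<le> e i + N" if "i \<in> I" for i
  proof -
    have "\<bar>e i\<bar> \<le> (\<Sum>j\<in>I. \<bar>e j\<bar>)" using that fin by (intro member_le_sum) auto
    moreover have "0 \<le> (\<Sum>j\<in>J. \<bar>f j\<bar>)" by (simp add: sum_nonneg)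
    ultimately show ?thesis unfolding N_def by linarith
  qed
  have N2: "0 \<le> f j + N" if "j \<in> J" for j
  proof -
    have "\<bar>f j\<bar> \<le> (\<Sum>j\<in>J. \<bar>f j\<bar>)" using that fin by (intro member_le_sum) auto
    moreover have "0 \<le> (\<Sum>j\<in>I. \<bar>e j\<bar>)" by (simp add: sum_nonneg)
    ultimately show ?thesis unfolding N_def by linarith
  qed
  have N0: "0 \<le> N" by (simp add: N_def sum_nonneg)
  define p where "p = (\<Sum>i\<in>I. monom (c i) (nat (e i + N)))"
  define r where "r = (\<Sum>j\<in>J. monom (d j) (nat (f j + N)))"
  have "poly p t = poly r t" if "t \<in> T" for t
    unfolding p_def r_def using N1 N2 N0 T(2)[OF that] eq[OF that] by (simp add: poly_of_Laurent)
  then have "T \<subseteq> {t. poly (p - r) t = 0}" by auto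
  then have "infinite {t. poly (p - r) t = 0}" using T(1) finite_subset by blast
  then have pr: "p = r" using poly_roots_finite[of "p - r"] by auto
  have "coeff p k = 0" for k
  proof (cases "\<exists>i\<in>I. k = nat (e i + N)")
    case True
    then obtain i where i: "i \<in> I" "k = nat (e i + N)" by auto
    have "nat (f j + N) \<noteq> k" if "j \<in> J" for j
      using disj[OF i(1) that] N1[OF i(1)] N2[OF that] i(2) by auto
    then have "coeff r k = 0" unfolding r_def coeff_sum by (intro sum.neutral) auto
    then show ?thesis using pr by simp
  next
    case False
    then show ?thesis unfolding p_def coeff_sum by (intro sum.neutral) auto
  qed
  then have "p = 0" by (simp add: poly_eq_iff)
  then have "poly p 1 = 0" by simp
  then show ?thesis by (simp add: p_def poly_sum poly_monom)
qed

definition int_pairing :: "int ^ 'n \<Rightarrow> int ^ 'n \<Rightarrow> int" where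
  "int_pairing w m = (\<Sum>i\<in>UNIV. w $ i * m $ i)"

lemma int_pairing_simps [simp]:
  "int_pairing w 0 = 0"
  "int_pairing w (m + m') = int_pairing w m + int_pairing w m'"
  "int_pairing w (m - m') = int_pairing w m - int_pairing w m'"
  "int_pairing w (c *s m) = c * int_pairing w m"
  by (simp_all add: int_pairing_def sum.distrib sum_subtractf algebra_simps sum_distrib_left)

lemma int_pairing_sum: "int_pairing w (sum f I) = (\<Sum>i\<in>I. int_pairing w (f i))"
  by (induction I rule: infinite_finite_induct) auto

text \<open>The vectors w are taken on the moment curve, with entries distinct powers of s. Pairing
  with a nonzero z is then a nonzero polynomial in s, so only finitely many integers s are
  excluded.\<close>

lemma exists_int_pairing_nonzero:
  fixes Z :: "(int ^ 'n) set"
  assumes Z: "finite Z" "0 \<notin> Z"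
  obtains w where "\<And>z. z \<in> Z \<Longrightarrow> int_pairing w z \<noteq> 0"
proof -
  obtain e :: "'n \<Rightarrow> nat" where e: "inj e" using finite_imp_inj_to_nat_seg[of "UNIV :: 'n set"] by auto
  define p where "p z = (\<Sum>i\<in>UNIV. monom (z $ i) (e i))" for z :: "int ^ 'n"
  have p0: "p z \<noteq> 0" if z: "z \<noteq> 0" for z
  proof -
    obtain i where i: "z $ i \<noteq> 0" using z by (auto simp: vec_eq_iff)
    have "coeff (p z) (e i) = (\<Sum>j\<in>UNIV. if j = i then z $ j else 0)"
      unfolding p_def coeff_sum using e by (intro sum.cong) (auto dest: injD)
    then show ?thesis using i by auto
  qed
  have "finite {s. poly (p z) s = 0}" if "z \<in> Z" for z
    by (rule poly_roots_finite[OF p0]) (use that Z(2) in auto)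
  then have "finite (\<Union>z\<in>Z. {s. poly (p z) s = 0})" using Z(1) by auto
  then obtain s where s: "s \<notin> (\<Union>z\<in>Z. {s. poly (p z) s = 0})"
    using ex_new_if_finite[OF infinite_UNIV_int] by blast
  show ?thesis
  proof
    fix z assume "z \<in> Z"
    then have "poly (p z) s \<noteq> 0" using s by auto
    then show "int_pairing (\<chi> i. s ^ e i) z \<noteq> 0"
      by (simp add: p_def poly_sum poly_monom int_pairing_def mult.commute)
  qed
qed

text \<open>One-parameter subgroups of the torus, which is the open orbit, belonging to the cone \<open>{0}\<close>.\<close>

definition one_param :: "int ^ 'n \<Rightarrow> 'k::field \<Rightarrow> ('n, 'k) toric_point" where
  "one_param w t = ({0}, \<lambda>m. t powi int_pairing w m)"

lemma zero_cone_in_fan: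
  assumes "complete_fan \<Delta>"
  shows "{0} \<in> \<Delta>" and "\<sigma> \<in> \<Delta> \<Longrightarrow> {0} face_of \<sigma>"
proof -
  have face: "{0} face_of \<sigma>" if "\<sigma> \<in> \<Delta>" for \<sigma>
  proof -
    have sc: "strongly_convex_rational_cone \<sigma>" using assms that by (simp add: complete_fan_def)
    then have cc: "convex_cone \<sigma>" and conv: "\<And>x. x \<in> \<sigma> \<Longrightarrow> - x \<in> \<sigma> \<Longrightarrow> x = 0"
      by (auto simp: strongly_convex_rational_cone_def convex_cone_convex_cone_hull)
    show ?thesis
      unfolding face_of_def
    proof (intro conjI ballI impI)
      fix p q x assume pq: "p \<in> \<sigma>" "q \<in> \<sigma>" and "x \<in> {0}" "x \<in> open_segment p q"
      then obtain u where u: "0 < u" "u < 1" "(1 - u) *\<^sub>R p + u *\<^sub>R q = 0" by (auto simp: in_segment)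
      have mem: "(1 - u) *\<^sub>R p \<in> \<sigma>" "u *\<^sub>R q \<in> \<sigma>" using pq u convex_cone_scaleR[OF cc] by auto
      have "- ((1 - u) *\<^sub>R p) = u *\<^sub>R q" using u(3) by (simp add: neg_eq_iff_add_eq_0)
      then have "(1 - u) *\<^sub>R p = 0" using conv mem by metis
      then show "p \<in> {0}" "q \<in> {0}" using u by auto
    qed (use convex_cone_contains_0[OF cc] in auto)
  qed
  show "\<sigma> \<in> \<Delta> \<Longrightarrow> {0} face_of \<sigma>" by (rule face)
  have "\<Delta> \<noteq> {}" using assms by (auto simp: complete_fan_def)
  then obtain \<sigma> where "\<sigma> \<in> \<Delta>" by auto
  then show "{0} \<in> \<Delta>" using face[of \<sigma>] assms unfolding complete_fan_def by blast
qed

lemma one_param_in_toric_points: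
  assumes "complete_fan \<Delta>" "t \<noteq> 0"
  shows "one_param w t \<in> toric_points \<Delta>"
  using zero_cone_in_fan[OF assms(1)] assms(2)
  by (simp add: toric_points_def one_param_def perp_lattice_def power_int_add)

lemma toric_eval_one_param:
  "toric_eval f (one_param w t) =
    (\<Sum>m\<in>Poly_Mapping.keys f. Poly_Mapping.lookup f m * t powi int_pairing w m)"
  by (simp add: toric_eval_def one_param_def)

text \<open>Density of nonempty open subsets of the torus is only needed along one-parameter subgroups.\<close>

lemma cofinite_one_param_open:
  fixes W :: "('n::finite, 'k::field) toric_point set"
  assumes fan: "complete_fan \<Delta>" and W: "openin (toric_variety \<Delta>) W"
    and t0: "t0 \<noteq> 0" "one_param w t0 \<in> W"
  shows "finite {t. t \<noteq> 0 \<and> one_param w t \<notin> W}"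
  using W[unfolded toric_variety_def openin_topology_generated_by_iff] t0
proof (induction arbitrary: t0)
  case (Int a b)
  have "{t. t \<noteq> 0 \<and> one_param w t \<notin> a \<inter> b} =
    {t. t \<noteq> 0 \<and> one_param w t \<notin> a} \<union> {t. t \<noteq> 0 \<and> one_param w t \<notin> b}" by auto
  then show ?case using Int by auto
next
  case (UN K)
  then obtain k where k: "k \<in> K" "one_param w t0 \<in> k" by auto
  have "finite {t. t \<noteq> 0 \<and> one_param w t \<notin> k}" by (rule UN.IH[OF k(1) UN.prems(1) k(2)])
  then show ?case by (rule rev_finite_subset) (use k in auto)
next
  case (Basis s)
  then obtain \<sigma> f where s: "s = {q \<in> toric_chart \<Delta> \<sigma>. toric_eval f q \<noteq> 0}" "\<sigma> \<in> \<Delta>" by auto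
  have "one_param w t \<in> toric_chart \<Delta> \<sigma>" if "t \<noteq> 0" for t
    using one_param_in_toric_points[OF fan that] zero_cone_in_fan(2)[OF fan s(2)]
    by (auto simp: toric_chart_def one_param_def)
  then have "{t. t \<noteq> 0 \<and> one_param w t \<notin> s} = {t. t \<noteq> 0 \<and> toric_eval f (one_param w t) = 0}"
    by (auto simp: s(1))
  moreover have "toric_eval f (one_param w t0) \<noteq> 0" using Basis.prems by (simp add: s(1))
  then have "finite {t. t \<noteq> 0 \<and> toric_eval f (one_param w t) = 0}"
    unfolding toric_eval_one_param by (rule Laurent_zeros[OF finite_keys Basis.prems(1)])
  ultimately show ?case by simp
qed auto

text \<open>The character of the torus to which a monomial in the homogeneous coordinates pulls
  back, in the trivialization given by \<open>m0\<close>.\<close>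

definition monomial_weight :: "int ^ 'n \<Rightarrow> ((int ^ 'n) \<Rightarrow>\<^sub>0 nat) \<Rightarrow> int ^ 'n" where
  "monomial_weight m0 \<mu> = (\<Sum>i\<in>Poly_Mapping.keys \<mu>. int (Poly_Mapping.lookup \<mu> i) *s (i - m0))"

lemma form_eval_one_param:
  assumes F: "form B e F" and t: "t \<noteq> 0" and y: "\<And>i. i \<in> B \<Longrightarrow> y i = t powi int_pairing w (i - m0)"
  shows "form_eval F y = (\<Sum>\<mu>\<in>Poly_Mapping.keys F. Poly_Mapping.lookup F \<mu> * t powi int_pairing w (monomial_weight m0 \<mu>))"
  unfolding form_eval_def
proof (rule sum.cong[OF refl])
  fix \<mu> assume \<mu>: "\<mu> \<in> Poly_Mapping.keys F"
  have pow: "(t powi k) ^ n = t powi (int n * k)" for k n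
    by (metis mult.commute power_int_mult power_int_of_nat)
  have "(\<Prod>i\<in>Poly_Mapping.keys \<mu>. y i ^ Poly_Mapping.lookup \<mu> i) =
    (\<Prod>i\<in>Poly_Mapping.keys \<mu>. t powi (int (Poly_Mapping.lookup \<mu> i) * int_pairing w (i - m0)))"
  proof (rule prod.cong[OF refl])
    fix i assume "i \<in> Poly_Mapping.keys \<mu>"
    then have "y i = t powi int_pairing w (i - m0)" using F \<mu> by (intro y) (auto simp: form_def)
    then show "y i ^ Poly_Mapping.lookup \<mu> i = t powi (int (Poly_Mapping.lookup \<mu> i) * int_pairing w (i - m0))"
      by (simp only: pow)
  qed
  also have "\<dots> = t powi (\<Sum>i\<in>Poly_Mapping.keys \<mu>. int (Poly_Mapping.lookup \<mu> i) * int_pairing w (i - m0))"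
    by (induction rule: finite_induct[OF finite_keys[of \<mu>]]) (auto simp: power_int_add t simp del: int_pairing_simps)
  also have "\<dots> = t powi int_pairing w (monomial_weight m0 \<mu>)"
    by (simp only: monomial_weight_def int_pairing_sum int_pairing_simps(4))
  finally show "Poly_Mapping.lookup F \<mu> * (\<Prod>i\<in>Poly_Mapping.keys \<mu>. y i ^ Poly_Mapping.lookup \<mu> i) =
    Poly_Mapping.lookup F \<mu> * t powi int_pairing w (monomial_weight m0 \<mu>)" by simp
qed

lemma generated_semigroup_add:
  "x \<in> generated_semigroup G \<Longrightarrow> y \<in> generated_semigroup G \<Longrightarrow> x + y \<in> generated_semigroup G"
  using submonoid.add_mem[OF generated_semigroup_submonoid] .

lemma difference_group_uminus:
  assumes "x \<in> generated_semigroup {u - v | u v :: int ^ 'n. u \<in> B \<and> v \<in> B}"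
  shows "- x \<in> generated_semigroup {u - v | u v. u \<in> B \<and> v \<in> B}"
  using assms
proof induction
  case (add g s)
  then obtain u v where "u \<in> B" "v \<in> B" "g = u - v" by auto
  then have "(v - u) + - s \<in> generated_semigroup {u - v | u v. u \<in> B \<and> v \<in> B}"
    using add by (intro generated_semigroup.add) auto
  then show ?case by (simp add: \<open>g = u - v\<close>)
qed (simp add: generated_semigroup.zero)

text \<open>Each factor of the monomial contributes i - m0, which is congruent to u0 - m0 modulo
  differences of points of \<open>B\<close>. Hence all weights of a form of degree e lie in a single
  coset.\<close>

lemma monomial_weight_mod:
  fixes B :: "(int ^ 'n) set"
  assumes u0: "u0 \<in> B" and F: "form B e F" and \<mu>: "\<mu> \<in> Poly_Mapping.keys F"
  shows "monomial_weight m0 \<mu> - int e *s (u0 - m0) \<in> generated_semigroup {u - v | u v. u \<in> B \<and> v \<in> B}"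
    (is "_ \<in> ?\<Lambda>")
proof -
  have B: "Poly_Mapping.keys \<mu> \<subseteq> B" and e: "(\<Sum>i\<in>Poly_Mapping.keys \<mu>. Poly_Mapping.lookup \<mu> i) = e"
    using F \<mu> by (auto simp: form_def)
  have mult: "int n *s (i - u0) \<in> ?\<Lambda>" if "i \<in> B" for i n
  proof (induction n)
    case 0
    then show ?case by (simp add: generated_semigroup.zero)
  next
    case (Suc n)
    have "(i - u0) + int n *s (i - u0) \<in> ?\<Lambda>"
      using that u0 Suc by (intro generated_semigroup.add) auto
    then show ?case by (simp add: vec_eq_iff algebra_simps)
  qed
  have "(\<Sum>i\<in>I. int (Poly_Mapping.lookup \<mu> i) *s (i - u0)) \<in> ?\<Lambda>" if "I \<subseteq> B" for I
    using that
  proof (induction I rule: infinite_finite_induct)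
    case (insert i I)
    then have "int (Poly_Mapping.lookup \<mu> i) *s (i - u0) + (\<Sum>i\<in>I. int (Poly_Mapping.lookup \<mu> i) *s (i - u0)) \<in> ?\<Lambda>"
      by (intro generated_semigroup_add mult) auto
    then show ?case by (simp only: sum.insert[OF insert(1,2)])
  qed (simp_all add: generated_semigroup.zero)
  moreover have "monomial_weight m0 \<mu> - int e *s (u0 - m0) =
    (\<Sum>i\<in>Poly_Mapping.keys \<mu>. int (Poly_Mapping.lookup \<mu> i) *s (i - u0))"
    unfolding monomial_weight_def e[symmetric]
    by (simp add: vec_eq_iff algebra_simps sum_subtractf sum_distrib_left)
  ultimately show ?thesis using B by simp
qed

text \<open>The dual of the zero cone is all of M, so on the torus every character is regular with
  denominator 1.\<close>

lemma toric_regular_character: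
  fixes \<Delta> :: "(real ^ 'n) set set"
  assumes fan: "complete_fan \<Delta>"
  shows "openin (toric_variety \<Delta>) (toric_chart \<Delta> {0} :: ('n, 'k::field) toric_point set)"
    and "toric_regular \<Delta> (toric_chart \<Delta> {0} :: ('n, 'k) toric_point set) (\<lambda>q. snd q m)"
proof -
  let ?U = "toric_chart \<Delta> {0} :: ('n, 'k) toric_point set"
  have z: "{0} \<in> \<Delta>" by (rule zero_cone_in_fan(1)[OF fan])
  have all: "f \<in> semigroup_algebra (dual_lattice_cone {0})" for f :: "int ^ 'n \<Rightarrow>\<^sub>0 'k"
    by (simp add: semigroup_algebra_def dual_lattice_cone_def)
  have one: "toric_eval 1 q = 1" if "q \<in> ?U" for q
    using that by (auto simp: toric_eval_one toric_chart_def toric_points_def)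
  have "?U = {q \<in> toric_chart \<Delta> {0}. toric_eval 1 q \<noteq> 0}" using one by auto
  then show op: "openin (toric_variety \<Delta>) ?U"
    unfolding toric_variety_def openin_topology_generated_by_iff
    using z all by (intro generate_topology_on.Basis) blast
  show "toric_regular \<Delta> ?U (\<lambda>q. snd q m)"
    unfolding toric_regular_def
  proof
    fix q assume q: "q \<in> ?U"
    have ev: "toric_eval (Poly_Mapping.single m 1) w = snd w m" for w :: "('n, 'k) toric_point"
      by (simp add: toric_eval_def)
    show "\<exists>\<sigma>\<in>\<Delta>. \<exists>g\<in>semigroup_algebra (dual_lattice_cone \<sigma>). \<exists>h\<in>semigroup_algebra (dual_lattice_cone \<sigma>). \<exists>V.
      openin (toric_variety \<Delta>) V \<and> q \<in> V \<and> V \<subseteq> ?U \<inter> toric_chart \<Delta> \<sigma> \<and>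
      (\<forall>w\<in>V. toric_eval h w \<noteq> 0 \<and> snd w m = toric_eval g w / toric_eval h w)"
      using op q one ev
      by (intro bexI[OF _ z] bexI[OF _ all[of "Poly_Mapping.single m 1"]] bexI[OF _ all[of 1]] exI[of _ ?U]) auto
  qed
qed

text \<open>Suppose m is not generated by differences. The character of m is regular on the torus,
  so near the unit it is a quotient \<open>Gf\<close> / \<open>Hf\<close> of forms of equal degree.
  The weights of both forms lie in one coset of the difference lattice, so after multiplying
  \<open>Hf\<close> by the character no weight matches one of \<open>Gf\<close>. Along a suitable
  one-parameter subgroup this forces \<open>Hf\<close> to vanish at the unit, where it is the
  denominator.\<close>

lemma lattice_point_differences_generate:
  fixes a :: "int ^ 'n \<Rightarrow> int"
  assumes tp: "toric_pair TYPE('k::alg_closed_field) \<Delta> a"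
  defines "B \<equiv> lattice_points (divisor_polytope \<Delta> a)"
  shows "generated_semigroup {u - v | u v. u \<in> B \<and> v \<in> B} = UNIV" (is "?\<Lambda> = UNIV")
proof (rule ccontr)
  assume "?\<Lambda> \<noteq> UNIV"
  then obtain m where m: "m \<notin> ?\<Lambda>" by auto
  let ?X = "toric_variety \<Delta> :: ('n, 'k) toric_point topology"
  let ?U = "toric_chart \<Delta> {0} :: ('n, 'k) toric_point set"
  let ?\<phi> = "divisor_map \<Delta> a :: ('n, 'k) toric_point \<Rightarrow> _"
  have fan: "complete_fan \<Delta>" using tp by (simp add: toric_pair_def)
  have z: "{0} \<in> \<Delta>" by (rule zero_cone_in_fan(1)[OF fan])
  have ce: "closed_embedding ?X (toric_regular \<Delta>) (proj_space B) (proj_regular B) ?\<phi>"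
    using tp by (simp add: toric_pair_def very_ample_def Let_def B_def)
  obtain u0 where u0: "u0 \<in> B" using divisor_map_base_point_free[OF tp z] unfolding B_def by blast
  \<comment> \<open>The unit of the torus. Every one-parameter subgroup passes through it at t = 1,
    so \<open>w\<close> can be chosen after the neighbourhood and the two forms.\<close>
  define x0 where "x0 = (one_param 0 1 :: ('n, 'k) toric_point)"
  have x0w: "one_param w 1 = x0" for w by (simp add: x0_def one_param_def)
  have x0U: "x0 \<in> ?U"
    using one_param_in_toric_points[OF fan, of 1 0] zero_cone_in_fan(2)[OF fan z]
    by (simp add: x0_def toric_chart_def one_param_def)
  obtain V g W where V: "openin (proj_space B) V" "proj_regular B V g" and W: "openin ?X W" "x0 \<in> W"
    and eq: "\<And>q. q \<in> W \<Longrightarrow> ?\<phi> q \<in> V \<and> snd q m = g (?\<phi> q)"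
  proof -
    have "\<forall>U f. \<forall>x\<in>U. openin ?X U \<and> toric_regular \<Delta> U f \<longrightarrow>
      (\<exists>V g W. openin (proj_space B) V \<and> proj_regular B V g \<and> openin ?X W \<and> x \<in> W \<and> W \<subseteq> U \<and>
        (\<forall>w\<in>W. ?\<phi> w \<in> V \<and> f w = g (?\<phi> w)))"
      using ce unfolding closed_embedding_def by (elim conjE)
    from this[rule_format, OF x0U conjI[OF toric_regular_character(1)[OF fan] toric_regular_character(2)[OF fan, of m]]]
    obtain V g W where *: "openin (proj_space B) V \<and> proj_regular B V g \<and> openin ?X W \<and> x0 \<in> W \<and> W \<subseteq> ?U \<and>
        (\<forall>w\<in>W. ?\<phi> w \<in> V \<and> snd w m = g (?\<phi> w))"
      by (elim exE)
    show thesis by (rule that[of V g W]) (use * in simp_all)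
  qed
  have "?\<phi> x0 \<in> V" using eq W(2) by blast
  then obtain e Gf Hf V' where GH: "form B e Gf" "form B e Hf" and V': "openin (proj_space B) V'" "?\<phi> x0 \<in> V'" "V' \<subseteq> V"
    and quot: "\<And>l y. l \<in> V' \<Longrightarrow> y \<in> l \<Longrightarrow> form_eval Hf y \<noteq> 0 \<and> g l = form_eval Gf y / form_eval Hf y"
  proof -
    from V(2)[unfolded proj_regular_def, rule_format, OF \<open>?\<phi> x0 \<in> V\<close>]
    obtain e Gf Hf V' where *: "form B e Gf \<and> form B e Hf \<and> openin (proj_space B) V' \<and> ?\<phi> x0 \<in> V' \<and> V' \<subseteq> V \<and>
      (\<forall>w\<in>V'. \<forall>y\<in>w. form_eval Hf y \<noteq> 0 \<and> g w = form_eval Gf y / form_eval Hf y)"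
      by (elim exE)
    show thesis by (rule that[of e Gf Hf V']) (use * in simp_all)
  qed
  define W' where "W' = W \<inter> {q \<in> topspace ?X. ?\<phi> q \<in> V'}"
  have "openin ?X {q \<in> topspace ?X. ?\<phi> q \<in> V'}"
    using ce V'(1) openin_continuous_map_preimage unfolding closed_embedding_def by fast
  then have W'o: "openin ?X W'" unfolding W'_def using W(1) by blast
  have x0W': "x0 \<in> W'" using W V'(2) openin_subset[OF W(1)] by (auto simp: W'_def)
  define m0 where "m0 = (SOME m. local_datum \<Delta> a {0} m)"
  define wt where "wt = monomial_weight m0"
  \<comment> \<open>The exponent differences whose vanishing would let a term of the multiplied
    \<open>Hf\<close> meet a term of \<open>Gf\<close>. None is 0, by the coset argument, and one
    \<open>w\<close> keeps the finitely many pairings nonzero.\<close>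
  define Z where "Z = (\<lambda>(\<mu>, \<nu>). m + wt \<mu> - wt \<nu>) ` (Poly_Mapping.keys Hf \<times> Poly_Mapping.keys Gf)"
  have "0 \<notin> Z"
  proof
    assume "0 \<in> Z"
    then obtain \<mu> \<nu> where \<mu>: "\<mu> \<in> Poly_Mapping.keys Hf" and \<nu>: "\<nu> \<in> Poly_Mapping.keys Gf" and 0: "m + wt \<mu> - wt \<nu> = 0"
      by (auto simp: Z_def)
    have "(wt \<nu> - int e *s (u0 - m0)) + - (wt \<mu> - int e *s (u0 - m0)) \<in> ?\<Lambda>"
      unfolding wt_def
      by (intro generated_semigroup_add difference_group_uminus monomial_weight_mod[OF u0 GH(1) \<nu>] monomial_weight_mod[OF u0 GH(2) \<mu>])
    moreover have "(wt \<nu> - int e *s (u0 - m0)) + - (wt \<mu> - int e *s (u0 - m0)) = m"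
    proof -
      have "m = wt \<nu> - wt \<mu>" using 0 by (simp add: algebra_simps)
      then show ?thesis by simp
    qed
    ultimately show False using m by simp
  qed
  moreover have "finite Z" by (simp add: Z_def)
  ultimately obtain w where w: "\<And>z. z \<in> Z \<Longrightarrow> int_pairing w z \<noteq> 0" using exists_int_pairing_nonzero by blast
  define T where "T = {t :: 'k. t \<noteq> 0 \<and> one_param w t \<in> W'}"
  have "finite {t. t \<noteq> 0 \<and> one_param w t \<notin> W'}"
    by (rule cofinite_one_param_open[OF fan W'o, of 1]) (simp_all add: x0w x0W')
  then have "finite (insert 0 (T \<union> {t. t \<noteq> 0 \<and> one_param w t \<notin> W'}))" if "finite T"
    using that by simp
  moreover have "insert 0 (T \<union> {t. t \<noteq> 0 \<and> one_param w t \<notin> W'}) = UNIV" by (auto simp: T_def)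
  ultimately have infT: "infinite T"
    using infinite_alg_closed_field[where 'k = 'k] by metis
  have evals: "form_eval Hf (\<lambda>u. if u \<in> B then t powi int_pairing w (u - m0) else 0) \<noteq> 0 \<and>
    t powi int_pairing w m * form_eval Hf (\<lambda>u. if u \<in> B then t powi int_pairing w (u - m0) else 0) =
    form_eval Gf (\<lambda>u. if u \<in> B then t powi int_pairing w (u - m0) else 0)" if "t \<in> T" for t
  proof -
    let ?y = "\<lambda>u. if u \<in> B then t powi int_pairing w (u - m0) else 0"
    have t: "one_param w t \<in> W" "?\<phi> (one_param w t) \<in> V'" using that by (auto simp: T_def W'_def)
    have "?\<phi> (one_param w t) = proj_class ?y"
      unfolding divisor_map_def one_param_def fst_conv snd_conv B_def[symmetric] m0_def[symmetric] ..
    moreover have "?y \<in> proj_class ?y" unfolding proj_class_def by (auto intro: exI[of _ 1])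
    ultimately have "form_eval Hf ?y \<noteq> 0" "g (?\<phi> (one_param w t)) = form_eval Gf ?y / form_eval Hf ?y"
      using quot[OF t(2), of ?y] by auto
    moreover have "t powi int_pairing w m = g (?\<phi> (one_param w t))"
      using eq[OF t(1)] by (simp add: one_param_def)
    ultimately show ?thesis by simp
  qed
  have Heval: "form_eval Hf (\<lambda>u. if u \<in> B then t powi int_pairing w (u - m0) else 0) =
    (\<Sum>\<mu>\<in>Poly_Mapping.keys Hf. Poly_Mapping.lookup Hf \<mu> * t powi int_pairing w (wt \<mu>))" if "t \<noteq> 0" for t :: 'k
    unfolding wt_def by (rule form_eval_one_param[OF GH(2) that]) simp
  have Geval: "form_eval Gf (\<lambda>u. if u \<in> B then t powi int_pairing w (u - m0) else 0) =
    (\<Sum>\<mu>\<in>Poly_Mapping.keys Gf. Poly_Mapping.lookup Gf \<mu> * t powi int_pairing w (wt \<mu>))" if "t \<noteq> 0" for t :: 'k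
    unfolding wt_def by (rule form_eval_one_param[OF GH(1) that]) simp
  have "(\<Sum>\<mu>\<in>Poly_Mapping.keys Hf. Poly_Mapping.lookup Hf \<mu>) = 0"
  proof (rule Laurent_disjoint_exponents[OF finite_keys finite_keys _ infT])
    fix \<mu> \<nu> assume "\<mu> \<in> Poly_Mapping.keys Hf" "\<nu> \<in> Poly_Mapping.keys Gf"
    then have "m + wt \<mu> - wt \<nu> \<in> Z" unfolding Z_def by force
    from w[OF this] show "int_pairing w (m + wt \<mu>) \<noteq> int_pairing w (wt \<nu>)" by simp
  next
    fix t assume t: "t \<in> T"
    then show t0: "t \<noteq> 0" by (simp add: T_def)
    have "(\<Sum>\<mu>\<in>Poly_Mapping.keys Hf. Poly_Mapping.lookup Hf \<mu> * t powi int_pairing w (m + wt \<mu>)) =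
      t powi int_pairing w m * (\<Sum>\<mu>\<in>Poly_Mapping.keys Hf. Poly_Mapping.lookup Hf \<mu> * t powi int_pairing w (wt \<mu>))"
      using t0 by (simp add: power_int_add sum_distrib_left mult_ac)
    then show "(\<Sum>\<mu>\<in>Poly_Mapping.keys Hf. Poly_Mapping.lookup Hf \<mu> * t powi int_pairing w (m + wt \<mu>)) =
      (\<Sum>\<mu>\<in>Poly_Mapping.keys Gf. Poly_Mapping.lookup Gf \<mu> * t powi int_pairing w (wt \<mu>))"
      using evals[OF t] Heval[OF t0] Geval[OF t0] by simp
  qed
  \<comment> \<open>The coefficient sum of \<open>Hf\<close> is its value at the unit, which cannot
    be 0.\<close>
  moreover have "1 \<in> T" using x0W' by (simp add: T_def x0w)
  ultimately show False using evals[of 1] Heval[of 1] by simp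
qed

lemma toric_pair_generating_points:
  fixes a :: "int ^ 'n \<Rightarrow> int"
  assumes tp: "toric_pair TYPE('k::alg_closed_field) \<Delta> a"
  shows "generating_points (lattice_points (divisor_polytope \<Delta> a))"
proof
  show "finite (lattice_points (divisor_polytope \<Delta> a))"
    by (rule finite_lattice_points[OF bounded_divisor_polytope[OF tp]])
  show "lattice_points (divisor_polytope \<Delta> a) \<noteq> {}"
    using divisor_polytope_minimizer[OF tp, of 0] by blast
qed (rule lattice_point_differences_generate[OF tp])

section \<open>Slices of the Hilbert-Kunz region\<close>

lemma sets_halfspace_snd:
  "{p :: 'a::euclidean_space \<times> real. snd p < c} \<in> sets borel" "{p :: 'a \<times> real. c \<le> snd p} \<in> sets borel"
  by (intro borel_open borel_closed open_Collect_less closed_Collect_le continuous_intros)+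

lemma sets_Int_halfspace_snd:
  fixes A :: "('a::euclidean_space \<times> real) set"
  assumes "A \<in> sets borel"
  shows "{p \<in> A. snd p < c} \<in> sets borel" "{p \<in> A. c \<le> snd p} \<in> sets borel"
  using sets.Int[OF assms sets_halfspace_snd(1)] sets.Int[OF assms sets_halfspace_snd(2)] by (simp_all add: Int_def)

lemma emeasure_slices:
  fixes E :: "('a::euclidean_space \<times> real) set"
  assumes "E \<in> sets borel"
  shows "emeasure lborel E = (\<integral>\<^sup>+t. emeasure lborel {x. (x, t) \<in> E} \<partial>lborel)"
proof -
  have "E \<in> sets (lborel \<Otimes>\<^sub>M lborel)" using assms unfolding lborel_prod by simp
  then have "emeasure (lborel \<Otimes>\<^sub>M lborel) E = (\<integral>\<^sup>+t. emeasure lborel ((\<lambda>x. (x, t)) -` E) \<partial>lborel)"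
    by (rule lborel_pair.emeasure_pair_measure_alt2)
  then show ?thesis by (simp add: lborel_prod vimage_def)
qed

lemma borel_measurable_emeasure_slice:
  fixes E :: "('a::euclidean_space \<times> real) set"
  assumes "E \<in> sets borel"
  shows "(\<lambda>t. emeasure lborel {x. (x, t) \<in> E}) \<in> borel_measurable borel"
proof -
  have "E \<in> sets (lborel \<Otimes>\<^sub>M lborel)" using assms unfolding lborel_prod by simp
  from lborel_pair.measurable_emeasure_Pair2[OF this] show ?thesis by (simp add: vimage_def)
qed

lemma borel_measurable_measure_slice:
  fixes E :: "('a::euclidean_space \<times> real) set"
  assumes "E \<in> sets borel"
  shows "(\<lambda>t. measure lborel {x. (x, t) \<in> E}) \<in> borel_measurable borel"
  unfolding measure_def using borel_measurable_emeasure_slice[OF assms] by measurable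

lemma sets_slice:
  fixes E :: "('a::euclidean_space \<times> real) set"
  assumes "E \<in> sets borel"
  shows "{x. (x, t) \<in> E} \<in> sets borel"
proof -
  have "(\<lambda>x. (x, t)) -` E \<inter> space borel \<in> sets borel" by (rule measurable_sets[OF _ assms]) measurable
  then show ?thesis by (simp add: vimage_def)
qed

lemma emeasure_scaleR_image:
  fixes A :: "'a::euclidean_space set"
  assumes A: "compact A" and c: "0 \<le> c"
  shows "emeasure lborel ((*\<^sub>R) c ` A) = ennreal (c ^ DIM('a)) * emeasure lborel A"
proof (cases "c = 0")
  case True
  have "emeasure lborel ((*\<^sub>R) c ` A) \<le> emeasure lborel {0 :: 'a}"
    using True by (intro emeasure_mono) auto
  then show ?thesis using True by (simp add: zero_power)
next
  case False
  have "compact ((*\<^sub>R) c ` A)" by (rule compact_scaling[OF A])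
  then have "(*\<^sub>R) c ` A \<in> sets borel" by (simp add: borel_compact)
  from emeasure_lborel_affine[OF this False, of 0] c False
  have "emeasure lborel ((*\<^sub>R) c ` A) = ennreal (c ^ DIM('a)) * emeasure lborel {x. c *\<^sub>R x \<in> (*\<^sub>R) c ` A}" by simp
  also have "{x. c *\<^sub>R x \<in> (*\<^sub>R) c ` A} = A" using False by auto
  finally show ?thesis .
qed

lemma measure_scaleR_image:
  fixes A :: "'a::euclidean_space set"
  assumes "compact A" "0 \<le> c"
  shows "measure lborel ((*\<^sub>R) c ` A) = c ^ DIM('a) * measure lborel A"
  unfolding measure_def emeasure_scaleR_image[OF assms] using assms(2) by (simp add: enn2real_mult)

lemma measure_cone_over_below:
  fixes Q :: "'a::euclidean_space set"
  assumes Q: "compact Q"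
  shows "emeasure lborel {p \<in> cone_over Q. snd p < 1} = ennreal (measure lborel Q / (DIM('a) + 1))"
proof -
  have [measurable]: "cone_over Q \<in> sets borel" using closed_cone_over[OF Q] by (rule borel_closed)
  have fin: "emeasure lborel Q = ennreal (measure lborel Q)"
    using emeasure_bounded_finite[OF compact_imp_bounded[OF Q]] by (intro emeasure_eq_ennreal_measure) auto
  have E: "{p \<in> cone_over Q. snd p < 1} \<in> sets borel" by (rule sets_Int_halfspace_snd) simp
  have "emeasure lborel {p \<in> cone_over Q. snd p < 1} =
      (\<integral>\<^sup>+t. emeasure lborel {x. (x, t) \<in> {p \<in> cone_over Q. snd p < 1}} \<partial>lborel)"
    by (rule emeasure_slices[OF E])
  also have "\<dots> = (\<integral>\<^sup>+t. ennreal (t ^ DIM('a) * measure lborel Q) * indicator {0..1} t \<partial>lborel)"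
  proof (rule nn_integral_cong_AE)
    \<comment> \<open>Dropping the single height 1 turns the half-open range into the closed
      interval of the fundamental theorem.\<close>
    have "AE t in lborel. t \<noteq> (1::real)" by (rule AE_lborel_singleton)
    then show "AE t in lborel. emeasure lborel {x. (x, t) \<in> {p \<in> cone_over Q. snd p < 1}} =
      ennreal (t ^ DIM('a) * measure lborel Q) * indicator {0..1} t"
    proof eventually_elim
      case (elim t)
      have "{x. (x, t) \<in> {p \<in> cone_over Q. snd p < 1}} = (if 0 \<le> t \<and> t < 1 then (*\<^sub>R) t ` Q else {})"
        by (auto simp: cone_over_iff)
      then show ?case
        using elim emeasure_scaleR_image[OF Q, of t] by (auto simp: fin ennreal_mult indicator_def)
    qed
  qed
  also have "\<dots> = ennreal (1 ^ (DIM('a) + 1) / (DIM('a) + 1) * measure lborel Q - 0 ^ (DIM('a) + 1) / (DIM('a) + 1) * measure lborel Q)"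
  proof (rule nn_integral_FTC_Icc)
    fix t :: real
    show "((\<lambda>t. t ^ (DIM('a) + 1) / (DIM('a) + 1) * measure lborel Q) has_real_derivative t ^ DIM('a) * measure lborel Q) (at t)"
      by (rule derivative_eq_intros refl | simp)+
  qed auto
  finally show ?thesis by simp
qed

lemma unfold_lattice_real:
  fixes E :: "'a::euclidean_space set"
  assumes E [measurable]: "E \<in> sets borel" and bd: "bounded E"
  shows "(\<lambda>x. real (card {z\<in>int_lattice. x + z \<in> E}) * indicator unit_cell x) \<in> borel_measurable borel"
    and "integrable lborel (\<lambda>x. real (card {z\<in>int_lattice. x + z \<in> E}) * indicator unit_cell x)"
    and "measure lborel E = (\<integral>x. real (card {z\<in>int_lattice. x + z \<in> E}) * indicator unit_cell x \<partial>lborel)"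
proof -
  obtain R where R: "\<And>y. y \<in> E \<Longrightarrow> norm y \<le> R" using bd by (auto simp: bounded_iff)
  \<comment> \<open>One finite set of lattice points serves all x in the cell, so the count is a
    finite sum of indicators and hence measurable.\<close>
  define F where "F = {z \<in> int_lattice :: 'a set. norm z \<le> R + DIM('a)}"
  have F: "finite F" by (rule finite_int_lattice_bounded) (auto simp: F_def bounded_iff)
  have eq: "real (card {z\<in>int_lattice. x + z \<in> E}) * indicator unit_cell x =
    (\<Sum>z\<in>F. indicator E (x + z)) * indicator unit_cell x" for x :: 'a
  proof (cases "x \<in> unit_cell")
    case True
    have "{z\<in>int_lattice. x + z \<in> E} = {z\<in>F. x + z \<in> E}"
    proof -
      have "norm z \<le> R + DIM('a)" if "x + z \<in> E" for z
        using R[OF that] norm_unit_cell[OF True] norm_triangle_ineq4[of "x + z" x] by simp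
      then show ?thesis by (auto simp: F_def)
    qed
    also have "real (card \<dots>) = (\<Sum>z\<in>F. indicator E (x + z))"
      using F by (simp add: indicator_def sum.If_cases Int_def)
    finally show ?thesis by simp
  qed simp
  show m: "(\<lambda>x. real (card {z\<in>int_lattice. x + z \<in> E}) * indicator unit_cell x) \<in> borel_measurable borel"
    unfolding eq by measurable
  have em: "emeasure lborel E =
    (\<integral>\<^sup>+x. ennreal (real (card {z\<in>int_lattice. x + z \<in> E}) * indicator unit_cell x) \<partial>lborel)"
    unfolding emeasure_unfold_lattice[OF E bd] by (rule nn_integral_cong) (simp add: indicator_def)
  have "emeasure lborel E < \<infinity>" by (rule emeasure_bounded_finite[OF bd])
  then show "integrable lborel (\<lambda>x. real (card {z\<in>int_lattice. x + z \<in> E}) * indicator unit_cell x)"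
    using m unfolding em by (intro integrableI_nonneg) auto
  show "measure lborel E = (\<integral>x. real (card {z\<in>int_lattice. x + z \<in> E}) * indicator unit_cell x \<partial>lborel)"
    unfolding measure_def em using m by (intro integral_eq_nn_integral[symmetric]) auto
qed

context generating_points
begin

lemma hk_region_eq_below: "{p \<in> hk_region. snd p < 1} = {p \<in> C. snd p < 1}"
  by (auto simp: hk_region_def rpair_def cone_over_iff)

text \<open>The continuous analogue of \<open>snd_hk_set_less\<close>: at height
  \<open>card B\<close> some coefficient is at least 1, and then a whole generator can be subtracted
  within \<open>C\<close>.\<close>

lemma snd_hk_region: "p \<in> hk_region \<Longrightarrow> snd p < card B"
proof (rule ccontr)
  assume p: "p \<in> hk_region" "\<not> snd p < card B"
  then obtain c where c: "\<And>u. u \<in> B \<Longrightarrow> 0 \<le> c u" "p = (\<Sum>u\<in>B. c u *\<^sub>R rpair (u, 1))" "snd p = sum c B"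
    using C_decomp[of p] by (auto simp: hk_region_def)
  have "\<exists>u\<in>B. c u \<ge> 1"
  proof (rule ccontr)
    assume "\<not> (\<exists>u\<in>B. c u \<ge> 1)"
    then have "sum c B < (\<Sum>u\<in>B. 1)" using finite_B nonempty_B by (intro sum_strict_mono) auto
    then show False using p(2) c(3) by simp
  qed
  then obtain u where u: "u \<in> B" "c u \<ge> 1" by auto
  have "p - rpair (u, 1) = (c u - 1) *\<^sub>R rpair (u, 1) + (\<Sum>v\<in>B - {u}. c v *\<^sub>R rpair (v, 1))"
    unfolding c(2) sum.remove[OF finite_B u(1)] by (simp add: algebra_simps)
  moreover have "(\<Sum>v\<in>I. c v *\<^sub>R rpair (v, 1)) \<in> C" if "I \<subseteq> B" for I
    using that c(1) by (induction I rule: infinite_finite_induct)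
      (auto simp: zero_in_C intro!: cone_over_add cone_over_scaleR rpair_gen_in_C)
  ultimately have "p - rpair (u, 1) \<in> C"
    using u by (auto intro!: cone_over_add cone_over_scaleR rpair_gen_in_C)
  then show False using p(1) u(1) by (auto simp: hk_region_def)
qed

lemma bounded_hk_region: "bounded hk_region"
proof -
  obtain M where M: "M > 0" "\<And>p. p \<in> C \<Longrightarrow> norm p \<le> M * snd p" by (rule norm_C_le) blast
  show ?thesis
    unfolding bounded_iff
  proof (intro exI[of _ "M * card B"] ballI)
    fix p assume p: "p \<in> hk_region"
    then have "norm p \<le> M * snd p" using M(2) by (simp add: hk_region_def)
    also have "\<dots> \<le> M * card B" using snd_hk_region[OF p] M(1) by (intro mult_left_mono) auto
    finally show "norm p \<le> M * card B" .
  qed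
qed

lemma measure_hk_region:
  "measure lborel hk_region = measure lborel Q / (CARD('n) + 1) + measure lborel {p \<in> hk_region. 1 \<le> snd p}"
proof -
  have finite: "emeasure lborel {p \<in> hk_region. X p} \<noteq> \<infinity>" for X
    using emeasure_bounded_finite[OF bounded_subset[OF bounded_hk_region], of "{p \<in> hk_region. X p}"] by auto
  note m = sets_Int_halfspace_snd[OF sets_hk_region, of 1]
  have "measure lborel hk_region = measure lborel ({p \<in> hk_region. snd p < 1} \<union> {p \<in> hk_region. 1 \<le> snd p})"
    by (rule arg_cong[where f = "measure lborel"]) auto
  also have "\<dots> = measure lborel {p \<in> hk_region. snd p < 1} + measure lborel {p \<in> hk_region. 1 \<le> snd p}"
    using m finite by (intro measure_Union) auto
  also have "measure lborel {p \<in> hk_region. snd p < 1} = measure lborel Q / (CARD('n) + 1)"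
    unfolding hk_region_eq_below measure_def[of _ "{p \<in> C. snd p < 1}"] measure_cone_over_below[OF compact_Q] by simp
  finally show ?thesis .
qed

lemma hilbert_samuel_mult_volume:
  "hilbert_samuel_mult (semigroup_ring S :: ((int ^ 'n) \<times> int \<Rightarrow>\<^sub>0 'k::field) ring)
    (semigroup_algebra {s \<in> S. snd s > 0}) (CARD('n) + 1) = fact CARD('n) * measure lborel Q"
  unfolding hilbert_samuel_mult_eq measure_def[of _ "{p \<in> C. snd p < 1}"] measure_cone_over_below[OF compact_Q]
  by (simp add: field_simps)

end

section \<open>Multiples of a lattice polytope\<close>

text \<open>The function \<psi> of the overview. A negative \<open>l\<close> covers nothing and
  gives the value 1, so the integrals below are restricted to \<open>{0..L}\<close>.\<close>

definition uncovered_fraction :: "(real ^ 'n) set \<Rightarrow> real \<Rightarrow> real" where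
  "uncovered_fraction P l =
    measure lborel {x \<in> unit_cell. \<forall>v. (x - rvec v, l) \<notin> cone_over P}"

text \<open>Both properties pass to the dilates k P, so one polytope carries the analysis of all
  multiples of the divisor.\<close>

locale lattice_polytope =
  fixes P :: "(real ^ 'n) set"
  assumes gp: "generating_points (lattice_points P)"
    and P_eq: "P = convex hull (rvec ` lattice_points P)"
begin

abbreviation "multiple_points k \<equiv> lattice_points ((*\<^sub>R) (real k) ` P)"
abbreviation "cell_gap l \<equiv> {x \<in> unit_cell. \<forall>v. (x - rvec v, l) \<notin> cone_over P}"

lemma compact_P: "compact P"
  by (subst P_eq) (rule generating_points.compact_Q[OF gp])

lemma convex_P: "convex P"
  by (subst P_eq) (rule convex_convex_hull)

text \<open>In a hyperplane with normal a, all differences of lattice points of \<open>P\<close> are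
  orthogonal to a. They generate M, so a would be 0.\<close>

lemma interior_P: "interior P \<noteq> {}"
proof
  assume "interior P = {}"
  then obtain a b where ab: "a \<noteq> 0" "P \<subseteq> {x. a \<bullet> x = b}"
    using empty_interior_subset_hyperplane[OF convex_P] by blast
  let ?B = "lattice_points P"
  have "a \<bullet> rvec m = 0" for m
  proof -
    have "m \<in> generated_semigroup {u - v | u v. u \<in> ?B \<and> v \<in> ?B}"
      using generating_points.differences_generate[OF gp] by simp
    then show ?thesis
    proof induction
      case (add g s)
      then obtain u v where uv: "u \<in> ?B" "v \<in> ?B" "g = u - v" by auto
      have "rvec u \<in> P" "rvec v \<in> P" using uv by (auto simp: lattice_points_def)
      then have "a \<bullet> rvec u = b" "a \<bullet> rvec v = b" using ab(2) by auto
      then show ?case using add uv(3) by (simp add: inner_add_right inner_diff_right)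
    qed simp
  qed
  then have "a \<bullet> rvec (axis i 1) = 0" for i .
  moreover have "rvec (axis i 1) = (axis i 1 :: real ^ 'n)" for i by (simp add: rvec_def axis_def vec_eq_iff)
  ultimately have "a $ i = 0" for i by (metis inner_axis inner_real_def mult.right_neutral)
  then show False using ab(1) by (simp add: vec_eq_iff)
qed

definition V :: real where "V = measure lborel P"

lemma emeasure_P: "emeasure lborel P = ennreal V"
  unfolding V_def using emeasure_bounded_finite[OF compact_imp_bounded[OF compact_P]]
  by (intro emeasure_eq_ennreal_measure) auto

lemma V_pos: "V > 0"
proof (rule ccontr)
  assume "\<not> V > 0"
  then have "emeasure lborel P = 0" using emeasure_P by (simp add: ennreal_neg)
  then have "P \<in> null_sets lborel" using compact_P by (auto simp: null_sets_def borel_compact)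
  then have "negligible P" by (simp add: negligible_iff_null_sets null_sets_completionI)
  then show False using interior_P convex_P by (simp add: negligible_convex_interior)
qed

lemma nonempty_P: "P \<noteq> {}" using interior_P by auto

lemma measure_scaled: "0 \<le> c \<Longrightarrow> measure lborel ((*\<^sub>R) c ` P) = c ^ CARD('n) * V"
  by (simp add: measure_scaleR_image[OF compact_P] V_def)

lemma norm_cone_over_le:
  obtains M where "M > 0" "\<And>x t. (x, t) \<in> cone_over P \<Longrightarrow> norm x \<le> M * t"
proof -
  obtain M where M: "M > 0" "\<And>p. p \<in> cone_over P \<Longrightarrow> norm p \<le> M * snd p"
    by (rule generating_points.norm_C_le[OF gp, folded P_eq]) blast
  have "norm x \<le> M * t" if "(x, t) \<in> cone_over P" for x t
    using M(2)[OF that] norm_fst_le[of x t] by simp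
  then show ?thesis using M(1) that by blast
qed

lemma closed_cone_P: "closed (cone_over P)" by (rule closed_cone_over[OF compact_P])

lemma cone_over_scaled: "(x, t) \<in> cone_over ((*\<^sub>R) c ` P) \<longleftrightarrow> (x, c * t) \<in> cone_over P" if "c > 0"
  using that by (auto simp: cone_over_iff image_image zero_le_mult_iff mult.commute)

lemma scaled_lattice_points:
  assumes k: "k \<ge> 1"
  shows "generating_points (multiple_points k)"
    and "(*\<^sub>R) (real k) ` P = convex hull (rvec ` multiple_points k)"
proof -
  let ?B = "lattice_points P" and ?Bk = "multiple_points k"
  have cpt: "compact ((*\<^sub>R) (real k) ` P)" by (rule compact_scaling[OF compact_P])
  have cvx: "convex ((*\<^sub>R) (real k) ` P)" by (rule convex_scaling[OF convex_P])
  have rv: "rvec (int j *s b) = real j *\<^sub>R rvec b" for j and b :: "int ^ 'n" by (simp add: rvec_def vec_eq_iff)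
  have Bk: "int k *s b \<in> ?Bk" if "b \<in> ?B" for b
    using imageI[of "rvec b" P "(*\<^sub>R) (real k)"] that by (simp add: lattice_points_def rv)
  show eq: "(*\<^sub>R) (real k) ` P = convex hull (rvec ` ?Bk)"
  proof
    have "(*\<^sub>R) (real k) ` P = convex hull ((*\<^sub>R) (real k) ` (rvec ` ?B))"
      by (subst P_eq) (rule convex_hull_scaling[symmetric])
    also have "\<dots> \<subseteq> convex hull (rvec ` ?Bk)"
      using Bk by (intro hull_mono) (auto simp flip: rv)
    finally show "(*\<^sub>R) (real k) ` P \<subseteq> convex hull (rvec ` ?Bk)" .
    show "convex hull (rvec ` ?Bk) \<subseteq> (*\<^sub>R) (real k) ` P"
      by (rule hull_minimal) (auto simp: lattice_points_def cvx)
  qed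
  show "generating_points ?Bk"
  proof
    show "finite ?Bk" by (rule finite_lattice_points[OF compact_imp_bounded[OF cpt]])
    obtain u0 where u0: "u0 \<in> ?B" using generating_points.nonempty_B[OF gp] by auto
    show "?Bk \<noteq> {}" using Bk[OF u0] by auto
    have "x \<in> generated_semigroup {u - v | u v. u \<in> ?Bk \<and> v \<in> ?Bk}" for x
    proof -
      have "x \<in> generated_semigroup {u - v | u v. u \<in> ?B \<and> v \<in> ?B}"
        using generating_points.differences_generate[OF gp] by simp
      then show ?thesis
      proof induction
        case zero
        then show ?case by (rule generated_semigroup.zero)
      next
        case (add g s)
        then obtain u v where uv: "u \<in> ?B" "v \<in> ?B" "g = u - v" by auto
        \<comment> \<open>Translating by k - 1 copies of a fixed \<open>u0\<close> places every
          lattice point of \<open>P\<close> into k P without changing differences.\<close>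
        have mem: "int (k - 1) *s u0 + w \<in> ?Bk" if "w \<in> ?B" for w
        proof -
          have "((real k - 1) / real k) *\<^sub>R rvec u0 + (1 / real k) *\<^sub>R rvec w \<in> P"
            using u0 that k by (intro convexD[OF convex_P]) (auto simp: lattice_points_def field_simps)
          then have "real k *\<^sub>R (((real k - 1) / real k) *\<^sub>R rvec u0 + (1 / real k) *\<^sub>R rvec w) \<in> (*\<^sub>R) (real k) ` P"
            by (rule imageI)
          also have "real k *\<^sub>R (((real k - 1) / real k) *\<^sub>R rvec u0 + (1 / real k) *\<^sub>R rvec w) = rvec (int (k - 1) *s u0 + w)"
            using k by (simp add: scaleR_add_right scaleR_diff_left rv of_nat_diff del: of_nat_diff_if)
          finally show ?thesis by (simp add: lattice_points_def)
        qed
        have "g = (int (k - 1) *s u0 + u) - (int (k - 1) *s u0 + v)" using uv(3) by simp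
        then show ?case using mem uv(1,2) add.IH by (intro generated_semigroup.add) blast+
      qed
    qed
    then show "generated_semigroup {u - v | u v. u \<in> ?Bk \<and> v \<in> ?Bk} = UNIV" by auto
  qed
qed

text \<open>With \<open>t = 1 + l / k\<close> as height, this is the slice of the Hilbert-Kunz region of \<open>k P\<close>.\<close>

definition uncovered :: "nat \<Rightarrow> ((real ^ 'n) \<times> real) set" where
  "uncovered k = {p. (fst p, real k + snd p) \<in> cone_over P \<and> 0 \<le> snd p \<and>
    (\<forall>u\<in>multiple_points k. (fst p - rvec u, snd p) \<notin> cone_over P)}"

lemma finite_multiple_points: "finite (multiple_points k)"
  by (intro finite_lattice_points compact_imp_bounded compact_scaling compact_P)

lemma closed_shifted_cone: "closed {p. (fst p - x, c + snd p) \<in> cone_over P}"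
proof -
  have "closed ((\<lambda>p. (fst p - x, c + snd p)) -` cone_over P)"
    by (intro continuous_closed_vimage closed_cone_P) (auto intro!: continuous_intros)
  then show ?thesis by (simp add: vimage_def)
qed

lemma sets_shifted_cone: "{p. (fst p - x, c + snd p) \<in> cone_over P} \<in> sets borel"
  by (rule borel_closed[OF closed_shifted_cone])

lemma sets_uncovered: "uncovered k \<in> sets borel"
proof -
  have "uncovered k = ({p. (fst p - 0, real k + snd p) \<in> cone_over P} \<inter> {p. 0 \<le> snd p}) -
    (\<Union>u\<in>multiple_points k. {p. (fst p - rvec u, 0 + snd p) \<in> cone_over P})"
    by (auto simp: uncovered_def)
  also have "\<dots> \<in> sets borel"
    by (intro sets.Diff sets.Int sets.finite_UN finite_multiple_points sets_shifted_cone sets_halfspace_snd)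
  finally show ?thesis .
qed

text \<open>Decompose (x, k + l) over the lattice points of \<open>P\<close>. Rounding coefficients
  down loses at most 1 for each of them, so for l at least their number the integral parts still sum
  to k or more. Any k of these units form a lattice point w of k P, and the rest puts x - w into l
  P. The bound on l is the same for all k, which confines the integration to a fixed
  interval.\<close>

lemma uncovered_empty:
  assumes k: "k \<ge> 1" and l: "real (card (lattice_points P)) \<le> l"
  shows "(x, l) \<notin> uncovered k"
proof
  let ?B = "lattice_points P"
  assume un: "(x, l) \<in> uncovered k"
  then have "(x, real k + l) \<in> cone_over P" by (simp add: uncovered_def)
  then obtain c where c: "\<And>u. u \<in> ?B \<Longrightarrow> 0 \<le> c u" "(x, real k + l) = (\<Sum>u\<in>?B. c u *\<^sub>R rpair (u, 1))"
      and c3: "snd (x, real k + l) = sum c ?B"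
    by (rule generating_points.C_decomp[OF gp, folded P_eq]) blast
  have c3: "real k + l = sum c ?B" using c3 by simp
  have fin: "finite ?B" by (rule generating_points.finite_B[OF gp])
  have sub: "\<exists>g. (\<forall>u\<in>I. g u \<le> f u) \<and> sum g I = m" if "finite I" "m \<le> sum f I" for f :: "int ^ 'n \<Rightarrow> nat" and m I
    using that
  proof (induction I arbitrary: m rule: finite_induct)
    case (insert i I)
    have "m - min m (f i) \<le> sum f I" using insert by auto
    then obtain g where g: "\<forall>u\<in>I. g u \<le> f u" "sum g I = m - min m (f i)" using insert.IH by blast
    have "sum (g(i := min m (f i))) I = sum g I" using insert by (intro sum.cong) auto
    then show ?case using g insert by (intro exI[of _ "g(i := min m (f i))"]) auto
  qed simp
  have "real k < real (\<Sum>u\<in>?B. nat \<lfloor>c u\<rfloor>) + 1 \<or> ?B = {}"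
  proof -
    have "sum c ?B \<le> (\<Sum>u\<in>?B. real (nat \<lfloor>c u\<rfloor>) + 1)"
      by (rule sum_mono) linarith
    then have "real k + l \<le> real (\<Sum>u\<in>?B. nat \<lfloor>c u\<rfloor>) + real (card ?B)" using c3 by (simp add: sum.distrib)
    then show ?thesis using l by linarith
  qed
  then have "k \<le> (\<Sum>u\<in>?B. nat \<lfloor>c u\<rfloor>)" using generating_points.nonempty_B[OF gp] by linarith
  then obtain g where g: "\<forall>u\<in>?B. g u \<le> nat \<lfloor>c u\<rfloor>" "sum g ?B = k" using sub[OF fin] by blast
  have gc: "real (g u) \<le> c u" if "u \<in> ?B" for u
  proof -
    have "real (g u) \<le> real (nat \<lfloor>c u\<rfloor>)" using g(1) that by simp
    also have "\<dots> = of_int \<lfloor>c u\<rfloor>" using c(1)[OF that] by simp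
    also have "\<dots> \<le> c u" by simp
    finally show ?thesis .
  qed
  define w where "w = (\<Sum>u\<in>?B. int (g u) *s u)"
  have rw: "rvec w = (\<Sum>u\<in>?B. real (g u) *\<^sub>R rvec u)"
    unfolding w_def rvec_sum by (intro sum.cong) (auto simp: rvec_def vec_eq_iff)
  have comb: "(\<Sum>u\<in>?B. e u *\<^sub>R rpair (u, 1)) \<in> cone_over P" if "\<And>u. u \<in> ?B \<Longrightarrow> 0 \<le> e u" for e
  proof -
    have "(\<Sum>u\<in>I. e u *\<^sub>R rpair (u, 1)) \<in> cone_over P" if "I \<subseteq> ?B" for I
      using that \<open>\<And>u. u \<in> ?B \<Longrightarrow> 0 \<le> e u\<close>
        generating_points.zero_in_C[OF gp, folded P_eq] generating_points.rpair_gen_in_C[OF gp, folded P_eq]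
      by (induction I rule: infinite_finite_induct)
        (auto intro!: cone_over_add cone_over_scaleR convex_P)
    then show ?thesis by simp
  qed
  have pair: "(\<Sum>u\<in>?B. e u *\<^sub>R rpair (u, 1)) = (\<Sum>u\<in>?B. e u *\<^sub>R rvec u, sum e ?B)" for e
    by (simp add: rpair_def sum_prod)
  have "(rvec w, real k) \<in> cone_over P"
    using comb[of "\<lambda>u. real (g u)"] g(2) unfolding pair rw by (simp flip: of_nat_sum)
  then have "w \<in> multiple_points k" by (simp add: cone_over_iff lattice_points_def)
  moreover have "(x - rvec w, l) \<in> cone_over P"
  proof -
    have "(\<Sum>u\<in>?B. (c u - real (g u)) *\<^sub>R rpair (u, 1)) \<in> cone_over P" using gc by (intro comb) simp
    also have "(\<Sum>u\<in>?B. (c u - real (g u)) *\<^sub>R rpair (u, 1)) = (x - rvec w, l)"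
      using c(2) c3 g(2) unfolding pair rw by (simp add: scaleR_diff_left sum_subtractf flip: of_nat_sum)
    finally show ?thesis .
  qed
  ultimately show False using un by (auto simp: uncovered_def)
qed

end

section \<open>Asymptotics of the uncovered volume\<close>

context lattice_polytope
begin

lemma bounded_uncovered_slice: "bounded {x. (x, l) \<in> uncovered k}"
proof -
  obtain M where M: "M > 0" "\<And>x t. (x, t) \<in> cone_over P \<Longrightarrow> norm x \<le> M * t" by (rule norm_cone_over_le) blast
  show ?thesis unfolding bounded_iff using M(2) by (auto simp: uncovered_def intro!: exI[of _ "M * (real k + l)"])
qed

text \<open>The substitution t = 1 + l / k costs a Jacobian 1 / k. Since the volume of
  \<open>uncovered k\<close> is of order k^n, the second summand has order k^(n - 1) = k^(d - 2),
  the normalization in the theorem.\<close>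

lemma measure_hk_region_scaled:
  assumes k: "k \<ge> 1"
  shows "measure lborel (generating_points.hk_region (multiple_points k)) =
    real k ^ CARD('n) * V / (CARD('n) + 1) + measure lborel (uncovered k) / real k"
proof -
  let ?Bk = "multiple_points k"
  interpret K: generating_points ?Bk by (rule scaled_lattice_points(1)[OF k])
  have Q: "K.Q = (*\<^sub>R) (real k) ` P" using scaled_lattice_points(2)[OF k] by simp
  let ?E = "{p \<in> K.hk_region. 1 \<le> snd p}"
  have E: "?E \<in> sets borel" by (rule sets_Int_halfspace_snd[OF K.sets_hk_region])
  have slice: "{x. (x, 1 + (1 / real k) * l) \<in> ?E} = {x. (x, l) \<in> uncovered k}" for l
  proof -
    have "(x, 1 + (1 / real k) * l) \<in> K.C \<longleftrightarrow> (x, real k + l) \<in> cone_over P" for x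
      unfolding Q using k by (simp add: cone_over_scaled ring_distribs)
    moreover have "(x, 1 + (1 / real k) * l) - rpair (u, 1) \<in> K.C \<longleftrightarrow> (x - rvec u, l) \<in> cone_over P" for x u
      unfolding Q using k by (simp add: cone_over_scaled rpair_def)
    moreover have "1 \<le> 1 + (1 / real k) * l \<longleftrightarrow> 0 \<le> l" using k by (simp add: zero_le_divide_iff)
    ultimately show ?thesis unfolding K.hk_region_def uncovered_def by auto
  qed
  have "emeasure lborel ?E = (\<integral>\<^sup>+t. emeasure lborel {x. (x, t) \<in> ?E} \<partial>lborel)" by (rule emeasure_slices[OF E])
  also have "\<dots> = ennreal \<bar>1 / real k\<bar> * (\<integral>\<^sup>+l. emeasure lborel {x. (x, 1 + (1 / real k) * l) \<in> ?E} \<partial>lborel)"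
    using k by (intro nn_integral_real_affine[where t = 1] borel_measurable_emeasure_slice[OF E]) auto
  also have "\<dots> = ennreal (1 / real k) * emeasure lborel (uncovered k)"
    unfolding slice emeasure_slices[OF sets_uncovered] by simp
  finally have "measure lborel ?E = measure lborel (uncovered k) / real k"
    by (simp add: measure_def enn2real_mult)
  then show ?thesis unfolding K.measure_hk_region Q by (simp add: measure_scaled)
qed

lemma measure_uncovered:
  assumes k: "k \<ge> 1" and L: "real (card (lattice_points P)) \<le> L"
  shows "measure lborel (uncovered k) = (\<integral>l. measure lborel {x. (x, l) \<in> uncovered k} * indicator {0..L} l \<partial>lborel)"
proof -
  have em: "emeasure lborel {x. (x, l) \<in> uncovered k} =
    ennreal (measure lborel {x. (x, l) \<in> uncovered k} * indicator {0..L} l)" for l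
  proof (cases "l \<in> {0..L}")
    case True
    then show ?thesis
      using emeasure_bounded_finite[OF bounded_uncovered_slice, of l k] by (simp add: emeasure_eq_ennreal_measure)
  next
    case False
    then have "{x. (x, l) \<in> uncovered k} = {}"
      using uncovered_empty[OF k] L by (auto simp: uncovered_def)
    then show ?thesis by simp
  qed
  have "measure lborel (uncovered k) = enn2real (\<integral>\<^sup>+l. emeasure lborel {x. (x, l) \<in> uncovered k} \<partial>lborel)"
    unfolding measure_def emeasure_slices[OF sets_uncovered] ..
  also have "\<dots> = (\<integral>l. measure lborel {x. (x, l) \<in> uncovered k} * indicator {0..L} l \<partial>lborel)"
    unfolding em
  proof (rule integral_eq_nn_integral[symmetric])
    have [measurable]: "(\<lambda>l. measure lborel {x. (x, l) \<in> uncovered k}) \<in> borel_measurable borel"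
      by (rule borel_measurable_measure_slice[OF sets_uncovered])
    show "(\<lambda>l. measure lborel {x. (x, l) \<in> uncovered k} * indicator {0..L} l) \<in> borel_measurable lborel"
      by measurable
  qed auto
  finally show ?thesis .
qed

lemma borel_measurable_uncovered_fraction: "uncovered_fraction P \<in> borel_measurable borel"
proof -
  let ?F = "(unit_cell \<times> UNIV) - (\<Union>v. {p. (fst p - rvec v, 0 + snd p) \<in> cone_over P})"
  have "(unit_cell :: (real ^ 'n) set) \<times> (UNIV :: real set) \<in> sets borel"
    unfolding borel_prod[symmetric] by (intro pair_measureI) auto
  moreover have "(\<Union>v. {p. (fst p - rvec v, 0 + snd p) \<in> cone_over P}) \<in> sets borel"
    by (intro sets.countable_UN'') (auto simp: sets_shifted_cone[of _ 0, simplified])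
  ultimately have F: "?F \<in> sets borel" by (rule sets.Diff)
  have "uncovered_fraction P l = measure lborel {x. (x, l) \<in> ?F}" for l
    unfolding uncovered_fraction_def by (rule arg_cong[where f = "measure lborel"]) auto
  then have "uncovered_fraction P = (\<lambda>l. measure lborel {x. (x, l) \<in> ?F})" by (rule ext)
  then show ?thesis using borel_measurable_measure_slice[OF F] by simp
qed

lemma norm_uncovered_le:
  assumes l: "0 \<le> l"
  obtains R where "\<And>k x z. k > 0 \<Longrightarrow> x \<in> unit_cell \<Longrightarrow> (x + z, l) \<in> uncovered k \<Longrightarrow> norm z \<le> R * real k"
proof -
  obtain M where M: "M > 0" "\<And>x t. (x, t) \<in> cone_over P \<Longrightarrow> norm x \<le> M * t" by (rule norm_cone_over_le) blast
  have "norm z \<le> (M * (1 + l) + CARD('n)) * real k" if "k > 0" "x \<in> unit_cell" "(x + z, l) \<in> uncovered k" for k x z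
  proof -
    have "norm (x + z) \<le> M * (real k + l)" using that M(2) by (auto simp: uncovered_def)
    moreover have "norm z \<le> norm (x + z) + norm x" using norm_triangle_ineq4[of "x + z" x] by simp
    moreover have "norm x \<le> CARD('n)" using norm_unit_cell[OF that(2)] by simp
    ultimately have "norm z \<le> M * (real k + l) + CARD('n)" by linarith
    also have "\<dots> \<le> M * (real k + l * real k) + CARD('n) * real k"
      using that(1) l M(1) mult_left_mono[of 1 "real k" l] by (intro add_mono mult_left_mono) auto
    finally show ?thesis by (simp add: algebra_simps)
  qed
  then show ?thesis by (rule that)
qed

text \<open>If no lattice translate of l P contains x, none contains x + z either, so the count is
  that of all z with x + z in (k + l) P and grows like V k^n. If v + l P contains x, then v + z + l
  P contains x + z, and v + z is a lattice point of k P as soon as (v + z) / k lies in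
  \<open>P\<close>. Only z with z / k near the boundary of \<open>P\<close> can then remain, and
  their share tends to 0.\<close>

lemma card_uncovered_slice_tendsto:
  assumes l: "0 \<le> l" and x: "x \<in> unit_cell"
  shows "(\<lambda>k. card {z \<in> int_lattice. (x + z, l) \<in> uncovered k} / real k ^ CARD('n)) \<longlonglongrightarrow>
    (if \<forall>v. (x - rvec v, l) \<notin> cone_over P then V else 0)"
proof -
  obtain R where R: "\<And>k z. k > 0 \<Longrightarrow> (x + z, l) \<in> uncovered k \<Longrightarrow> norm z \<le> R * real k"
    using norm_uncovered_le[OF l] x by metis
  define D where "D = (if \<forall>v. (x - rvec v, l) \<notin> cone_over P then P else {})"
  have "(\<lambda>k. card {z \<in> int_lattice. (x + z, l) \<in> uncovered k} / real k ^ DIM(real ^ 'n)) \<longlonglongrightarrow> measure lborel D"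
  proof (rule lattice_card_tendsto[where R = R])
    show "D \<in> sets borel" using compact_P by (simp add: D_def borel_compact)
    show "norm z \<le> R * real k" if "k > 0" "z \<in> {z \<in> int_lattice. (x + z, l) \<in> uncovered k}" for k z
      using that R by simp
    show "AE y in lborel. \<forall>\<^sub>F k in sequentially.
      int_floor (real k *\<^sub>R y) \<in> {z \<in> int_lattice. (x + z, l) \<in> uncovered k} \<longleftrightarrow> y \<in> D"
      using AE_notin_frontier_convex[OF convex_P]
    proof eventually_elim
      case (elim y)
      define z where "z k = int_floor (real k *\<^sub>R y)" for k
      have zl: "z k \<in> int_lattice" for k by (simp add: z_def int_floor_in_lattice)
      have lim: "(\<lambda>k. z k /\<^sub>R real k) \<longlonglongrightarrow> y" unfolding z_def by (rule tendsto_int_floor_scaleR)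
      have inv0: "(\<lambda>k. inverse (real k)) \<longlonglongrightarrow> 0" using lim_inverse_n by simp
      have lim1: "(\<lambda>k. (w + z k) /\<^sub>R real k) \<longlonglongrightarrow> y" for w
      proof -
        have "(\<lambda>k. inverse (real k) *\<^sub>R w + z k /\<^sub>R real k) \<longlonglongrightarrow> 0 *\<^sub>R w + y"
          by (intro tendsto_add tendsto_scaleR inv0 tendsto_const lim)
        then show ?thesis by (simp add: scaleR_add_right)
      qed
      have lim2: "(\<lambda>k. (x + z k) /\<^sub>R (real k + l)) \<longlonglongrightarrow> y"
      proof -
        have "(\<lambda>k. real k / (real k + l)) \<longlonglongrightarrow> 1" by real_asymp
        then have "(\<lambda>k. (real k / (real k + l)) *\<^sub>R ((x + z k) /\<^sub>R real k)) \<longlonglongrightarrow> 1 *\<^sub>R y"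
          by (intro tendsto_scaleR lim1)
        moreover have "\<forall>\<^sub>F k in sequentially. (real k / (real k + l)) *\<^sub>R ((x + z k) /\<^sub>R real k) = (x + z k) /\<^sub>R (real k + l)"
          using eventually_gt_at_top[of 0] by eventually_elim (use l in \<open>simp add: field_simps\<close>)
        ultimately show ?thesis using Lim_transform_eventually by fastforce
      qed
      show ?case
      proof (cases "y \<in> P")
        case False
        then have "\<forall>\<^sub>F k in sequentially. (x + z k) /\<^sub>R (real k + l) \<in> - P"
          using compact_imp_closed[OF compact_P] by (intro topological_tendstoD[OF lim2]) auto
        then show ?thesis
          using eventually_gt_at_top[of 0]
        proof eventually_elim
          case (elim k)
          have "(x + z k, l) \<notin> uncovered k"
          proof
            assume "(x + z k, l) \<in> uncovered k"
            then obtain p where "p \<in> P" "x + z k = (real k + l) *\<^sub>R p" by (auto simp: uncovered_def cone_over_iff)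
            then show False using elim l by simp
          qed
          then show ?case using False by (auto simp: D_def z_def)
        qed
      next
        case True
        then have int: "y \<in> interior P" using elim compact_imp_closed[OF compact_P] by (simp add: frontier_def closure_closed)
        show ?thesis
        proof (cases "\<forall>v. (x - rvec v, l) \<notin> cone_over P")
          case un: True
          have "\<forall>\<^sub>F k in sequentially. (x + z k) /\<^sub>R (real k + l) \<in> interior P"
            using int by (rule topological_tendstoD[OF lim2 open_interior])
          then show ?thesis
            using eventually_gt_at_top[of 0]
          proof eventually_elim
            case (elim k)
            have "(x + z k) /\<^sub>R (real k + l) \<in> P" using elim interior_subset by blast
            then have "(real k + l) *\<^sub>R ((x + z k) /\<^sub>R (real k + l)) \<in> (*\<^sub>R) (real k + l) ` P" by (rule imageI)
            then have "(x + z k, real k + l) \<in> cone_over P" using elim l by (simp add: cone_over_iff)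
            moreover have "(x + z k - rvec u, l) \<notin> cone_over P" for u
            proof -
              obtain v where "z k = rvec v" using zl[of k] unfolding range_rvec[symmetric] by auto
              then show ?thesis using un[rule_format, of "u - v"] by (simp add: algebra_simps)
            qed
            ultimately have "(x + z k, l) \<in> uncovered k" using l by (simp add: uncovered_def)
            then show ?case using un True zl[of k] by (simp add: D_def z_def)
          qed
        next
          case cov: False
          then obtain v where v: "(x - rvec v, l) \<in> cone_over P" by auto
          have "\<forall>\<^sub>F k in sequentially. (rvec v + z k) /\<^sub>R real k \<in> interior P"
            using int by (rule topological_tendstoD[OF lim1 open_interior])
          then show ?thesis
            using eventually_gt_at_top[of 0]
          proof eventually_elim
            case (elim k)
            obtain u where u: "z k = rvec u" using zl[of k] unfolding range_rvec[symmetric] by auto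
            have "(rvec v + z k) /\<^sub>R real k \<in> P" using elim interior_subset by blast
            then have "real k *\<^sub>R ((rvec v + z k) /\<^sub>R real k) \<in> (*\<^sub>R) (real k) ` P" by (rule imageI)
            then have "v + u \<in> multiple_points k" using elim by (simp add: lattice_points_def u)
            moreover have "(x + z k - rvec (v + u), l) \<in> cone_over P" using v by (simp add: u)
            ultimately have "(x + z k, l) \<notin> uncovered k"
              unfolding uncovered_def mem_Collect_eq fst_conv snd_conv by blast
            then show ?case using cov by (auto simp: D_def z_def)
          qed
        qed
      qed
    qed
  qed auto
  moreover have "measure lborel D = (if \<forall>v. (x - rvec v, l) \<notin> cone_over P then V else 0)"
    by (simp add: D_def V_def)
  ultimately show ?thesis by simp
qed

lemma sets_cell_gap: "cell_gap l \<in> sets borel"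
proof -
  have "closed ((\<lambda>x. (x - rvec v, l)) -` cone_over P)" for v
    by (intro continuous_closed_vimage closed_cone_P) (auto intro!: continuous_intros)
  then have "unit_cell - (\<Union>v. (\<lambda>x. (x - rvec v, l)) -` cone_over P) \<in> sets borel"
    by (intro sets.Diff sets.countable_UN'' sets_unit_cell) (auto intro: borel_closed)
  also have "unit_cell - (\<Union>v. (\<lambda>x. (x - rvec v, l)) -` cone_over P) =
    cell_gap l" by auto
  finally show ?thesis .
qed

text \<open>Folding the slice into the unit cell turns its volume into an integral of the preceding
  counts, and \<open>card_int_lattice_le\<close> supplies the dominating constant.\<close>

lemma measure_uncovered_slice_tendsto:
  assumes l: "0 \<le> l"
  shows "(\<lambda>k. measure lborel {x. (x, l) \<in> uncovered k} / real k ^ CARD('n)) \<longlonglongrightarrow> V * uncovered_fraction P l"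
proof -
  obtain R where R: "\<And>k x z. k > 0 \<Longrightarrow> x \<in> unit_cell \<Longrightarrow> (x + z, l) \<in> uncovered k \<Longrightarrow> norm z \<le> R * real k"
    by (rule norm_uncovered_le[OF l]) blast
  let ?N = "\<lambda>k x. real (card {z \<in> int_lattice. x + z \<in> {x. (x, l) \<in> uncovered k}}) * indicator unit_cell x"
  let ?U = "cell_gap l"
  define c where "c = measure lborel (cball 0 (R + DIM(real ^ 'n)) :: (real ^ 'n) set)"
  have Nm [measurable]: "?N k \<in> borel_measurable borel" for k
    by (rule unfold_lattice_real(1)[OF sets_slice[OF sets_uncovered] bounded_uncovered_slice])
  have lim: "(\<lambda>k. \<integral>x. ?N (Suc k) x / real (Suc k) ^ CARD('n) \<partial>lborel) \<longlonglongrightarrow> (\<integral>x. V * indicator ?U x \<partial>lborel)"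
  proof (rule integral_dominated_convergence[where w = "\<lambda>x. c * indicator unit_cell x"])
    show "integrable lborel (\<lambda>x. c * indicator (unit_cell :: (real ^ 'n) set) x)"
      by (intro integrable_mult_right integrable_real_indicator) (auto simp: emeasure_unit_cell)
    show "(\<lambda>x. V * indicator ?U x) \<in> borel_measurable lborel"
      using sets_cell_gap[of l] by measurable
    show "AE x in lborel. (\<lambda>k. ?N (Suc k) x / real (Suc k) ^ CARD('n)) \<longlonglongrightarrow> V * indicator ?U x"
    proof (rule AE_I2)
      fix x :: "real ^ 'n"
      show "(\<lambda>k. ?N (Suc k) x / real (Suc k) ^ CARD('n)) \<longlonglongrightarrow> V * indicator ?U x"
      proof (cases "x \<in> unit_cell")
        case True
        have "V * indicator ?U x = (if \<forall>v. (x - rvec v, l) \<notin> cone_over P then V else 0)"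
          using True by (simp add: indicator_def)
        then show ?thesis using LIMSEQ_Suc[OF card_uncovered_slice_tendsto[OF l True]] True by simp
      qed simp
    qed
    show "AE x in lborel. norm (?N (Suc k) x / real (Suc k) ^ CARD('n)) \<le> c * indicator unit_cell x" for k
    proof (rule AE_I2)
      fix x :: "real ^ 'n"
      show "norm (?N (Suc k) x / real (Suc k) ^ CARD('n)) \<le> c * indicator unit_cell x"
      proof (cases "x \<in> unit_cell")
        case True
        have "card {z \<in> int_lattice. x + z \<in> {x. (x, l) \<in> uncovered (Suc k)}} / real (Suc k) ^ DIM(real ^ 'n) \<le> c"
          unfolding c_def by (rule card_int_lattice_le) (use R[of "Suc k"] True in auto)
        then show ?thesis using True by (simp del: of_nat_Suc)
      qed simp
    qed
  qed measurable
  have int: "(\<integral>x. V * indicator ?U x \<partial>lborel) = V * uncovered_fraction P l"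
    using sets_cell_gap[of l] by (simp add: uncovered_fraction_def)
  have eq: "(\<integral>x. ?N (Suc k) x / real (Suc k) ^ CARD('n) \<partial>lborel) =
      measure lborel {x. (x, l) \<in> uncovered (Suc k)} / real (Suc k) ^ CARD('n)" for k
    by (subst unfold_lattice_real(3)[OF sets_slice[OF sets_uncovered] bounded_uncovered_slice])
      (simp only: integral_divide_zero)
  from lim show ?thesis unfolding eq int by (rule LIMSEQ_imp_Suc)
qed

lemma measure_uncovered_slice_le:
  assumes "0 \<le> l"
  shows "measure lborel {x. (x, l) \<in> uncovered k} \<le> (real k + l) ^ CARD('n) * V"
proof -
  have cpt: "compact ((*\<^sub>R) (real k + l) ` P)" by (rule compact_scaling[OF compact_P])
  have "measure lborel {x. (x, l) \<in> uncovered k} \<le> measure lborel ((*\<^sub>R) (real k + l) ` P)"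
  proof (rule measure_mono_fmeasurable)
    show "{x. (x, l) \<in> uncovered k} \<subseteq> (*\<^sub>R) (real k + l) ` P" by (auto simp: uncovered_def cone_over_iff)
    show "{x. (x, l) \<in> uncovered k} \<in> sets lborel" using sets_slice[OF sets_uncovered] by simp
    show "(*\<^sub>R) (real k + l) ` P \<in> fmeasurable lborel"
      using cpt by (intro fmeasurableI emeasure_bounded_finite compact_imp_bounded) (auto simp: borel_compact)
  qed
  then show ?thesis using assms by (simp add: measure_scaled)
qed

lemma measure_uncovered_tendsto:
  assumes L: "real (card (lattice_points P)) \<le> L"
  shows "(\<lambda>k. measure lborel (uncovered k) / real k ^ CARD('n)) \<longlonglongrightarrow>
    V * (\<integral>l. uncovered_fraction P l * indicator {0..L} l \<partial>lborel)"
proof -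
  note [measurable] = borel_measurable_uncovered_fraction borel_measurable_measure_slice[OF sets_uncovered]
  have "(\<lambda>k. \<integral>l. measure lborel {x. (x, l) \<in> uncovered (Suc k)} * indicator {0..L} l / real (Suc k) ^ CARD('n) \<partial>lborel)
    \<longlonglongrightarrow> (\<integral>l. V * (uncovered_fraction P l * indicator {0..L} l) \<partial>lborel)"
  \<comment> \<open>For l \<le> L and k \<ge> 1 one has (k + l)^n \<le> ((1 + L) k)^n, and a slice
    has volume at most (k + l)^n V.\<close>
  proof (rule integral_dominated_convergence[where w = "\<lambda>l. (1 + L) ^ CARD('n) * V * indicator {0..L} l"])
    show "integrable lborel (\<lambda>l. (1 + L) ^ CARD('n) * V * indicator {0..L} l)"
      by (intro integrable_mult_right integrable_real_indicator) (auto simp: emeasure_lborel_Icc_eq)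
    show "AE l in lborel. (\<lambda>k. measure lborel {x. (x, l) \<in> uncovered (Suc k)} * indicator {0..L} l / real (Suc k) ^ CARD('n))
      \<longlonglongrightarrow> V * (uncovered_fraction P l * indicator {0..L} l)"
    proof (rule AE_I2)
      fix l
      show "(\<lambda>k. measure lborel {x. (x, l) \<in> uncovered (Suc k)} * indicator {0..L} l / real (Suc k) ^ CARD('n))
        \<longlonglongrightarrow> V * (uncovered_fraction P l * indicator {0..L} l)"
        using LIMSEQ_Suc[OF measure_uncovered_slice_tendsto[of l]] by (cases "l \<in> {0..L}") auto
    qed
    show "AE l in lborel. norm (measure lborel {x. (x, l) \<in> uncovered (Suc k)} * indicator {0..L} l / real (Suc k) ^ CARD('n))
      \<le> (1 + L) ^ CARD('n) * V * indicator {0..L} l" for k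
    proof (rule AE_I2)
      fix l
      show "norm (measure lborel {x. (x, l) \<in> uncovered (Suc k)} * indicator {0..L} l / real (Suc k) ^ CARD('n))
        \<le> (1 + L) ^ CARD('n) * V * indicator {0..L} l"
      proof (cases "l \<in> {0..L}")
        case True
        have "real (Suc k) + l \<le> (1 + L) * real (Suc k)"
        proof -
          have "l \<le> L * real (Suc k)" using True mult_mono[of l L 1 "real (Suc k)"] by simp
          then show ?thesis by (simp add: algebra_simps)
        qed
        then have "(real (Suc k) + l) ^ CARD('n) \<le> ((1 + L) * real (Suc k)) ^ CARD('n)"
          using True by (intro power_mono) auto
        then have "(real (Suc k) + l) ^ CARD('n) * V \<le> ((1 + L) ^ CARD('n) * V) * real (Suc k) ^ CARD('n)"
          using V_pos by (simp add: power_mult_distrib mult_right_mono mult.assoc mult.commute[of V] del: of_nat_Suc)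
        then have "measure lborel {x. (x, l) \<in> uncovered (Suc k)} \<le> ((1 + L) ^ CARD('n) * V) * real (Suc k) ^ CARD('n)"
          using measure_uncovered_slice_le[of l "Suc k"] True by simp
        then show ?thesis using True by (simp add: divide_le_eq del: of_nat_Suc)
      qed simp
    qed
  qed measurable
  moreover have "(\<integral>l. measure lborel {x. (x, l) \<in> uncovered (Suc k)} * indicator {0..L} l / real (Suc k) ^ CARD('n) \<partial>lborel) =
    measure lborel (uncovered (Suc k)) / real (Suc k) ^ CARD('n)" for k
    by (subst measure_uncovered[OF _ L]) (simp_all only: integral_divide_zero le_add1 plus_1_eq_Suc)
  ultimately have "(\<lambda>k. measure lborel (uncovered (Suc k)) / real (Suc k) ^ CARD('n)) \<longlonglongrightarrow>
    V * (\<integral>l. uncovered_fraction P l * indicator {0..L} l \<partial>lborel)"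
    by simp
  then show ?thesis by (rule LIMSEQ_imp_Suc)
qed

end

section \<open>Coverings and tilings\<close>

context lattice_polytope
begin

lemma covered_iff_lattice:
  assumes "0 \<le> l"
  shows "(\<exists>v. (x - rvec v, l) \<in> cone_over P) \<longleftrightarrow> (\<exists>z\<in>int_lattice. x + z \<in> (*\<^sub>R) l ` P)"
proof
  assume "\<exists>v. (x - rvec v, l) \<in> cone_over P"
  then obtain v where v: "(x - rvec v, l) \<in> cone_over P" by auto
  have "rvec (- v) \<in> int_lattice" unfolding range_rvec[symmetric] by (rule rangeI)
  then show "\<exists>z\<in>int_lattice. x + z \<in> (*\<^sub>R) l ` P" using v by (intro bexI[of _ "rvec (- v)"]) (auto simp: cone_over_iff)
next
  assume "\<exists>z\<in>int_lattice. x + z \<in> (*\<^sub>R) l ` P"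
  then obtain v where "x + rvec v \<in> (*\<^sub>R) l ` P" unfolding range_rvec[symmetric] by auto
  then have "(x - rvec (- v), l) \<in> cone_over P" using assms by (simp add: cone_over_iff)
  then show "\<exists>v. (x - rvec v, l) \<in> cone_over P" by blast
qed

abbreviation "lattice_count l x \<equiv> card {z \<in> int_lattice. x + z \<in> (*\<^sub>R) l ` P}"

lemma finite_lattice_count: "finite {z \<in> int_lattice. x + z \<in> (*\<^sub>R) l ` P}"
proof (rule finite_int_lattice_bounded)
  have "bounded ((+) (- x) ` (*\<^sub>R) l ` P)"
    by (intro bounded_translation bounded_scaling compact_imp_bounded compact_P)
  then show "bounded {z \<in> int_lattice. x + z \<in> (*\<^sub>R) l ` P}"
    by (rule bounded_subset) (auto intro!: image_eqI simp: algebra_simps)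
qed auto

lemma lattice_count_0_iff:
  assumes "0 \<le> l"
  shows "lattice_count l x = 0 \<longleftrightarrow> (\<forall>v. (x - rvec v, l) \<notin> cone_over P)"
  using covered_iff_lattice[OF assms, of x] finite_lattice_count[of x l] by auto

text \<open>On the unit cell \<open>f\<close> is the excess max 0 (N - 1), where N is the number of
  lattice translates of l P that contain x. The mean of N over the cell is the volume l^n V.
  Nonnegativity of the excess yields the lower bound for \<psi>, its vanishing the equality
  case.\<close>

lemma uncovered_fraction_excess:
  assumes l: "0 \<le> l"
  defines "f \<equiv> \<lambda>x. (real (lattice_count l x) - 1 + (if lattice_count l x = 0 then 1 else 0)) * indicator unit_cell x"
  shows "integrable lborel f" "(\<integral>x. f x \<partial>lborel) = l ^ CARD('n) * V - 1 + uncovered_fraction P l"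
proof -
  let ?U = "cell_gap l"
  have cpt: "compact ((*\<^sub>R) l ` P)" by (rule compact_scaling[OF compact_P])
  have i1: "integrable lborel (\<lambda>x. real (lattice_count l x) * indicator unit_cell x)"
    and e1: "(\<integral>x. real (lattice_count l x) * indicator unit_cell x \<partial>lborel) = l ^ CARD('n) * V"
    using unfold_lattice_real(2,3)[of "(*\<^sub>R) l ` P"] cpt l
    by (simp_all add: borel_compact compact_imp_bounded measure_scaled)
  have i2: "integrable lborel (indicator (unit_cell :: (real ^ 'n) set) :: _ \<Rightarrow> real)"
    by (intro integrable_real_indicator) (auto simp: emeasure_unit_cell)
  have U: "?U \<in> sets lborel" using sets_cell_gap[of l] by simp
  have i3: "integrable lborel (indicator ?U :: _ \<Rightarrow> real)"
    by (rule integrable_real_indicator[OF U])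
      (rule le_less_trans[OF emeasure_mono[of ?U unit_cell]], auto simp: emeasure_unit_cell)
  have feq: "f x = real (lattice_count l x) * indicator unit_cell x - indicator unit_cell x + indicator ?U x" for x
    unfolding f_def by (cases "x \<in> unit_cell") (simp_all add: lattice_count_0_iff[OF l] indicator_def)
  show "integrable lborel f" unfolding feq using i1 i2 i3 by auto
  have "(\<integral>x. f x \<partial>lborel) = (\<integral>x. real (lattice_count l x) * indicator unit_cell x \<partial>lborel)
      - (\<integral>x. indicator (unit_cell :: (real ^ 'n) set) x \<partial>lborel) + (\<integral>x. indicator ?U x \<partial>lborel)"
    unfolding feq using i1 i2 i3 by simp
  also have "(\<integral>x. indicator (unit_cell :: (real ^ 'n) set) x \<partial>lborel) = (1 :: real)"
    using emeasure_unit_cell[where 'a = "real ^ 'n"] by (simp add: measure_def)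
  also have "(\<integral>x. indicator ?U x \<partial>lborel) = uncovered_fraction P l" using U by (simp add: uncovered_fraction_def)
  finally show "(\<integral>x. f x \<partial>lborel) = l ^ CARD('n) * V - 1 + uncovered_fraction P l" using e1 by simp
qed

lemma uncovered_fraction_ge: "0 \<le> l \<Longrightarrow> 1 - l ^ CARD('n) * V \<le> uncovered_fraction P l"
proof -
  assume l: "0 \<le> l"
  have "0 \<le> (\<integral>x. (real (lattice_count l x) - 1 + (if lattice_count l x = 0 then 1 else 0)) * indicator unit_cell x \<partial>lborel)"
  proof (rule Bochner_Integration.integral_nonneg)
    fix x
    show "0 \<le> (real (lattice_count l x) - 1 + (if lattice_count l x = 0 then 1 else 0)) * indicator unit_cell x"
      by (cases "lattice_count l x") (auto simp: indicator_def)
  qed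
  then show ?thesis unfolding uncovered_fraction_excess(2)[OF l] by linarith
qed

lemma uncovered_fraction_eq_iff:
  assumes l: "0 \<le> l"
  shows "uncovered_fraction P l = 1 - l ^ CARD('n) * V \<longleftrightarrow> (AE x in lborel. x \<in> unit_cell \<longrightarrow> lattice_count l x \<le> 1)"
proof -
  let ?f = "\<lambda>x. (real (lattice_count l x) - 1 + (if lattice_count l x = 0 then 1 else 0)) * indicator unit_cell x"
  have nn: "0 \<le> ?f x" for x by (cases "lattice_count l x") (auto simp: indicator_def)
  have "uncovered_fraction P l = 1 - l ^ CARD('n) * V \<longleftrightarrow> (\<integral>x. ?f x \<partial>lborel) = 0"
    unfolding uncovered_fraction_excess(2)[OF l] by linarith
  also have "\<dots> \<longleftrightarrow> (AE x in lborel. ?f x = 0)"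
    by (rule integral_nonneg_eq_0_iff_AE[OF uncovered_fraction_excess(1)[OF l]]) (use nn in auto)
  also have "\<dots> \<longleftrightarrow> (AE x in lborel. x \<in> unit_cell \<longrightarrow> lattice_count l x \<le> 1)"
    by (rule AE_cong) (auto simp: indicator_def)
  finally show ?thesis .
qed

lemma uncovered_fraction_nonneg: "0 \<le> uncovered_fraction P l"
  by (simp add: uncovered_fraction_def)

lemma uncovered_fraction_le_1: "uncovered_fraction P l \<le> 1"
proof -
  have "uncovered_fraction P l \<le> measure lborel (unit_cell :: (real ^ 'n) set)"
    unfolding uncovered_fraction_def using sets_cell_gap[of l]
    by (intro measure_mono_fmeasurable fmeasurableI) (auto simp: emeasure_unit_cell)
  also have "\<dots> = 1" using emeasure_unit_cell[where 'a = "real ^ 'n"] by (simp add: measure_def)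
  finally show ?thesis .
qed

definition overlap :: "real \<Rightarrow> int ^ 'n \<Rightarrow> int ^ 'n \<Rightarrow> (real ^ 'n) set" where
  "overlap l v v' = (+) (rvec v) ` (*\<^sub>R) l ` P \<inter> (+) (rvec v') ` (*\<^sub>R) l ` P"

lemma translate_iff: "0 \<le> l \<Longrightarrow> x \<in> (+) w ` (*\<^sub>R) l ` P \<longleftrightarrow> (x - w, l) \<in> cone_over P"
  by (auto simp: cone_over_iff image_iff algebra_simps)

lemma overlap_iff:
  "0 \<le> l \<Longrightarrow> x \<in> overlap l v v' \<longleftrightarrow> (x - rvec v, l) \<in> cone_over P \<and> (x - rvec v', l) \<in> cone_over P"
  by (simp only: overlap_def Int_iff translate_iff)

lemma compact_overlap: "compact (overlap l v v')"
  unfolding overlap_def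
  by (intro compact_Int compact_translation compact_scaling compact_P)

lemma convex_overlap: "convex (overlap l v v')"
  unfolding overlap_def by (intro convex_Int convex_translation convex_scaling convex_P)

text \<open>For a convex set, being null, having empty interior and having lower dimension are the
  same. This translates the dimension condition on tilings into measure theory.\<close>

lemma overlap_low_dim_iff: "aff_dim (overlap l v v') < int CARD('n) \<longleftrightarrow> overlap l v v' \<in> null_sets lborel"
proof -
  have "overlap l v v' \<in> null_sets lborel \<longleftrightarrow> negligible (overlap l v v')"
    using compact_overlap by (simp add: negligible_iff_null_sets null_sets_completion_iff borel_compact)
  also have "\<dots> \<longleftrightarrow> interior (overlap l v v') = {}" by (rule negligible_convex_interior[OF convex_overlap])
  also have "\<dots> \<longleftrightarrow> aff_dim (overlap l v v') < int CARD('n)"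
  proof
    assume int: "interior (overlap l v v') = {}"
    show "aff_dim (overlap l v v') < int CARD('n)"
    proof (rule ccontr)
      assume "\<not> aff_dim (overlap l v v') < int CARD('n)"
      then have full: "aff_dim (overlap l v v') = int (DIM(real ^ 'n))"
        using aff_dim_le_DIM[of "overlap l v v'"] by simp
      then have "rel_interior (overlap l v v') = {}"
        using int rel_interior_interior by (metis aff_dim_eq_full)
      then have "overlap l v v' = {}" using rel_interior_eq_empty[OF convex_overlap] by blast
      then show False using full by simp
    qed
  next
    assume "aff_dim (overlap l v v') < int CARD('n)"
    then show "interior (overlap l v v') = {}"
      using aff_dim_nonempty_interior[of "overlap l v v'"] by force
  qed
  finally show ?thesis by simp
qed

lemma tiles_iff:
  assumes l: "0 \<le> l"
  shows "tiles_space_for P l \<longleftrightarrow> (\<forall>x. \<exists>v. (x - rvec v, l) \<in> cone_over P) \<and>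
    (\<forall>v v'. v \<noteq> v' \<longrightarrow> overlap l v v' \<in> null_sets lborel)"
  unfolding tiles_space_for_def overlap_low_dim_iff[symmetric] overlap_def[symmetric]
  by (auto simp: set_eq_iff translate_iff[OF l])

text \<open>With p0 in \<open>P\<close>, adding (r - l) p0 moves v + l P into v + r P for every v by
  the same vector, so a translate of the smaller overlap lies in the larger one.\<close>

lemma overlap_null_mono:
  assumes "overlap r v v' \<in> null_sets lborel" "0 \<le> l" "l \<le> r"
  shows "overlap l v v' \<in> null_sets lborel"
proof -
  obtain p0 where p0: "p0 \<in> P" using nonempty_P by auto
  have step: "(x + (r - l) *\<^sub>R p0 - w, r) \<in> cone_over P" if "(x - w, l) \<in> cone_over P" for x w
  proof -
    have "((r - l) *\<^sub>R p0, r - l) \<in> cone_over P" using p0 assms(3) by (simp add: cone_over_iff imageI)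
    from cone_over_add[OF convex_P that this] show ?thesis by (simp add: algebra_simps)
  qed
  have "overlap l v v' \<subseteq> {x. (r - l) *\<^sub>R p0 + 1 *\<^sub>R x \<in> overlap r v v'}"
  proof
    fix x assume x: "x \<in> overlap l v v'"
    then have "x + (r - l) *\<^sub>R p0 \<in> overlap r v v'"
      using step assms(2,3) by (simp add: overlap_iff)
    then show "x \<in> {x. (r - l) *\<^sub>R p0 + 1 *\<^sub>R x \<in> overlap r v v'}" by (simp add: add.commute)
  qed
  moreover have "{x. (r - l) *\<^sub>R p0 + 1 *\<^sub>R x \<in> overlap r v v'} \<in> null_sets lborel"
  proof -
    have b: "overlap r v v' \<in> sets borel" using compact_overlap by (rule borel_compact)
    have "(\<lambda>x. (r - l) *\<^sub>R p0 + 1 *\<^sub>R x) -` overlap r v v' \<inter> space borel \<in> sets borel"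
      by (rule measurable_sets[OF _ b]) measurable
    then show ?thesis
      using emeasure_lborel_affine[OF b, of 1 "(r - l) *\<^sub>R p0"] assms(1) by (simp add: null_sets_def vimage_def)
  qed
  ultimately show ?thesis using compact_overlap by (auto intro: null_sets_subset simp: borel_compact)
qed

text \<open>A point counted twice lies in an overlap of two distinct translates, and there are only
  countably many pairs.\<close>

lemma lattice_count_le_1_AE:
  assumes l: "0 \<le> l" and null: "\<And>v v'. v \<noteq> v' \<Longrightarrow> overlap l v v' \<in> null_sets lborel"
  shows "AE x in lborel. x \<in> unit_cell \<longrightarrow> lattice_count l x \<le> 1"
proof -
  have "(\<Union>p\<in>{(v, v'). v \<noteq> v'}. overlap l (fst p) (snd p)) \<in> null_sets lborel"
    using null by (intro null_sets_UN') auto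
  then have "AE x in lborel. x \<notin> (\<Union>p\<in>{(v, v'). v \<noteq> v'}. overlap l (fst p) (snd p))" by (rule AE_not_in)
  then show ?thesis
  proof eventually_elim
    case (elim x)
    have "z = z'" if z: "z \<in> int_lattice" "z' \<in> int_lattice" "x + z \<in> (*\<^sub>R) l ` P" "x + z' \<in> (*\<^sub>R) l ` P" for z z'
    proof (rule ccontr)
      assume ne: "z \<noteq> z'"
      obtain v v' where v: "z = rvec v" "z' = rvec v'" using z(1,2) unfolding range_rvec[symmetric] by auto
      have "x \<in> overlap l (- v) (- v')"
        using z(3,4) l by (simp add: overlap_iff v cone_over_iff)
      moreover have "- v \<noteq> - v'" using ne v by auto
      ultimately have "x \<in> (\<Union>p\<in>{(v, v'). v \<noteq> v'}. overlap l (fst p) (snd p))"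
        by (intro UN_I[of "(- v, - v')"]) simp_all
      then show False using elim by contradiction
    qed
    then show ?case using card_le_Suc0_iff_eq[OF finite_lattice_count] by auto
  qed
qed

text \<open>Null overlaps persist for smaller factors, and covering persists for larger ones. At r
  itself both formulas hold, which forces r^n V = 1 and joins them into one maximum.\<close>

lemma uncovered_fraction_of_tiling:
  assumes r: "0 < r" "tiles_space_for P r" and l: "0 \<le> l"
  shows "uncovered_fraction P l = max 0 (1 - l ^ CARD('n) * V)"
proof -
  have cover: "\<exists>v. (x - rvec v, r) \<in> cone_over P" for x using r tiles_iff[of r] by auto
  have null: "v \<noteq> v' \<Longrightarrow> overlap r v v' \<in> null_sets lborel" for v v' using r tiles_iff[of r] by auto
  have below: "uncovered_fraction P s = 1 - s ^ CARD('n) * V" if "0 \<le> s" "s \<le> r" for s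
  proof -
    have "AE x in lborel. x \<in> unit_cell \<longrightarrow> lattice_count s x \<le> 1"
      by (rule lattice_count_le_1_AE[OF that(1)]) (rule overlap_null_mono[OF null that])
    then show ?thesis using uncovered_fraction_eq_iff[OF that(1)] by blast
  qed
  have above: "uncovered_fraction P s = 0" if s: "r \<le> s" for s
  proof -
    obtain p0 where p0: "p0 \<in> P" using nonempty_P by auto
    have "\<exists>v. (x - rvec v, s) \<in> cone_over P" for x
    proof -
      obtain v where v: "(x - (s - r) *\<^sub>R p0 - rvec v, r) \<in> cone_over P" using cover by blast
      have "((s - r) *\<^sub>R p0, s - r) \<in> cone_over P" using p0 s by (simp add: cone_over_iff imageI)
      from cone_over_add[OF convex_P v this] show ?thesis by (auto simp: algebra_simps)
    qed
    then have emp: "cell_gap s = {}" by auto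
    show ?thesis unfolding uncovered_fraction_def emp by simp
  qed
  have rV: "r ^ CARD('n) * V = 1" using below[of r] above[of r] r by simp
  show ?thesis
  proof (cases "l \<le> r")
    case True
    then have "l ^ CARD('n) * V \<le> r ^ CARD('n) * V" using l V_pos by (intro mult_right_mono power_mono) auto
    then show ?thesis using below[OF l True] rV by simp
  next
    case False
    then have "r ^ CARD('n) * V \<le> l ^ CARD('n) * V" using r V_pos by (intro mult_right_mono power_mono) auto
    then show ?thesis using above[of l] False rV by simp
  qed
qed

text \<open>The uncovered set is invariant under the lattice, so it is null as soon as its part in
  one cell is.\<close>

lemma uncovered_null:
  assumes "uncovered_fraction P l = 0"
  shows "{x. \<forall>v. (x - rvec v, l) \<notin> cone_over P} \<in> null_sets lborel"
proof -
  let ?U = "{x. \<forall>v. (x - rvec v, l) \<notin> cone_over P}"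
  have "closed ((\<lambda>x. (x - rvec v, l)) -` cone_over P)" for v
    by (intro continuous_closed_vimage closed_cone_P) (auto intro!: continuous_intros)
  then have "UNIV - (\<Union>v. (\<lambda>x. (x - rvec v, l)) -` cone_over P) \<in> sets borel"
    by (intro sets.Diff sets.countable_UN'') (auto intro: borel_closed)
  also have "UNIV - (\<Union>v. (\<lambda>x. (x - rvec v, l)) -` cone_over P) = ?U" by auto
  finally have U: "?U \<in> sets borel" .
  have "emeasure lborel (?U \<inter> unit_cell) = 0"
  proof -
    have "?U \<inter> unit_cell = cell_gap l" by auto
    moreover have "emeasure lborel (cell_gap l) =
      ennreal (measure lborel (cell_gap l))"
    proof -
      have "emeasure lborel (cell_gap l) < \<infinity>"
        by (rule le_less_trans[OF emeasure_mono[of _ unit_cell]]) (auto simp: emeasure_unit_cell)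
      then show ?thesis by (intro emeasure_eq_ennreal_measure) auto
    qed
    ultimately show ?thesis using assms by (simp add: uncovered_fraction_def)
  qed
  then have "?U \<inter> unit_cell \<in> null_sets lborel" using U by (auto simp: null_sets_def)
  then have "AE x in lborel. x \<notin> ?U \<inter> unit_cell" by (rule AE_not_in)
  then show ?thesis
  proof (intro null_sets_unfold_lattice[OF U], eventually_elim, intro impI ballI)
    fix x z :: "real ^ 'n"
    assume x: "x \<notin> ?U \<inter> unit_cell" "x \<in> unit_cell" and "z \<in> int_lattice"
    then obtain u v where "(x - rvec v, l) \<in> cone_over P" "z = rvec u" unfolding range_rvec[symmetric] by blast
    then have "(x + z - rvec (u + v), l) \<in> cone_over P" by simp
    then show "x + z \<notin> ?U" by blast
  qed
qed

text \<open>Passing to the limit is possible since the covering translates stay in a bounded region.\<close>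

lemma covering_limit:
  assumes r: "0 \<le> r" and dense: "\<And>e. 0 < e \<Longrightarrow> \<exists>l. r < l \<and> l < r + e \<and> uncovered_fraction P l = 0"
  shows "\<exists>v. (x - rvec v, r) \<in> cone_over P"
proof -
  obtain M where M: "M > 0" "\<And>x t. (x, t) \<in> cone_over P \<Longrightarrow> norm x \<le> M * t" by (rule norm_cone_over_le) blast
  have "\<exists>y l v. dist y x < inverse (real (Suc j)) \<and> r < l \<and> l < r + inverse (real (Suc j)) \<and> (y - rvec v, l) \<in> cone_over P" for j
  proof -
    have e: "0 < inverse (real (Suc j))" by simp
    obtain l where l: "r < l" "l < r + inverse (real (Suc j))" "uncovered_fraction P l = 0" using dense[OF e] by auto
    \<comment> \<open>A ball has positive volume, so some point near x is covered even though
      covering holds only almost everywhere.\<close>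
    have "\<not> ball x (inverse (real (Suc j))) \<subseteq> {x. \<forall>v. (x - rvec v, l) \<notin> cone_over P}"
    proof
      assume "ball x (inverse (real (Suc j))) \<subseteq> {x. \<forall>v. (x - rvec v, l) \<notin> cone_over P}"
      then have "ball x (inverse (real (Suc j))) \<in> null_sets lborel"
        using uncovered_null[OF l(3)] by (rule null_sets_subset[rotated 2]) auto
      then have "negligible (ball x (inverse (real (Suc j))))" by (simp add: negligible_iff_null_sets null_sets_completionI)
      then show False using open_not_negligible[OF open_ball] e by (metis centre_in_ball empty_iff)
    qed
    then show ?thesis using l by (auto simp: dist_commute)
  qed
  then obtain y l v where yl: "\<And>j. dist (y j) x < inverse (real (Suc j))" "\<And>j. r < l j" "\<And>j. l j < r + inverse (real (Suc j))"
    and v: "\<And>j. (y j - rvec (v j), l j) \<in> cone_over P" by metis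
  have le1: "inverse (real (Suc j)) \<le> 1" for j by (simp add: inverse_le_1_iff)
  have "finite (rvec ` range v)"
  proof (rule finite_int_lattice_bounded)
    show "bounded (rvec ` range v)"
      unfolding bounded_iff
    proof (intro exI[of _ "M * (r + 1) + norm x + 1"] ballI)
      fix w assume "w \<in> rvec ` range v"
      then obtain j where w: "w = rvec (v j)" by auto
      have "norm (y j - w) \<le> M * l j" using M(2)[OF v] w by simp
      also have "\<dots> \<le> M * (r + 1)" using yl(3)[of j] le1[of j] M(1) by (intro mult_left_mono) auto
      finally have "norm (y j - w) \<le> M * (r + 1)" .
      moreover have "norm (y j - x) \<le> 1" using yl(1)[of j] le1[of j] by (simp add: dist_norm)
      moreover have "norm w \<le> norm (y j - w) + (norm (y j - x) + norm x)"
        using norm_triangle_ineq4[of "y j" "y j - w"] norm_triangle_ineq[of "y j - x" x] by simp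
      ultimately show "norm w \<le> M * (r + 1) + norm x + 1" by linarith
    qed
  qed (auto simp flip: range_rvec)
  then have "finite (range v)" by (rule finite_imageD) (use inj_rvec in \<open>auto intro: inj_on_subset\<close>)
  \<comment> \<open>A single translate serves infinitely many j, so closedness of the cone can be
    applied to a fixed lattice vector.\<close>
  then obtain j0 where j0: "infinite {j \<in> UNIV. v j = v j0}" using pigeonhole_infinite[of UNIV v] by auto
  have "(x - rvec (v j0), r) \<in> cone_over P"
  proof (rule ccontr)
    assume "(x - rvec (v j0), r) \<notin> cone_over P"
    have inv: "(\<lambda>j. inverse (real (Suc j))) \<longlonglongrightarrow> 0" by (rule LIMSEQ_inverse_real_of_nat)
    have "y \<longlonglongrightarrow> x" using yl(1) by (intro metric_tendsto_imp_tendsto[OF inv]) (auto intro!: always_eventually less_imp_le)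
    moreover have "l \<longlonglongrightarrow> r"
    proof (rule tendsto_sandwich[of "\<lambda>_. r" _ _ "\<lambda>j. r + inverse (real (Suc j))"])
      show "(\<lambda>j. r + inverse (real (Suc j))) \<longlonglongrightarrow> r" using tendsto_add[OF tendsto_const inv, of r] by simp
    qed (use yl in \<open>auto intro!: always_eventually less_imp_le\<close>)
    ultimately have "(\<lambda>j. (y j - rvec (v j0), l j)) \<longlonglongrightarrow> (x - rvec (v j0), r)" by (intro tendsto_intros)
    then have "\<forall>\<^sub>F j in sequentially. (y j - rvec (v j0), l j) \<in> - cone_over P"
      by (rule topological_tendstoD) (use closed_cone_P \<open>(x - rvec (v j0), r) \<notin> cone_over P\<close> in auto)
    then obtain N where N: "\<And>j. j \<ge> N \<Longrightarrow> (y j - rvec (v j0), l j) \<notin> cone_over P" by (auto simp: eventually_sequentially)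
    obtain j where "j \<ge> N" "v j = v j0" using j0 unfolding infinite_nat_iff_unbounded_le by auto
    then show False using N[of j] v[of j] by simp
  qed
  then show ?thesis by blast
qed

text \<open>Covering at r is a limit from larger factors. Then \<psi> r = 0 = 1 - r^n V is the
  equality case at r, so almost no point is covered twice and the overlaps are null.\<close>

lemma tiling_of_uncovered_fraction:
  assumes r: "0 < r" "r ^ CARD('n) * V = 1" and dense: "\<And>e. 0 < e \<Longrightarrow> \<exists>l. r < l \<and> l < r + e \<and> uncovered_fraction P l = 0"
  shows "tiles_space_for P r"
proof -
  have r0: "0 \<le> r" using r by simp
  have cover: "\<exists>v. (x - rvec v, r) \<in> cone_over P" for x by (rule covering_limit[OF r0 dense])
  then have emp: "cell_gap r = {}" by auto
  have "uncovered_fraction P r = 0" unfolding uncovered_fraction_def emp by simp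
  then have ae: "AE x in lborel. x \<in> unit_cell \<longrightarrow> lattice_count r x \<le> 1"
    using r uncovered_fraction_eq_iff[OF r0] by simp
  have "overlap r v v' \<in> null_sets lborel" if ne: "v \<noteq> v'" for v v'
  proof -
    have O: "overlap r v v' \<in> sets borel" using compact_overlap by (rule borel_compact)
    show ?thesis
      using ae
    proof (intro null_sets_unfold_lattice[OF O], eventually_elim, intro impI ballI notI)
      fix x z :: "real ^ 'n"
      assume "x \<in> unit_cell \<longrightarrow> lattice_count r x \<le> 1" "x \<in> unit_cell"
        and z: "z \<in> int_lattice" and "x + z \<in> overlap r v v'"
      then have le: "lattice_count r x \<le> 1"
        and mem: "x + (z - rvec v) \<in> (*\<^sub>R) r ` P" "x + (z - rvec v') \<in> (*\<^sub>R) r ` P"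
        using r0 by (auto simp: overlap_iff cone_over_iff add_diff_eq)
      have "z - rvec w \<in> int_lattice" for w
        using z by (intro int_lattice_diff) (auto simp flip: range_rvec)
      then have "z - rvec v = z - rvec v'"
        using le mem unfolding One_nat_def card_le_Suc0_iff_eq[OF finite_lattice_count] by blast
      then show False using ne by simp
    qed
  qed
  then show ?thesis using cover tiles_iff[OF r0] by blast
qed


section \<open>Integration over the dilation factor\<close>

lemma integral_lower_bound:
  assumes r: "0 < r" "r ^ CARD('n) * V = 1" "r \<le> L"
  shows "(\<integral>l. max 0 (1 - l ^ CARD('n) * V) * indicator {0..L} l \<partial>lborel) = r * (real CARD('n) / (real CARD('n) + 1))"
proof -
  have eq: "max 0 (1 - l ^ CARD('n) * V) * indicator {0..L} l = (1 - l ^ CARD('n) * V) * indicator {0..r} l" for l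
  proof -
    consider "l < 0" | "0 \<le> l" "l \<le> r" | "r < l" by linarith
    then show ?thesis
    proof cases
      case 2
      then have "l ^ CARD('n) * V \<le> r ^ CARD('n) * V" using V_pos by (intro mult_right_mono power_mono) auto
      then show ?thesis using 2 r by (simp add: indicator_def)
    next
      case 3
      then have "r ^ CARD('n) * V \<le> l ^ CARD('n) * V" using r V_pos by (intro mult_right_mono power_mono) auto
      then show ?thesis using 3 r by (simp add: indicator_def)
    qed simp
  qed
  have "(\<integral>l. (1 - l ^ CARD('n) * V) * indicator {0..r} l \<partial>lborel) =
    (r - r ^ (CARD('n) + 1) / (CARD('n) + 1) * V) - (0 - 0 ^ (CARD('n) + 1) / (CARD('n) + 1) * V)"
  proof (rule integral_FTC_Icc_real)
    fix x :: real
    show "DERIV (\<lambda>l. l - l ^ (CARD('n) + 1) / (CARD('n) + 1) * V) x :> 1 - x ^ CARD('n) * V"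
      by (rule derivative_eq_intros refl | simp)+
    show "isCont (\<lambda>l. 1 - l ^ CARD('n) * V) x" by (intro continuous_intros)
  qed (use r in auto)
  also have "\<dots> = r - r * (r ^ CARD('n) * V) / (CARD('n) + 1)" by (simp add: mult_ac)
  also have "\<dots> = r * (real CARD('n) / (real CARD('n) + 1))" unfolding r(2) by (simp add: field_simps)
  finally show ?thesis unfolding eq .
qed

text \<open>The integrands satisfy \<open>h l \<le> f l\<close>, so equality of the integrals means
  equality almost everywhere. A set of full measure meets every interval to the right of r, where
  \<open>h\<close> is 0, and this supplies covering factors arbitrarily close to r. Conversely, a
  tiling gives equality pointwise.\<close>

lemma uncovered_integral:
  assumes r: "0 < r" "r ^ CARD('n) * V = 1" "r < L"
  defines "I \<equiv> \<integral>l. uncovered_fraction P l * indicator {0..L} l \<partial>lborel"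
  shows "r * (real CARD('n) / (real CARD('n) + 1)) \<le> I"
    and "I = r * (real CARD('n) / (real CARD('n) + 1)) \<longleftrightarrow> (\<exists>s>0. tiles_space_for P s)"
proof -
  define h where "h l = max 0 (1 - l ^ CARD('n) * V) * indicator {0..L} l" for l :: real
  define f where "f l = uncovered_fraction P l * indicator {0..L} l" for l
  have hI: "(\<integral>l. h l \<partial>lborel) = r * (real CARD('n) / (real CARD('n) + 1))"
    unfolding h_def using r by (intro integral_lower_bound) auto
  have iL: "integrable lborel (\<lambda>l. indicator {0..L} l :: real)"
    by (intro integrable_real_indicator) (auto simp: emeasure_lborel_Icc_eq)
  have fm [measurable]: "f \<in> borel_measurable borel"
    unfolding f_def using borel_measurable_uncovered_fraction by measurable
  have hm [measurable]: "h \<in> borel_measurable borel" unfolding h_def by measurable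
  have fi: "integrable lborel f"
    by (rule Bochner_Integration.integrable_bound[OF iL])
      (auto simp: f_def indicator_def uncovered_fraction_nonneg uncovered_fraction_le_1)
  have hi: "integrable lborel h"
  proof (rule Bochner_Integration.integrable_bound[OF iL])
    show "AE l in lborel. norm (h l) \<le> norm (indicator {0..L} l :: real)"
      using V_pos by (intro AE_I2) (auto simp: h_def indicator_def)
  qed simp
  have le: "h l \<le> f l" for l
    unfolding h_def f_def using uncovered_fraction_nonneg uncovered_fraction_ge[of l] by (auto simp: indicator_def)
  have I: "I = (\<integral>l. f l \<partial>lborel)" unfolding I_def f_def ..
  have diff: "I - r * (real CARD('n) / (real CARD('n) + 1)) = (\<integral>l. f l - h l \<partial>lborel)"
    unfolding I hI[symmetric] using fi hi by simp
  have "0 \<le> (\<integral>l. f l - h l \<partial>lborel)" using le by (intro Bochner_Integration.integral_nonneg) simp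
  then show "r * (real CARD('n) / (real CARD('n) + 1)) \<le> I" using diff by linarith
  have "I = r * (real CARD('n) / (real CARD('n) + 1)) \<longleftrightarrow> (\<integral>l. f l - h l \<partial>lborel) = 0" using diff by linarith
  also have "\<dots> \<longleftrightarrow> (AE l in lborel. f l - h l = 0)"
    using fi hi le by (intro integral_nonneg_eq_0_iff_AE) auto
  also have "\<dots> \<longleftrightarrow> (\<exists>s>0. tiles_space_for P s)"
  proof
    assume ae: "AE l in lborel. f l - h l = 0"
    have "tiles_space_for P r"
    proof (rule tiling_of_uncovered_fraction[OF r(1,2)])
      fix e :: real assume e: "0 < e"
      \<comment> \<open>The cap at \<open>L\<close> keeps \<open>l\<close> inside
        \<open>{0..L}\<close>, where \<open>f\<close> agrees with \<psi>; the assumption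
        \<open>r < L\<close> leaves room.\<close>
      define b where "b = min (r + e) L"
      have b: "r < b" using e r(3) by (simp add: b_def)
      have "\<exists>l\<in>{r<..<b}. f l - h l = 0"
      proof (rule ccontr)
        assume no: "\<not> (\<exists>l\<in>{r<..<b}. f l - h l = 0)"
        have "AE l in lborel. l \<notin> {r<..<b}" using ae by eventually_elim (use no in auto)
        then have "emeasure lborel {r<..<b} = 0" by (subst (asm) AE_iff_null_sets[symmetric]) auto
        then show False using b by simp
      qed
      then obtain l where l: "r < l" "l < b" "f l - h l = 0" by auto
      have "r ^ CARD('n) * V \<le> l ^ CARD('n) * V" using l r V_pos by (intro mult_right_mono power_mono) auto
      then have "uncovered_fraction P l = 0" using l r by (simp add: f_def h_def b_def indicator_def)
      then show "\<exists>l. r < l \<and> l < r + e \<and> uncovered_fraction P l = 0" using l by (intro exI[of _ l]) (auto simp: b_def)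
    qed
    then show "\<exists>s>0. tiles_space_for P s" using r(1) by blast
  next
    assume "\<exists>s>0. tiles_space_for P s"
    then obtain s where s: "0 < s" "tiles_space_for P s" by auto
    show "AE l in lborel. f l - h l = 0"
      using uncovered_fraction_of_tiling[OF s] by (intro AE_I2) (auto simp: f_def h_def indicator_def)
  qed
  finally show "I = r * (real CARD('n) / (real CARD('n) + 1)) \<longleftrightarrow> (\<exists>s>0. tiles_space_for P s)" .
qed

end

section \<open>Multiplicities of the multiples of a divisor\<close>

lemma toric_pair_lattice_polytope:
  fixes a :: "int ^ 'n \<Rightarrow> int"
  assumes "toric_pair TYPE('k::alg_closed_field) \<Delta> a"
  shows "lattice_polytope (divisor_polytope \<Delta> a)"
  by (intro lattice_polytope.intro toric_pair_generating_points[OF assms] divisor_polytope_eq_convex_hull[OF assms])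

lemma divisor_polytope_multiple:
  assumes k: "k \<ge> 1"
  shows "divisor_polytope \<Delta> (divisor_multiple k a) = (*\<^sub>R) (real k) ` divisor_polytope \<Delta> a"
proof (intro equalityI subsetI)
  fix u assume u: "u \<in> divisor_polytope \<Delta> (divisor_multiple k a)"
  have "u /\<^sub>R real k \<in> divisor_polytope \<Delta> a"
    unfolding divisor_polytope_def
  proof (intro CollectI ballI)
    fix v assume "v \<in> ray_gens \<Delta>"
    then have "real k * - real_of_int (a v) \<le> u \<bullet> rvec v"
      using u by (simp add: divisor_polytope_def divisor_multiple_def)
    then have "- real_of_int (a v) \<le> (u \<bullet> rvec v) / real k" using k by (simp add: le_divide_eq mult.commute)
    then show "- real_of_int (a v) \<le> (u /\<^sub>R real k) \<bullet> rvec v" by (simp add: divide_inverse mult.commute)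
  qed
  then have "real k *\<^sub>R (u /\<^sub>R real k) \<in> (*\<^sub>R) (real k) ` divisor_polytope \<Delta> a" by (rule imageI)
  then show "u \<in> (*\<^sub>R) (real k) ` divisor_polytope \<Delta> a" using k by simp
next
  fix u assume "u \<in> (*\<^sub>R) (real k) ` divisor_polytope \<Delta> a"
  then obtain w where w: "w \<in> divisor_polytope \<Delta> a" "u = real k *\<^sub>R w" by auto
  show "u \<in> divisor_polytope \<Delta> (divisor_multiple k a)"
    unfolding divisor_polytope_def
  proof (intro CollectI ballI)
    fix v assume "v \<in> ray_gens \<Delta>"
    then have "real k * - real_of_int (a v) \<le> real k * (w \<bullet> rvec v)"
      using w(1) by (intro mult_left_mono) (auto simp: divisor_polytope_def)
    then show "- real_of_int (divisor_multiple k a v) \<le> u \<bullet> rvec v" by (simp add: divisor_multiple_def w(2))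
  qed
qed

context lattice_polytope
begin

lemma coord_max_ideal_eq:
  "coord_max_ideal \<Delta> a = (semigroup_algebra {s \<in> coord_semigroup \<Delta> a. snd s > 0} :: ((int ^ 'n) \<times> int \<Rightarrow>\<^sub>0 'k::field) set)"
  by (auto simp: coord_max_ideal_def coord_ring_def semigroup_algebra_def)

lemma multiplicities_of_multiple:
  fixes a :: "int ^ 'n \<Rightarrow> int"
  assumes P: "P = divisor_polytope \<Delta> a" and p: "CHAR('k::field) > 0" and k: "k \<ge> 1"
  shows "e0 TYPE('k) \<Delta> (divisor_multiple k a) = fact CARD('n) * (real k ^ CARD('n) * V)"
    and "eHK TYPE('k) \<Delta> (divisor_multiple k a) =
      real k ^ CARD('n) * V / (CARD('n) + 1) + measure lborel (uncovered k) / real k"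
proof -
  let ?Bk = "multiple_points k"
  interpret K: generating_points ?Bk by (rule scaled_lattice_points(1)[OF k])
  have Q: "K.Q = (*\<^sub>R) (real k) ` P" using scaled_lattice_points(2)[OF k] by simp
  have S: "coord_semigroup \<Delta> (divisor_multiple k a) = K.S"
    by (simp add: coord_semigroup_def divisor_polytope_multiple[OF k] P)
  show "e0 TYPE('k) \<Delta> (divisor_multiple k a) = fact CARD('n) * (real k ^ CARD('n) * V)"
    unfolding e0_def coord_max_ideal_eq coord_ring_def S K.hilbert_samuel_mult_volume Q by (simp add: measure_scaled)
  show "eHK TYPE('k) \<Delta> (divisor_multiple k a) =
      real k ^ CARD('n) * V / (CARD('n) + 1) + measure lborel (uncovered k) / real k"
    unfolding eHK_def coord_max_ideal_eq coord_ring_def S K.hilbert_kunz_mult_eq[OF refl p]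
    by (rule measure_hk_region_scaled[OF k])
qed

lemma multiplicity_defect_tendsto:
  fixes a :: "int ^ 'n \<Rightarrow> int"
  assumes P: "P = divisor_polytope \<Delta> a" and p: "CHAR('k::field) > 0" and d: "d = CARD('n) + 1"
    and L: "real (card (lattice_points P)) \<le> L"
  shows "(\<lambda>k. (eHK TYPE('k) \<Delta> (divisor_multiple k a) - e0 TYPE('k) \<Delta> (divisor_multiple k a) / fact d) / real k ^ (d - 2))
    \<longlonglongrightarrow> V * (\<integral>l. uncovered_fraction P l * indicator {0..L} l \<partial>lborel)"
proof (rule Lim_transform_eventually[OF measure_uncovered_tendsto[OF L]])
  show "\<forall>\<^sub>F k in sequentially. measure lborel (uncovered k) / real k ^ CARD('n) =
    (eHK TYPE('k) \<Delta> (divisor_multiple k a) - e0 TYPE('k) \<Delta> (divisor_multiple k a) / fact d) / real k ^ (d - 2)"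
    using eventually_ge_at_top[of 1]
  proof eventually_elim
    case (elim k)
    have e0d: "e0 TYPE('k) \<Delta> (divisor_multiple k a) / fact d = real k ^ CARD('n) * V / (CARD('n) + 1)"
    proof -
      have "fact d = (real CARD('n) + 1) * fact CARD('n)" using d by (simp add: algebra_simps)
      then show ?thesis
        unfolding multiplicities_of_multiple(1)[OF P p elim]
        by (simp only: mult.commute[of "fact CARD('n)"] of_nat_add of_nat_1
          nonzero_mult_divide_mult_cancel_right[OF fact_nonzero])
    qed
    \<comment> \<open>The dimension is d - 1 \<ge> 1, so the truncated subtraction d - 2 is
      exact.\<close>
    have "Suc (d - 2) = CARD('n)" using d zero_less_card_finite[where 'a = 'n] by linarith
    then have "real k ^ CARD('n) = real k * real k ^ (d - 2)" by (metis power_Suc)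
    then show ?case unfolding e0d multiplicities_of_multiple(2)[OF P p elim] by simp
  qed
qed

end

theorem theorem6p3:
  fixes \<Delta> :: "(real ^ 'n) set set" and a :: "int ^ 'n \<Rightarrow> int" and d :: nat
  assumes "CHAR('k::alg_closed_field) > 0"
    and "d = CARD('n) + 1"
    and "toric_pair TYPE('k) \<Delta> a"
  shows "\<exists>L :: real.
      (\<lambda>k. (eHK TYPE('k) \<Delta> (divisor_multiple k a) - e0 TYPE('k) \<Delta> (divisor_multiple k a) / fact d)
             / real k ^ (d - 2)) \<longlonglongrightarrow> L \<and>
      e0 TYPE('k) \<Delta> a powr ((2 - real d) / (real d - 1)) * L
        \<ge> (real d - 1) / real d * fact (d - 1) powr ((2 - real d) / (real d - 1)) \<and>
      (e0 TYPE('k) \<Delta> a powr ((2 - real d) / (real d - 1)) * L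
         = (real d - 1) / real d * fact (d - 1) powr ((2 - real d) / (real d - 1))
       \<longleftrightarrow> (\<exists>r>0. tiles_space_for (divisor_polytope \<Delta> a) r))"
proof -
  define P where "P = divisor_polytope \<Delta> a"
  interpret lattice_polytope P unfolding P_def by (rule toric_pair_lattice_polytope[OF assms(3)])
  define n where "n = real CARD('n)"
  have n: "n > 0" by (simp add: n_def)
  \<comment> \<open>The factor at which r P has volume 1, hence the only one at which P can
    tile.\<close>
  define r where "r = V powr (- 1 / n)"
  have r: "0 < r" using V_pos by (simp add: r_def)
  have rV: "r ^ CARD('n) * V = 1"
  proof -
    have "r ^ CARD('n) = r powr n" using r by (simp add: n_def powr_realpow)
    also have "\<dots> = V powr (- 1)" using n by (simp add: r_def powr_powr)
    finally show ?thesis using V_pos by (simp add: powr_minus)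
  qed
  \<comment> \<open>Uncovered slices are empty from the number of lattice points on, and
    \<open>r < L\<close> allows r to be approached from the right.\<close>
  define L where "L = real (card (lattice_points P)) + r + 1"
  define I where "I = (\<integral>l. uncovered_fraction P l * indicator {0..L} l \<partial>lborel)"
  have lim: "(\<lambda>k. (eHK TYPE('k) \<Delta> (divisor_multiple k a) - e0 TYPE('k) \<Delta> (divisor_multiple k a) / fact d)
      / real k ^ (d - 2)) \<longlonglongrightarrow> V * I"
    unfolding I_def by (rule multiplicity_defect_tendsto[OF P_def assms(1,2)]) (use r in \<open>simp add: L_def\<close>)
  have rL: "r < L" by (simp add: L_def)
  have bound: "r * (n / (n + 1)) \<le> I" and equality: "I = r * (n / (n + 1)) \<longleftrightarrow> (\<exists>s>0. tiles_space_for P s)"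
    using uncovered_integral[OF r rV rL] by (simp_all only: I_def n_def)
  define s where "s = (2 - real d) / (real d - 1)"
  \<comment> \<open>This exponent makes the volume cancel: V^s V = V^(1/n) = 1 / r.\<close>
  have s: "s = 1 / n - 1" using n assms(2) by (simp add: s_def n_def field_simps)
  have "divisor_multiple 1 a = a" by (simp add: divisor_multiple_def)
  then have e0: "e0 TYPE('k) \<Delta> a = fact (d - 1) * V"
    using multiplicities_of_multiple(1)[OF P_def assms(1), of 1] assms(2) by simp
  define c where "c = (fact (d - 1) :: real) powr s"
  have c: "c > 0" by (simp add: c_def)
  have "e0 TYPE('k) \<Delta> a powr s * (V * I) = c * (V powr s * V) * I"
    unfolding e0 c_def using V_pos by (simp add: powr_mult)
  also have "V powr s * V = V powr (s + 1)" using V_pos by (simp add: powr_add)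
  also have "\<dots> = 1 / r" using V_pos by (simp add: s r_def powr_minus_divide)
  finally have lhs: "e0 TYPE('k) \<Delta> a powr s * (V * I) = c / r * I" by simp
  have rhs: "(real d - 1) / real d * fact (d - 1) powr s = c / r * (r * (n / (n + 1)))"
    using r assms(2) by (simp add: c_def n_def add.commute)
  have cr: "c / r > 0" using c r by simp
  show ?thesis
    unfolding s_def[symmetric] P_def[symmetric]
  proof (intro exI[of _ "V * I"] conjI lim)
    show "(real d - 1) / real d * fact (d - 1) powr s \<le> e0 TYPE('k) \<Delta> a powr s * (V * I)"
      unfolding lhs rhs using bound cr by (intro mult_left_mono) auto
    show "e0 TYPE('k) \<Delta> a powr s * (V * I) = (real d - 1) / real d * fact (d - 1) powr s \<longleftrightarrow>
        (\<exists>r>0. tiles_space_for P r)"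
      unfolding lhs rhs equality[symmetric] using cr by (metis less_irrefl mult_cancel_left)
  qed
qed

end
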